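(* Let $(W,S)$ be a Coxeter system, let $\underline{s}=(s_1,\ldots,s_n)$ be a finite sequence of elements of $S$ and let $w\in W$. Let $E$ be the set of all positive integers $d$ such that $d$ divides the order of some element of finite order in $W$ that is a product of at most two entries of $\underline{s}$. Then the cycle space of the graph $\mathfrak{S}(\underline{s},w)$ is spanned by the cycles of $\mathfrak{S}(\underline{s},w)$ whose lengths belong to $\{d+2\mid d\in E\}$.
   Context: A subexpression of $\underline{s}=(s_1,\ldots,s_n)$ with target $w$ is a sequence $(\epsilon_1,\ldots,\epsilon_n)$ with entries in $\{0,1\}$ such that $s_1^{\epsilon_1}s_2^{\epsilon_2}\cdots s_n^{\epsilon_n}=w$. The graph $\mathfrak{S}(\underline{s},w)$ is the undirected graph whose vertices are all subexpressions of $\underline{s}$ with target $w$ and whose edges are the pairs of vertices at Hamming distance exactly $2$ (i.e. differing in exactly two positions). For a finite undirected graph with edge set $\mathcal E$, a subgraph means a subset $F\subset \mathcal E$. Subgraphs form a vector space over the two-element field with symmetric difference as addition. A subgraph is even if every vertex is incident with an even number of its edges; the even subgraphs form a subspace called the cycle space. A cycle is a subgraph forming a usual simple closed cycle (connected, and every vertex has degree $2$ or $0$ in it); its length is its number of edges. *)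

theory Defs
  imports
    "HOL-Algebra.Multiplicative_Group"
    "HOL-Algebra.Generated_Groups"
    "HOL-Library.Z2"
    "HOL-Library.Function_Algebras"
begin

section \<open>Group presentations and Coxeter systems\<close>

text \<open>
  A letter \<open>(a, True)\<close> stands for the generator \<open>a\<close> and \<open>(a, False)\<close> for its formal inverse.
\<close>
type_synonym 'a gword = "('a \<times> bool) list"

definition list_prod :: "('a, 'b) monoid_scheme \<Rightarrow> 'a list \<Rightarrow> 'a" where
  "list_prod G xs = foldr (mult G) xs (one G)"

definition eval_gword :: "('a, 'b) monoid_scheme \<Rightarrow> 'a gword \<Rightarrow> 'a" where
  "eval_gword G u = list_prod G (map (\<lambda>(a, b). if b then a else inv\<^bsub>G\<^esub> a) u)"

text \<open>
  Equality of words in the abstract group generated by \<open>S\<close> subject to the relators \<open>R\<close>: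
  the congruence on words generated by free cancellation and by \<open>r = 1\<close> for \<open>r \<in> R\<close>.
\<close>
inductive pres_eq :: "'a set \<Rightarrow> 'a gword set \<Rightarrow> 'a gword \<Rightarrow> 'a gword \<Rightarrow> bool"
  for S :: "'a set" and R :: "'a gword set" where
  pres_eq_refl: "pres_eq S R u u"
| pres_eq_sym: "pres_eq S R u v \<Longrightarrow> pres_eq S R v u"
| pres_eq_trans: "pres_eq S R u v \<Longrightarrow> pres_eq S R v x \<Longrightarrow> pres_eq S R u x"
| pres_eq_cancel: "a \<in> S \<Longrightarrow> pres_eq S R (u @ [(a, b), (a, \<not> b)] @ v) (u @ v)"
| pres_eq_relator: "r \<in> R \<Longrightarrow> pres_eq S R (u @ r @ v) (u @ v)"

definition is_presentation :: "('a, 'b) monoid_scheme \<Rightarrow> 'a set \<Rightarrow> 'a gword set \<Rightarrow> bool" where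
  "is_presentation G S R \<longleftrightarrow>
     generate G S = carrier G \<and>
     (\<forall>u \<in> lists (S \<times> UNIV). \<forall>v \<in> lists (S \<times> UNIV).
        eval_gword G u = eval_gword G v \<longleftrightarrow> pres_eq S R u v)"

text \<open>
  The words \<open>(s t)\<^sup>m\<close>, where \<open>m\<close> is the order of \<open>s t\<close> in \<open>G\<close>, over all pairs for which this
  order is finite (\<open>group.ord\<close> is \<open>0\<close> on elements of infinite order).
\<close>
definition coxeter_relators :: "('a, 'b) monoid_scheme \<Rightarrow> 'a set \<Rightarrow> 'a gword set" where
  "coxeter_relators G S =
     {concat (replicate (group.ord G (s \<otimes>\<^bsub>G\<^esub> t)) [(s, True), (t, True)]) | s t.
        s \<in> S \<and> t \<in> S \<and> group.ord G (s \<otimes>\<^bsub>G\<^esub> t) \<noteq> 0}"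

text \<open>
  Bourbaki's definition (Lie groups and Lie algebras, Ch. IV, 1.3). The set \<open>S\<close> may be infinite.
\<close>
definition coxeter_system :: "('a, 'b) monoid_scheme \<Rightarrow> 'a set \<Rightarrow> bool" where
  "coxeter_system G S \<longleftrightarrow>
     group G \<and> S \<subseteq> carrier G \<and> (\<forall>s \<in> S. group.ord G s = 2) \<and>
     is_presentation G S (coxeter_relators G S)"


section \<open>The graph of subexpressions\<close>

definition subexpressions :: "('a, 'b) monoid_scheme \<Rightarrow> 'a list \<Rightarrow> 'a \<Rightarrow> nat list set" where
  "subexpressions G ss w =
     {e. length e = length ss \<and> set e \<subseteq> {0, 1} \<and>
         list_prod G (map2 (\<lambda>s k. s [^]\<^bsub>G\<^esub> k) ss e) = w}"

definition hamming_dist :: "'a list \<Rightarrow> 'a list \<Rightarrow> nat" where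
  "hamming_dist x y = card {i. i < length x \<and> x ! i \<noteq> y ! i}"

definition subexpression_edges ::
    "('a, 'b) monoid_scheme \<Rightarrow> 'a list \<Rightarrow> 'a \<Rightarrow> nat list set set" where
  "subexpression_edges G ss w =
     {{x, y} | x y. x \<in> subexpressions G ss w \<and> y \<in> subexpressions G ss w \<and>
                    hamming_dist x y = 2}"

text \<open>
  The empty product is included among the products of at most two entries; it contributes only
  the divisor \<open>1\<close>.
\<close>
definition order_divisors :: "('a, 'b) monoid_scheme \<Rightarrow> 'a list \<Rightarrow> nat set" where
  "order_divisors G ss =
     {d. d > 0 \<and>
         (\<exists>xs. length xs \<le> 2 \<and> set xs \<subseteq> set ss \<and>
               group.ord G (list_prod G xs) \<noteq> 0 \<and> d dvd group.ord G (list_prod G xs))}"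


section \<open>Subgraphs, cycles and the cycle space\<close>

text \<open>
  An undirected graph is given by its vertex set \<open>V\<close> and its set \<open>E\<close> of two-element edges;
  a subgraph is a set of edges.
\<close>
definition degree_in :: "'v set set \<Rightarrow> 'v \<Rightarrow> nat" where
  "degree_in F v = card {e \<in> F. v \<in> e}"

definition cycle_space :: "'v set \<Rightarrow> 'v set set \<Rightarrow> 'v set set set" where
  "cycle_space V E = {F. F \<subseteq> E \<and> (\<forall>v \<in> V. even (degree_in F v))}"

definition connected_edges :: "'v set set \<Rightarrow> bool" where
  "connected_edges F \<longleftrightarrow> (\<forall>u \<in> \<Union>F. \<forall>v \<in> \<Union>F. (u, v) \<in> {(x, y). {x, y} \<in> F}\<^sup>*)"

definition is_cycle :: "'v set \<Rightarrow> 'v set set \<Rightarrow> 'v set set \<Rightarrow> bool" where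
  "is_cycle V E C \<longleftrightarrow>
     C \<subseteq> E \<and> C \<noteq> {} \<and> connected_edges C \<and> (\<forall>v \<in> V. degree_in C v = 0 \<or> degree_in C v = 2)"

text \<open>
  Sets under symmetric difference are identified with their characteristic functions into the
  two-element field, so that the linear span of the library applies.
\<close>
definition f2_indicator :: "'e set \<Rightarrow> 'e \<Rightarrow> bit" where
  "f2_indicator A = (\<lambda>e. of_bool (e \<in> A))"

definition f2_scale :: "bit \<Rightarrow> ('e \<Rightarrow> bit) \<Rightarrow> 'e \<Rightarrow> bit" where
  "f2_scale c f = (\<lambda>e. c * f e)"

global_interpretation f2: vector_space f2_scale
  by unfold_locales (auto simp: f2_scale_def fun_eq_iff algebra_simps)

lemma f2_indicator_sym_diff: "f2_indicator (sym_diff A B) = f2_indicator A + f2_indicator B"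
  by (auto simp: f2_indicator_def fun_eq_iff)

lemma f2_indicator_empty: "f2_indicator {} = 0"
  by (simp add: f2_indicator_def fun_eq_iff)

lemma bij_f2_indicator: "bij f2_indicator"
proof (rule bijI)
  show "inj f2_indicator"
    by (rule injI) (simp add: f2_indicator_def fun_eq_iff of_bool_eq_iff set_eq_iff)
  have "f = f2_indicator {e. f e = 1}" for f :: "'a \<Rightarrow> bit"
    by (auto simp: f2_indicator_def fun_eq_iff)
  then show "surj (f2_indicator :: 'a set \<Rightarrow> 'a \<Rightarrow> bit)"
    by (rule surjI[OF sym])
qed

definition f2_span :: "'e set set \<Rightarrow> 'e set set" where
  "f2_span \<C> = {F. f2_indicator F \<in> f2.span (f2_indicator ` \<C>)}"

end

theory Submission
  imports Defs
begin

text \<open>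
  A subexpression is read as a gallery of chambers in \<open>W\<close> that starts at \<open>\<one>\<close>: at position \<open>k\<close> the
  gallery hits the wall (reflection) \<open>hit e k\<close> of the chamber \<open>prefix e k\<close>, and it crosses this wall
  if the bit is \<open>1\<close> and bounces off it if the bit is \<open>0\<close>. Flipping one bit reflects the rest of the
  gallery in the wall at that position. Hence two subexpressions with the same target are adjacent
  iff they differ in two positions at which a common wall is hit (\<open>edge_flip\<close>, \<open>flip_vertex\<close>).

  The proof is a peak reduction. A position is a descent if its wall separates the chamber reached
  from \<open>\<one>\<close>. For a fixed target the set of descents determines the subexpression, and reading these
  sets as binary numbers orders the vertices linearly (\<open>height\<close>). An edge that leads down from \<open>v\<close>
  flips \<open>i < j\<close> with \<open>j\<close> a descent of \<open>v\<close>. By \<open>cycle_space_by_peak_reduction\<close> it suffices that any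
  two edges down from \<open>v\<close> are \<open>linked\<close>: some sum of short cycles has exactly these two edges at \<open>v\<close>
  and does not rise above \<open>v\<close>. Adding such sums to an even subgraph removes its highest vertex.

  Let the two edges flip \<open>i < j\<close> and \<open>k < l\<close>, with \<open>j < l\<close>. If the walls are equal, the edges lie on a
  triangle. Unless \<open>i < k < j\<close>, the two flips do not disturb each other, and the edges lie on a
  square. So the difficulty is a pair of descents \<open>j < l\<close> with walls \<open>r\<close> and \<open>t\<close> such that, for every
  choice of \<open>i\<close> and \<open>k\<close>, the walls are hit in the order \<open>r, t, r, t\<close>.

  In that case some finite rank-two residue has both \<open>r\<close> and \<open>t\<close> among its walls. Indeed the gallery
  up to position \<open>j\<close> and a reduced word through the chamber behind \<open>r\<close> are two words for the same
  chamber, one of which meets \<open>r\<close> before \<open>t\<close> while the other one meets \<open>r\<close> only at its last letter.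
  So they differ in the parity of the number of pairs "\<open>r\<close> before \<open>t\<close>", and this parity can be
  changed only by a Coxeter relator whose walls include \<open>r\<close> and \<open>t\<close> (\<open>crossing_walls_residue\<close>).

  Let \<open>m\<close> be the number of walls of this residue, in their cyclic order. The walls of the residue that
  separate a given chamber from \<open>\<one>\<close> form an initial or a final segment (\<open>residue_fan\<close>). Tracing this
  segment along the gallery shows that the gallery runs around the residue, and it yields \<open>m + 2\<close>
  positions at which the walls are hit in a cyclic pattern (\<open>pattern_exists\<close>). Flips at these positions
  produce a cycle with one vertex for each of the \<open>m + 2\<close> cyclically neighbouring pairs of positions
  (\<open>polygon_vertices\<close>); it has its highest vertex at \<open>v\<close>, and \<open>l\<close> is flipped on one of its two edges
  there. Finally all \<open>m\<close> walls are hit by the gallery, so they lie in the subgroup generated by the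
  entries of the sequence, and therefore \<open>m\<close> is the order of a product of two entries
  (\<open>parabolic_rank_two\<close>).
\<close>

section \<open>Parities of occurrences\<close>

definition odds :: "'a list \<Rightarrow> 'a set" where
  "odds xs = {x. odd (count_list xs x)}"

lemma odds_Nil [simp]: "odds [] = {}"
  by (simp add: odds_def)

lemma odds_append: "odds (xs @ ys) = sym_diff (odds xs) (odds ys)"
  by (auto simp: odds_def)

lemma odds_single [simp]: "odds [x] = {x}"
  by (auto simp: odds_def split: if_splits)

lemma odds_subset: "odds xs \<subseteq> set xs"
proof
  fix x assume "x \<in> odds xs"
  then have "odd (count_list xs x)" by (simp add: odds_def)
  then have "count_list xs x \<noteq> 0" by (rule contrapos_pn) simp
  then show "x \<in> set xs" using count_notin by metis
qed

lemma odds_map: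
  assumes "inj_on f A" "set xs \<subseteq> A"
  shows "odds (map f xs) = f ` odds xs"
  using assms(2)
proof (induction xs)
  case (Cons x xs)
  have "odds (map f (x # xs)) = sym_diff {f x} (odds (map f xs))"
    using odds_append[of "[f x]" "map f xs"] by simp
  also have "\<dots> = sym_diff (f ` {x}) (f ` odds xs)"
    using Cons by simp
  also have "\<dots> = f ` sym_diff {x} (odds xs)"
    using Cons.prems odds_subset[of xs] assms(1)
    by (auto simp: inj_on_def)
  also have "sym_diff {x} (odds xs) = odds (x # xs)"
    using odds_append[of "[x]" xs] by simp
  finally show ?case .
qed simp

text \<open>
  The parity of the number of pairs of positions \<open>i < j\<close> that carry \<open>r\<close> and \<open>t\<close>, respectively.
\<close>
fun odd_pairs :: "'a \<Rightarrow> 'a \<Rightarrow> 'a list \<Rightarrow> bool" where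
  "odd_pairs r t [] = False"
| "odd_pairs r t (x # xs) = (odd_pairs r t xs \<noteq> (x = r \<and> t \<in> odds xs))"

lemma odd_pairs_append:
  "odd_pairs r t (xs @ ys) =
     ((odd_pairs r t xs \<noteq> odd_pairs r t ys) \<noteq> (r \<in> odds xs \<and> t \<in> odds ys))"
  by (induction xs) (auto simp: odds_def)

lemma odd_pairs_notin:
  "r \<notin> set xs \<or> t \<notin> set xs \<Longrightarrow> \<not> odd_pairs r t xs"
proof (induction xs)
  case (Cons x xs)
  then show ?case using odds_subset[of xs] by auto
qed simp

text \<open>
  Both walls have to occur in a repeated block for the block to matter: its occurrences of \<open>r\<close> and of
  \<open>t\<close> are even in number, so pairs with one member outside the block cancel.
\<close>
lemma odd_pairs_double:
  "r \<notin> set xs \<or> t \<notin> set xs \<Longrightarrow> odd_pairs r t (us @ (xs @ xs) @ vs) = odd_pairs r t (us @ vs)"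
  using odd_pairs_notin[of r "xs @ xs" t]
  by (auto simp: odd_pairs_append odds_append)

section \<open>Words, walls and inversions\<close>

locale coxeter = group W for W (structure) +
  fixes S
  assumes coxeter: "coxeter_system W S"
begin

lemma S_closed [simp, intro]: "s \<in> S \<Longrightarrow> s \<in> carrier W"
  using coxeter by (auto simp: coxeter_system_def)

lemma S_square [simp]: "s \<in> S \<Longrightarrow> s \<otimes> s = \<one>"
  using coxeter pow_ord_eq_1[of s] by (auto simp: coxeter_system_def numeral_2_eq_2)

lemma S_inv [simp]: "s \<in> S \<Longrightarrow> inv s = s"
  by (simp add: inv_equality)

lemma list_prod_Nil [simp]: "list_prod W [] = \<one>"
  by (simp add: list_prod_def)

lemma list_prod_Cons [simp]: "list_prod W (x # xs) = x \<otimes> list_prod W xs"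
  by (simp add: list_prod_def)

lemma list_prod_closed [simp, intro]:
  "set xs \<subseteq> carrier W \<Longrightarrow> list_prod W xs \<in> carrier W"
  by (induction xs) auto

lemma word_closed [simp, intro]: "xs \<in> lists S \<Longrightarrow> list_prod W xs \<in> carrier W"
  by (rule list_prod_closed) auto

lemma list_prod_append:
  "set xs \<subseteq> carrier W \<Longrightarrow> set ys \<subseteq> carrier W \<Longrightarrow>
     list_prod W (xs @ ys) = list_prod W xs \<otimes> list_prod W ys"
  by (induction xs) (auto simp: m_assoc)

lemma word_append:
  "xs \<in> lists S \<Longrightarrow> ys \<in> lists S \<Longrightarrow> list_prod W (xs @ ys) = list_prod W xs \<otimes> list_prod W ys"
  by (rule list_prod_append) auto

definition conjugate :: "'a \<Rightarrow> 'a \<Rightarrow> 'a" where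
  "conjugate x y = x \<otimes> y \<otimes> inv x"

lemma conjugate_closed [simp, intro]: "x \<in> carrier W \<Longrightarrow> y \<in> carrier W \<Longrightarrow> conjugate x y \<in> carrier W"
  by (simp add: conjugate_def)

lemma conjugate_conjugate: "x \<in> carrier W \<Longrightarrow> y \<in> carrier W \<Longrightarrow> z \<in> carrier W \<Longrightarrow> conjugate x (conjugate y z) = conjugate (x \<otimes> y) z"
  by (simp add: conjugate_def m_assoc inv_mult_group)

lemma conjugate_one [simp]: "x \<in> carrier W \<Longrightarrow> conjugate \<one> x = x" "x \<in> carrier W \<Longrightarrow> conjugate x \<one> = \<one>"
  by (simp_all add: conjugate_def)

lemma conjugate_mult: "x \<in> carrier W \<Longrightarrow> y \<in> carrier W \<Longrightarrow> z \<in> carrier W \<Longrightarrow>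
    conjugate x (y \<otimes> z) = conjugate x y \<otimes> conjugate x z"
  by (simp add: conjugate_def m_assoc inv_solve_left)

lemma conjugate_swap: "x \<in> carrier W \<Longrightarrow> y \<in> carrier W \<Longrightarrow> conjugate x y \<otimes> x = x \<otimes> y"
  by (simp add: conjugate_def m_assoc)

lemma inj_conjugate: "x \<in> carrier W \<Longrightarrow> inj_on (conjugate x) (carrier W)"
  by (rule inj_onI) (simp add: conjugate_def)

lemma conjugate_eq_iff: "x \<in> carrier W \<Longrightarrow> y \<in> carrier W \<Longrightarrow> z \<in> carrier W \<Longrightarrow>
    conjugate x y = conjugate x z \<longleftrightarrow> y = z"
  by (rule inj_on_eq_iff[OF inj_conjugate])

lemma conjugate_self [simp]: "x \<in> carrier W \<Longrightarrow> conjugate x x = x"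
  by (simp add: conjugate_def m_assoc)

lemma conjugate_square: "x \<in> carrier W \<Longrightarrow> y \<in> carrier W \<Longrightarrow> y \<otimes> y = \<one> \<Longrightarrow> conjugate x y \<otimes> conjugate x y = \<one>"
  by (simp add: conjugate_mult[symmetric])

text \<open>
  The walls met by the gallery that starts at \<open>x\<close> and crosses one wall for each letter of the word.
\<close>
primrec walls :: "'a \<Rightarrow> 'a list \<Rightarrow> 'a list" where
  "walls x [] = []"
| "walls x (s # xs) = conjugate x s # walls (x \<otimes> s) xs"

lemma walls_append:
  "x \<in> carrier W \<Longrightarrow> xs \<in> lists S \<Longrightarrow> walls x (xs @ ys) = walls x xs @ walls (x \<otimes> list_prod W xs) ys"
  by (induction xs arbitrary: x) (auto simp: m_assoc)

lemma walls_closed: "x \<in> carrier W \<Longrightarrow> xs \<in> lists S \<Longrightarrow> set (walls x xs) \<subseteq> carrier W"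
  by (induction xs arbitrary: x) auto

lemma walls_conjugate:
  "y \<in> carrier W \<Longrightarrow> x \<in> carrier W \<Longrightarrow> xs \<in> lists S \<Longrightarrow>
     walls (y \<otimes> x) xs = map (conjugate y) (walls x xs)"
  by (induction xs arbitrary: x) (auto simp: m_assoc conjugate_conjugate)

definition loop :: "'a \<Rightarrow> 'a \<Rightarrow> 'a list" where
  "loop s t = concat (replicate (ord (s \<otimes> t)) [s, t])"

text \<open>
  The hits of an alternating word are consecutive in the dihedral group generated by \<open>s\<close> and \<open>t\<close>; this
  fixes the numbering of the walls of a rank-two residue that is used throughout.
\<close>
lemma alternating_walls:
  assumes "s \<in> S" "t \<in> S" "x \<in> carrier W"
  shows "walls x (concat (replicate k [s, t])) =
           map (\<lambda>i. conjugate x ((s \<otimes> t) [^] i \<otimes> s)) [0..<2 * k] \<and>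
         list_prod W (concat (replicate k [s, t])) = (s \<otimes> t) [^] k"
proof (induction k)
  case (Suc k)
  let ?u = "concat (replicate k [s, t])"
  let ?\<rho> = "s \<otimes> t"
  have u: "?u \<in> lists S" using assms by (induction k) auto
  have inv_pow: "s \<otimes> inv (?\<rho> [^] i) = ?\<rho> [^] i \<otimes> s" for i :: nat
  proof (induction i)
    case (Suc i)
    have "s \<otimes> inv (?\<rho> [^] Suc i) = s \<otimes> inv (?\<rho> [^] i \<otimes> ?\<rho>)" by simp
    also have "\<dots> = s \<otimes> (inv ?\<rho> \<otimes> inv (?\<rho> [^] i))"
      using assms by (simp add: inv_mult_group)
    also have "\<dots> = s \<otimes> t \<otimes> (s \<otimes> inv (?\<rho> [^] i))"
      using assms by (simp add: inv_mult_group m_assoc)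
    also have "\<dots> = ?\<rho> \<otimes> (?\<rho> [^] i \<otimes> s)" by (simp add: Suc)
    also have "\<dots> = ?\<rho> [^] Suc i \<otimes> s"
      using assms by (simp add: m_assoc[symmetric] nat_pow_Suc2[symmetric] del: nat_pow_Suc)
    finally show ?case .
  qed (use assms in auto)
  have p: "list_prod W ?u = ?\<rho> [^] k" using Suc by simp
  have "conjugate (x \<otimes> ?\<rho> [^] k) s = conjugate x (conjugate (?\<rho> [^] k) s)"
    using assms by (simp add: conjugate_conjugate)
  also have "conjugate (?\<rho> [^] k) s = ?\<rho> [^] (2 * k) \<otimes> s"
    using assms inv_pow[of k] by (simp add: conjugate_def m_assoc mult_2 nat_pow_mult[symmetric])
  finally have 1: "conjugate (x \<otimes> ?\<rho> [^] k) s = conjugate x (?\<rho> [^] (2 * k) \<otimes> s)" .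
  have "conjugate (x \<otimes> ?\<rho> [^] k \<otimes> s) t = conjugate (x \<otimes> ?\<rho> [^] k) (conjugate s t)"
    using assms by (simp add: conjugate_conjugate[of "x \<otimes> ?\<rho> [^] k" s t])
  also have "\<dots> = conjugate x (conjugate (?\<rho> [^] k) (conjugate s t))"
    using assms by (intro conjugate_conjugate[symmetric]) auto
  also have "conjugate (?\<rho> [^] k) (conjugate s t) = ?\<rho> [^] k \<otimes> ?\<rho> \<otimes> ?\<rho> [^] k \<otimes> s"
    using assms inv_pow[of k] by (simp add: conjugate_def m_assoc)
  also have "\<dots> = ?\<rho> [^] (Suc (2 * k)) \<otimes> s"
    using assms nat_pow_mult[of ?\<rho> "Suc k" k] by (simp add: mult_2)
  finally have 2: "conjugate (x \<otimes> ?\<rho> [^] k \<otimes> s) t = conjugate x (?\<rho> [^] (Suc (2 * k)) \<otimes> s)" .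
  have c: "concat (replicate (Suc k) [s, t]) = ?u @ [s, t]"
    by (induction k) auto
  have "walls x (concat (replicate (Suc k) [s, t])) = walls x ?u @ walls (x \<otimes> ?\<rho> [^] k) [s, t]"
    unfolding c using assms u p by (simp add: walls_append)
  also have "\<dots> = map (\<lambda>i. conjugate x (?\<rho> [^] i \<otimes> s)) [0..<2 * Suc k]"
    using Suc 1 2 by simp
  finally have "walls x (concat (replicate (Suc k) [s, t])) = map (\<lambda>i. conjugate x (?\<rho> [^] i \<otimes> s)) [0..<2 * Suc k]" .
  moreover have "list_prod W (concat (replicate (Suc k) [s, t])) = ?\<rho> [^] Suc k"
    unfolding c using u assms p by (simp add: word_append)
  ultimately show ?case by simp
qed (use assms in simp)

lemma loop_words [simp]:
  assumes "s \<in> S" "t \<in> S"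
  shows "loop s t \<in> lists S"
proof -
  have "concat (replicate k [s, t]) \<in> lists S" for k
    using assms by (induction k) auto
  then show ?thesis by (simp add: loop_def)
qed

lemma loop_prod:
  assumes "s \<in> S" "t \<in> S"
  shows "list_prod W (loop s t) = \<one>"
  using alternating_walls[of s t \<one>] assms by (simp add: loop_def)

text \<open>
  A relator walks once around a rank-two residue, so it meets each wall of the residue twice, the
  second time in the same order as the first.
\<close>
lemma loop_walls:
  assumes "s \<in> S" "t \<in> S" "x \<in> carrier W"
  defines "ws \<equiv> map (\<lambda>i. conjugate x ((s \<otimes> t) [^] i \<otimes> s)) [0..<ord (s \<otimes> t)]"
  shows "walls x (loop s t) = ws @ ws"
proof -
  let ?m = "ord (s \<otimes> t)"
  let ?f = "\<lambda>i. conjugate x ((s \<otimes> t) [^] i \<otimes> s)"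
  have "walls x (loop s t) = map ?f [0..<?m + ?m]"
    using alternating_walls[OF assms(1-3)] by (simp add: loop_def mult_2)
  also have "\<dots> = ws @ map (\<lambda>i. ?f (i + ?m)) [0..<?m]"
    unfolding upt_add_eq_append[OF le0] map_append ws_def
    by (simp add: map_add_upt[symmetric] del: map_add_upt)
  also have "map (\<lambda>i. ?f (i + ?m)) [0..<?m] = ws"
    using assms by (simp add: ws_def nat_pow_mult[symmetric])
  finally show ?thesis .
qed

text \<open>
  The presentation of \<open>W\<close> turned into an induction principle: a function of words depends on the
  group element only as soon as it ignores the insertion of relators. The cancellation of \<open>a a\<close> is the
  relator of the pair \<open>(a, a)\<close>.
\<close>
lemma word_invariant:
  assumes step: "\<And>xs ys s t. xs \<in> lists S \<Longrightarrow> ys \<in> lists S \<Longrightarrow> s \<in> S \<Longrightarrow> t \<in> S \<Longrightarrow>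
      ord (s \<otimes> t) \<noteq> 0 \<Longrightarrow> f (xs @ loop s t @ ys) = f (xs @ ys)"
    and "xs \<in> lists S" "ys \<in> lists S" and eq: "list_prod W xs = list_prod W ys"
  shows "f xs = f ys"
proof -
  define letters where "letters u = filter (\<lambda>a. a \<in> S) (map fst u)" for u :: "'a gword"
  have letters_S: "letters u \<in> lists S" for u by (auto simp: letters_def)
  have inv: "f (letters u) = f (letters v)" if "pres_eq S (coxeter_relators W S) u v" for u v
    using that
  proof (induction rule: pres_eq.induct)
    case (pres_eq_cancel a u b v)
    have "loop a a = [a, a]" using pres_eq_cancel by (simp add: loop_def)
    then show ?case
      using pres_eq_cancel step[OF letters_S[of u] letters_S[of v], of a a] by (simp add: letters_def)
  next
    case (pres_eq_relator r u v)
    then obtain s t where st: "s \<in> S" "t \<in> S" "ord (s \<otimes> t) \<noteq> 0"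
      and r: "r = concat (replicate (ord (s \<otimes> t)) [(s, True), (t, True)])"
      by (auto simp: coxeter_relators_def)
    have "letters r = loop s t"
      using st(1,2) by (simp add: r letters_def loop_def filter_concat map_concat)
    then show ?case
      using step[OF letters_S[of u] letters_S[of v] st] by (simp add: letters_def)
  qed auto
  define pos where "pos = map (\<lambda>a. (a :: 'a, True))"
  have ev: "eval_gword W (pos xs) = list_prod W xs" for xs
    by (simp add: eval_gword_def pos_def comp_def)
  have pos_S: "pos xs \<in> lists (S \<times> UNIV)" if "xs \<in> lists S" for xs
    using that by (auto simp: pos_def)
  have "pres_eq S (coxeter_relators W S) (pos xs) (pos ys)"
    using coxeter pos_S[OF assms(2)] pos_S[OF assms(3)] ev eq
    unfolding coxeter_system_def is_presentation_def by metis
  then have "f (letters (pos xs)) = f (letters (pos ys))" by (rule inv)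
  moreover have "letters (pos xs) = xs" if "xs \<in> lists S" for xs
    using that by (auto simp: letters_def pos_def comp_def filter_id_conv)
  ultimately show ?thesis using assms(2,3) by simp
qed

lemma generate_words:
  assumes "I \<subseteq> S"
  shows "generate W I = list_prod W ` lists I"
proof (rule equalityI)
  have IS: "xs \<in> lists S" if "xs \<in> lists I" for xs
    using that assms by auto
  show "generate W I \<subseteq> list_prod W ` lists I"
  proof
    fix x assume "x \<in> generate W I"
    then show "x \<in> list_prod W ` lists I"
    proof (induction rule: generate.induct)
      case one
      show ?case by (rule image_eqI[of _ _ "[]"]) auto
    next
      case (incl h)
      then show ?case using assms by (intro image_eqI[of _ _ "[h]"]) auto
    next
      case (inv h)
      then show ?case using assms S_inv[of h] by (intro image_eqI[of _ _ "[h]"]) auto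
    next
      case (eng h1 h2)
      then obtain xs ys where "h1 = list_prod W xs" "h2 = list_prod W ys" "xs \<in> lists I" "ys \<in> lists I"
        by auto
      then show ?case
        using IS word_append[of xs ys] by (intro image_eqI[of _ _ "xs @ ys"]) auto
    qed
  qed
  show "list_prod W ` lists I \<subseteq> generate W I"
  proof (rule image_subsetI)
    fix xs assume "xs \<in> lists I"
    then show "list_prod W xs \<in> generate W I"
    proof (induction xs)
      case (Cons a xs)
      then have "a \<in> generate W I" "list_prod W xs \<in> generate W I"
        by (auto intro: generate.incl)
      then show ?case using generate.eng by fastforce
    qed (simp add: generate.one)
  qed
qed

lemma words_exist:
  assumes "x \<in> carrier W"
  obtains xs where "xs \<in> lists S" "list_prod W xs = x"
proof -
  have "x \<in> list_prod W ` lists S"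
    using assms coxeter generate_words[of S] by (auto simp: coxeter_system_def is_presentation_def)
  then show thesis using that by auto
qed

text \<open>
  The walls that separate \<open>x\<close> from \<open>\<one>\<close>, that is, those that a gallery from \<open>\<one>\<close> to \<open>x\<close> crosses an odd
  number of times; by \<open>inversions_word\<close> every word for \<open>x\<close> gives the same set.
\<close>
definition inversions :: "'a \<Rightarrow> 'a set" where
  "inversions x = odds (walls \<one> (SOME xs. xs \<in> lists S \<and> list_prod W xs = x))"

lemma odds_walls_loop:
  assumes "s \<in> S" "t \<in> S" "x \<in> carrier W"
  shows "odds (walls x (loop s t)) = {}"
  by (simp add: loop_walls[OF assms] odds_append)

lemma inversions_word:
  assumes "xs \<in> lists S"
  shows "inversions (list_prod W xs) = odds (walls \<one> xs)"
proof -
  let ?ys = "SOME ys. ys \<in> lists S \<and> list_prod W ys = list_prod W xs"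
  have ys: "?ys \<in> lists S \<and> list_prod W ?ys = list_prod W xs"
    by (rule someI[of _ xs]) (use assms in auto)
  have "odds (walls \<one> ?ys) = odds (walls \<one> xs)"
  proof (rule word_invariant[of "\<lambda>xs. odds (walls \<one> xs)"])
    fix xs ys s t assume a: "xs \<in> lists S" "ys \<in> lists S" "s \<in> S" "t \<in> S"
    then show "odds (walls \<one> (xs @ loop s t @ ys)) = odds (walls \<one> (xs @ ys))"
      by (simp add: walls_append odds_append odds_walls_loop loop_prod)
  qed (use ys assms in auto)
  then show ?thesis by (simp add: inversions_def)
qed

lemma inversions_one [simp]: "inversions \<one> = {}"
  using inversions_word[of "[]"] by simp

lemma inversions_closed: "x \<in> carrier W \<Longrightarrow> inversions x \<subseteq> carrier W"
proof (elim words_exist)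
  fix xs assume xs: "xs \<in> lists S" "list_prod W xs = x"
  show "inversions x \<subseteq> carrier W"
    using odds_subset[of "walls \<one> xs"] walls_closed[OF one_closed xs(1)] inversions_word[OF xs(1)] xs(2)
    by auto
qed

lemma inversions_mult:
  assumes "x \<in> carrier W" "y \<in> carrier W"
  shows "inversions (x \<otimes> y) = sym_diff (inversions x) (conjugate x ` inversions y)"
proof -
  obtain xs ys where xs: "xs \<in> lists S" "list_prod W xs = x" and ys: "ys \<in> lists S" "list_prod W ys = y"
    using words_exist assms by metis
  have "inversions (x \<otimes> y) = odds (walls \<one> (xs @ ys))"
    using inversions_word[of "xs @ ys"] xs ys word_append[of xs ys] by simp
  also have "walls \<one> (xs @ ys) = walls \<one> xs @ map (conjugate x) (walls \<one> ys)"
    using xs ys assms walls_conjugate[of x \<one> ys] by (simp add: walls_append)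
  also have "odds \<dots> = sym_diff (odds (walls \<one> xs)) (conjugate x ` odds (walls \<one> ys))"
    using odds_map[OF inj_conjugate[OF assms(1)], of "walls \<one> ys"] walls_closed[of \<one> ys] ys
    by (simp add: odds_append)
  finally show ?thesis using inversions_word xs ys by metis
qed

lemma inversions_gen [simp]: "s \<in> S \<Longrightarrow> inversions s = {s}"
  using inversions_word[of "[s]"] by simp

lemma inversions_step:
  "x \<in> carrier W \<Longrightarrow> s \<in> S \<Longrightarrow> inversions (x \<otimes> s) = sym_diff (inversions x) {conjugate x s}"
  by (simp add: inversions_mult)

section \<open>Lengths and reduced words\<close>

definition word_length :: "'a \<Rightarrow> nat" where
  "word_length x = (LEAST k. \<exists>xs\<in>lists S. list_prod W xs = x \<and> length xs = k)"

lemma word_length_le: "xs \<in> lists S \<Longrightarrow> word_length (list_prod W xs) \<le> length xs"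
  unfolding word_length_def by (rule Least_le) auto

lemma reduced_word:
  assumes "x \<in> carrier W"
  obtains xs where "xs \<in> lists S" "list_prod W xs = x" "length xs = word_length x"
proof -
  have "\<exists>k. \<exists>xs\<in>lists S. list_prod W xs = x \<and> length xs = k"
    using words_exist[OF assms] by metis
  from LeastI_ex[OF this] show thesis
    using that unfolding word_length_def by blast
qed

text \<open>
  Folding a gallery along a wall that it meets removes the letter at which it meets the wall. This is
  the exchange condition.
\<close>
lemma delete_letter:
  assumes "I \<subseteq> S" "xs \<in> lists I" "h \<in> set (walls \<one> xs)"
  shows "\<exists>ys\<in>lists I. length ys < length xs \<and> list_prod W ys = h \<otimes> list_prod W xs"
  using assms(2,3)
proof (induction xs rule: rev_induct)
  case (snoc s xs)
  have s: "s \<in> S" "s \<in> I" and xs: "xs \<in> lists S" "xs \<in> lists I"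
    using snoc.prems assms(1) by auto
  have w: "walls \<one> (xs @ [s]) = walls \<one> xs @ [conjugate (list_prod W xs) s]"
    using xs by (simp add: walls_append)
  show ?case
  proof (cases "h \<in> set (walls \<one> xs)")
    case True
    then obtain ys where ys: "ys \<in> lists I" "length ys < length xs" "list_prod W ys = h \<otimes> list_prod W xs"
      using snoc.IH xs by auto
    have "ys \<in> lists S" using ys assms(1) by auto
    moreover have "h \<in> carrier W" using True walls_closed[OF one_closed xs(1)] by auto
    ultimately have "list_prod W (ys @ [s]) = h \<otimes> list_prod W (xs @ [s])"
      using ys xs s by (simp add: word_append m_assoc)
    then show ?thesis using ys s by (intro bexI[of _ "ys @ [s]"]) auto
  next
    case False
    then have "h = conjugate (list_prod W xs) s" using snoc.prems w by auto
    then have "list_prod W xs = h \<otimes> list_prod W (xs @ [s])"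
      using xs s by (simp add: word_append m_assoc[symmetric] conjugate_swap) (simp add: m_assoc)
    then show ?thesis using xs by (intro bexI[of _ xs]) auto
  qed
qed simp

lemma inversion_shortens:
  assumes "x \<in> carrier W" "p \<in> inversions x"
  shows "word_length (p \<otimes> x) < word_length x"
proof -
  obtain xs where xs: "xs \<in> lists S" "list_prod W xs = x" "length xs = word_length x"
    using reduced_word[OF assms(1)] .
  have "p \<in> set (walls \<one> xs)"
    using assms(2) inversions_word[OF xs(1)] odds_subset[of "walls \<one> xs"] xs(2) by auto
  then obtain ys where "ys \<in> lists S" "length ys < length xs" "list_prod W ys = p \<otimes> x"
    using delete_letter[of S xs p] xs by auto
  then show ?thesis using word_length_le[of ys] xs(3) by auto
qed

text \<open>
  A reflection in a wall that separates \<open>x\<close> from \<open>\<one>\<close> shortens \<open>x\<close>. So in a coset of a reflection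
  subgroup a shortest element lies on the same side as \<open>\<one>\<close> of all walls of the subgroup; this
  replaces the usual theory of minimal coset representatives.
\<close>
lemma shortest_element:
  assumes "A \<subseteq> carrier W" "A \<noteq> {}"
  obtains x where "x \<in> A" "\<And>p. p \<otimes> x \<in> A \<Longrightarrow> p \<notin> inversions x"
proof -
  obtain x where x: "x \<in> A" "\<And>y. y \<in> A \<Longrightarrow> word_length x \<le> word_length y"
    using assms(2) ex_has_least_nat[of "\<lambda>x. x \<in> A" _ word_length] by auto
  show thesis
  proof (rule that[OF x(1)])
    fix p assume "p \<otimes> x \<in> A"
    then show "p \<notin> inversions x"
      using x assms(1) inversion_shortens[of x p] by (metis linorder_not_less subsetD)
  qed
qed

section \<open>Standard parabolic subgroups\<close>

lemma parabolic_walls: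
  assumes "I \<subseteq> S" "xs \<in> lists I" "x \<in> generate W I"
  shows "set (walls x xs) \<subseteq> generate W I"
proof -
  have I: "I \<subseteq> carrier W" using assms(1) by auto
  interpret P: subgroup "generate W I" W by (rule generate_is_subgroup[OF I])
  show ?thesis
    using assms(2,3)
  proof (induction xs arbitrary: x)
    case (Cons s xs)
    then have "s \<in> generate W I" by (auto intro: generate.incl)
    then show ?case using Cons by (auto simp: conjugate_def)
  qed simp
qed

lemma inversions_parabolic:
  assumes "I \<subseteq> S" "x \<in> generate W I"
  shows "inversions x \<subseteq> generate W I"
proof -
  obtain xs where xs: "xs \<in> lists I" "x = list_prod W xs"
    using assms generate_words by auto
  then have "xs \<in> lists S" using assms(1) by auto
  then show ?thesis
    using inversions_word[of xs] odds_subset[of "walls \<one> xs"]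
      parabolic_walls[OF assms(1) xs(1) generate.one] xs(2) by auto
qed

text \<open>
  In a shortest word of \<open>x\<close> over \<open>I\<close> the first letter \<open>a\<close> is met only once as a wall: otherwise both
  occurrences could be deleted. Hence \<open>a\<close> is an inversion of \<open>x\<close>.
\<close>
lemma parabolic_reflection_is_generator:
  assumes "I \<subseteq> S" "x \<in> generate W I" "inversions x = {x}"
  shows "x \<in> I"
proof -
  have "\<exists>xs. xs \<in> lists I \<and> list_prod W xs = x"
    using assms(1,2) generate_words by auto
  then obtain xs where xs: "xs \<in> lists I" "list_prod W xs = x"
    and least: "\<And>ys. ys \<in> lists I \<Longrightarrow> list_prod W ys = x \<Longrightarrow> length xs \<le> length ys"
    using ex_has_least_nat[of "\<lambda>xs. xs \<in> lists I \<and> list_prod W xs = x" _ length] by metis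
  have "xs \<noteq> []" using xs assms(3) by auto
  then obtain a ys where ays: "xs = a # ys" by (cases xs) auto
  have a: "a \<in> I" "a \<in> S" and ys: "ys \<in> lists I" "ys \<in> lists S" and xsS: "xs \<in> lists S"
    using xs(1) assms(1) ays by auto
  have "a = x"
  proof (rule ccontr)
    assume "a \<noteq> x"
    then have "a \<notin> odds (walls \<one> xs)" using assms(3) inversions_word[OF xsS] xs by auto
    moreover have w: "walls \<one> xs = a # map (conjugate a) (walls \<one> ys)"
      using a ays ys walls_conjugate[of a \<one> ys] by simp
    moreover have "odds (a # map (conjugate a) (walls \<one> ys)) = sym_diff {a} (odds (map (conjugate a) (walls \<one> ys)))"
      using odds_append[of "[a]"] by simp
    ultimately have "a \<in> set (map (conjugate a) (walls \<one> ys))"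
      using odds_subset by fastforce
    then obtain h where h: "h \<in> set (walls \<one> ys)" "conjugate a a = conjugate a h" using a by auto
    \<comment> \<open>The second occurrence of \<open>a\<close> among the walls comes from a wall \<open>a\<close> of the remaining word.\<close>
    then have "h = a"
      using conjugate_eq_iff[of a a h] walls_closed[OF one_closed ys(2)] a by auto
    then obtain zs where "zs \<in> lists I" "length zs < length ys" "list_prod W zs = a \<otimes> list_prod W ys"
      using delete_letter[OF assms(1) ys(1)] h by auto
    then show False using least[of zs] xs ays by auto
  qed
  then show ?thesis using a by simp
qed

lemma ord_conjugate:
  assumes "x \<in> carrier W" "y \<in> carrier W"
  shows "ord (conjugate x y) = ord y"
proof -
  have pow: "conjugate x y [^] n = conjugate x (y [^] n)" for n :: nat
    using assms by (induction n) (auto simp: conjugate_mult)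
  have "conjugate x y [^] n = \<one> \<longleftrightarrow> y [^] n = \<one>" for n :: nat
    using assms conjugate_eq_iff[of x "y [^] n" \<one>] by (simp add: pow)
  then have "ord (conjugate x y) dvd n \<longleftrightarrow> ord y dvd n" for n
    using assms by (simp add: pow_eq_id[symmetric])
  then show ?thesis by (metis dvd_antisym dvd_refl)
qed

text \<open>
  A rank-two residue whose walls all belong to the standard parabolic subgroup generated by \<open>I\<close> is,
  up to conjugation, spanned by two elements of \<open>I\<close>. In the coset of \<open>x\<close> there is a chamber \<open>z\<close> without
  inversions in the subgroup; then \<open>z a z\<^sup>-\<^sup>1\<close> and \<open>z b z\<^sup>-\<^sup>1\<close> have no inversion but
  themselves.
\<close>
lemma parabolic_rank_two:
  assumes I: "I \<subseteq> S" and x: "x \<in> carrier W" and ab: "a \<in> S" "b \<in> S"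
    and "conjugate x a \<in> generate W I" "conjugate x b \<in> generate W I"
  shows "\<exists>a'\<in>I. \<exists>b'\<in>I. ord (a' \<otimes> b') = ord (a \<otimes> b)"
proof -
  let ?P = "generate W I"
  have IC: "I \<subseteq> carrier W" using I by auto
  interpret P: subgroup ?P W by (rule generate_is_subgroup[OF IC])
  have Pc: "p \<in> carrier W" if "p \<in> ?P" for p using that P.subset by auto
  let ?A = "(\<lambda>p. p \<otimes> x) ` ?P"
  have "?A \<noteq> {}" using generate.one[of W I] by blast
  moreover have "?A \<subseteq> carrier W" using x Pc by auto
  ultimately obtain z where z: "z \<in> ?A" "\<And>p. p \<otimes> z \<in> ?A \<Longrightarrow> p \<notin> inversions z"
    using shortest_element by blast
  then obtain y where y: "y \<in> ?P" "z = y \<otimes> x" by auto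
  have zc: "z \<in> carrier W" using y x Pc by simp
  have disj: "p \<notin> inversions z" if "p \<in> ?P" for p
  proof (rule z(2))
    show "p \<otimes> z \<in> ?A"
      using that y x Pc by (intro image_eqI[of _ _ "p \<otimes> y"]) (auto simp: m_assoc)
  qed
  have gen: "conjugate z c \<in> I" if c: "c \<in> S" "conjugate x c \<in> ?P" for c
  proof (rule parabolic_reflection_is_generator[OF I])
    let ?r = "conjugate z c"
    have "?r = conjugate y (conjugate x c)"
      using y x c Pc by (simp add: conjugate_conjugate)
    then show rP: "?r \<in> ?P" using c y by (simp add: conjugate_def)
    have "inversions (?r \<otimes> z) = inversions (z \<otimes> c)" using c zc by (simp add: conjugate_swap)
    then have eq: "sym_diff (inversions ?r) (conjugate ?r ` inversions z) = sym_diff (inversions z) {?r}"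
      using c zc by (simp add: inversions_mult)
    \<comment> \<open>Conjugation by \<open>?r\<close> preserves the subgroup, so it cannot move an inversion of \<open>z\<close> into it. Comparing
      the inversions of \<open>?r z = z c\<close> inside the subgroup leaves only \<open>?r\<close>.\<close>
    have img: "conjugate ?r p \<notin> ?P" if "p \<in> inversions z" for p
    proof
      assume "conjugate ?r p \<in> ?P"
      then have "conjugate (inv ?r) (conjugate ?r p) \<in> ?P" using rP by (simp add: conjugate_def)
      moreover have "conjugate (inv ?r) (conjugate ?r p) = p"
        using that inversions_closed[OF zc] zc c by (subst conjugate_conjugate) auto
      ultimately show False using disj that by simp
    qed
    have "inversions ?r \<subseteq> ?P" by (rule inversions_parabolic[OF I rP])
    moreover have "conjugate ?r ` inversions z \<inter> ?P = {}" using img by blast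
    ultimately have "inversions ?r = sym_diff (inversions ?r) (conjugate ?r ` inversions z) \<inter> ?P"
      by blast
    also have "\<dots> = sym_diff (inversions z) {?r} \<inter> ?P" unfolding eq ..
    also have "\<dots> = {?r}" using disj rP by auto
    finally show "inversions ?r = {?r}" .
  qed
  have "conjugate z a \<otimes> conjugate z b = conjugate z (a \<otimes> b)"
    using zc ab by (simp add: conjugate_mult)
  then show ?thesis using gen assms ord_conjugate[OF zc, of "a \<otimes> b"] by (metis S_closed m_closed)
qed

section \<open>Rank-two residues\<close>

text \<open>
  Suppose that a word for \<open>x\<close> has an odd number of pairs "wall \<open>r\<close> before wall \<open>t\<close>", where \<open>r\<close> is a wall of
  the chamber \<open>x\<close> that separates it from \<open>\<one>\<close>. A word for \<open>x\<close> that ends by crossing \<open>r\<close> and does not meet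
  \<open>r\<close> before has no such pair. So some relator changes the parity, and both walls belong to its residue.
\<close>
lemma crossing_walls_residue:
  assumes us: "us \<in> lists S" "list_prod W us = x" and s: "s \<in> S"
    and r: "conjugate x s \<in> inversions x"
    and odd: "odd_pairs (conjugate x s) t (walls \<one> us)"
  obtains y a b where "y \<in> carrier W" "a \<in> S" "b \<in> S" "ord (a \<otimes> b) \<noteq> 0"
    "{conjugate x s, t} \<subseteq> (\<lambda>i. conjugate y ((a \<otimes> b) [^] i \<otimes> a)) ` {..<ord (a \<otimes> b)}"
proof -
  let ?r = "conjugate x s"
  let ?ws = "\<lambda>y a b. (\<lambda>i. conjugate y ((a \<otimes> b) [^] i \<otimes> a)) ` {..<ord (a \<otimes> b)}"
  have x: "x \<in> carrier W" using us by auto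
  have rx: "?r \<otimes> x = x \<otimes> s" using x s by (simp add: conjugate_swap)
  obtain zs where zs: "zs \<in> lists S" "list_prod W zs = x \<otimes> s" "length zs = word_length (x \<otimes> s)"
    using reduced_word[of "x \<otimes> s"] x s by auto
  \<comment> \<open>A shortest word for the chamber behind \<open>r\<close> stays on the side of \<open>\<one>\<close>.\<close>
  have notin: "?r \<notin> set (walls \<one> zs)"
  proof
    assume "?r \<in> set (walls \<one> zs)"
    then obtain ys where ys: "ys \<in> lists S" "length ys < length zs" "list_prod W ys = ?r \<otimes> (x \<otimes> s)"
      using delete_letter[of S zs ?r] zs by auto
    have "?r \<otimes> (x \<otimes> s) = x"
      using x s by (simp add: m_assoc[symmetric] conjugate_swap) (simp add: m_assoc)
    then have "word_length x < word_length (x \<otimes> s)" using ys word_length_le[of ys] zs by simp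
    moreover have "word_length (x \<otimes> s) < word_length x"
      using inversion_shortens[OF x r] rx by simp
    ultimately show False by simp
  qed
  have "conjugate (x \<otimes> s) s = ?r"
    using x s conjugate_conjugate[of x s s] by simp
  then have w: "walls \<one> (zs @ [s]) = walls \<one> zs @ [?r]"
    using zs s x by (simp add: walls_append)
  have "odds [?r] = {?r}" by simp
  then have even: "\<not> odd_pairs ?r t (walls \<one> (zs @ [s]))"
    using notin odd_pairs_notin[of ?r "walls \<one> zs" t] odds_subset[of "walls \<one> zs"]
    unfolding w odd_pairs_append by auto
  show thesis
  proof (rule ccontr)
    note residue = that
    assume "\<not> thesis"
    then have none: "?r \<notin> ?ws y a b \<or> t \<notin> ?ws y a b"
      if "y \<in> carrier W" "a \<in> S" "b \<in> S" "ord (a \<otimes> b) \<noteq> 0" for y a b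
      using that residue[of y a b] by blast
    have "odd_pairs ?r t (walls \<one> us) = odd_pairs ?r t (walls \<one> (zs @ [s]))"
    proof (rule word_invariant[of "\<lambda>us. odd_pairs ?r t (walls \<one> us)"])
      fix xs ys a b assume a: "xs \<in> lists S" "ys \<in> lists S" "a \<in> S" "b \<in> S" "ord (a \<otimes> b) \<noteq> 0"
      let ?l = "map (\<lambda>i. conjugate (list_prod W xs) ((a \<otimes> b) [^] i \<otimes> a)) [0..<ord (a \<otimes> b)]"
      have "set ?l = ?ws (list_prod W xs) a b" by (simp add: atLeast0LessThan)
      then have "?r \<notin> set ?l \<or> t \<notin> set ?l" using none[of "list_prod W xs" a b] a by auto
      moreover have "walls \<one> (xs @ loop a b @ ys) = walls \<one> xs @ (?l @ ?l) @ walls (list_prod W xs) ys"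
        using a by (simp add: walls_append loop_walls loop_prod)
      moreover have "walls \<one> (xs @ ys) = walls \<one> xs @ walls (list_prod W xs) ys"
        using a by (simp add: walls_append)
      ultimately show "odd_pairs ?r t (walls \<one> (xs @ loop a b @ ys)) = odd_pairs ?r t (walls \<one> (xs @ ys))"
        using odd_pairs_double by metis
    qed (use us zs s x in \<open>auto simp: word_append m_assoc\<close>)
    then show False using odd even by simp
  qed
qed

end

section \<open>The walls of a finite residue\<close>

text \<open>
  The sets of walls of a rank-two residue with \<open>m\<close> walls that can separate a chamber from \<open>\<one>\<close>, once the
  walls are numbered around the residue starting next to \<open>\<one>\<close>.
\<close>
definition end_segment :: "int \<Rightarrow> int set \<Rightarrow> bool" where
  "end_segment m K \<longleftrightarrow> (\<exists>c. 0 \<le> c \<and> c \<le> m \<and> (K = {0..<c} \<or> K = {c..<m}))"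

lemma odds_distinct: "distinct xs \<Longrightarrow> odds xs = set xs"
proof (induction xs)
  case (Cons x xs)
  then show ?case using odds_append[of "[x]" xs] by auto
qed simp

text \<open>
  Walking around a cycle of length \<open>m\<close>, everything met on the second turn cancels against the first.
\<close>
lemma odds_periodic:
  fixes f :: "nat \<Rightarrow> 'a"
  assumes inj: "inj_on f {..<m}" and per: "\<And>i. f (i + m) = f i" and "N \<le> 2 * m"
  shows "odds (map f [0..<N]) = (if N \<le> m then f ` {0..<N} else f ` {N - m..<m})"
proof -
  have init: "odds (map f [0..<k]) = f ` {0..<k}" if "k \<le> m" for k
    using odds_distinct[of "map f [0..<k]"] inj that
    by (simp add: distinct_map inj_on_def)
  show ?thesis
  proof (cases "N \<le> m")
    case False
    define k where "k = N - m"
    have k: "N = m + k" "k \<le> m" using False assms(3) by (auto simp: k_def)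
    have "map f [0..<N] = map f [0..<m] @ map (\<lambda>i. f (i + m)) [0..<k]"
      unfolding k upt_add_eq_append[OF le0] map_append
      by (simp add: map_add_upt[symmetric] add.commute del: map_add_upt)
    then have "odds (map f [0..<N]) = sym_diff (f ` {0..<m}) (f ` {0..<k})"
      using k by (simp add: per odds_append init)
    also have "f ` {0..<k} \<subseteq> f ` {0..<m}" using k by auto
    then have "sym_diff (f ` {0..<m}) (f ` {0..<k}) = f ` {0..<m} - f ` {0..<k}" by auto
    also have "\<dots> = f ` ({0..<m} - {0..<k})"
      using k by (intro inj_on_image_set_diff[symmetric, OF inj]) auto
    also have "{0..<m} - {0..<k} = {k..<m}" using k by auto
    finally show ?thesis using False by (simp add: k_def)
  qed (simp add: init)
qed

context coxeter
begin

text \<open>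
  The walls of a rank-two residue in cyclic order, indexed by integers modulo \<open>m\<close>. The numbering starts
  next to the chamber of the residue that is closest to \<open>\<one>\<close>, which makes the last clause possible.
\<close>
definition reflection_fan :: "int \<Rightarrow> (int \<Rightarrow> 'a) \<Rightarrow> bool" where
  "reflection_fan m t \<longleftrightarrow> m > 0 \<and> (\<forall>i. t i \<in> carrier W) \<and> inj_on t {0..<m} \<and>
     (\<forall>i. t (i + m) = t i) \<and> (\<forall>i j. conjugate (t i) (t j) = t (2 * i - j)) \<and>
     (\<forall>x\<in>carrier W. end_segment m {i \<in> {0..<m}. t i \<in> inversions x})"

lemma conjugate_hom: "x \<in> carrier W \<Longrightarrow> conjugate x \<in> hom W W"
  by (rule homI) (simp_all add: conjugate_mult)

text \<open>
  If \<open>z\<close> and \<open>\<one>\<close> are on the same side of the wall \<open>u\<^sup>-\<^sup>1 p u\<close>, then \<open>u z\<close> and \<open>u\<close> are on the same side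
  of \<open>p\<close>.
\<close>
lemma inversions_coset_iff:
  assumes "u \<in> carrier W" "z \<in> carrier W" "p \<in> carrier W"
    and "conjugate (inv u) p \<notin> inversions z"
  shows "p \<in> inversions (u \<otimes> z) \<longleftrightarrow> p \<in> inversions u"
proof -
  have "p \<notin> conjugate u ` inversions z"
  proof
    assume "p \<in> conjugate u ` inversions z"
    then obtain q where q: "q \<in> inversions z" "p = conjugate u q" by auto
    then have "conjugate (inv u) p = q"
      using assms inversions_closed[OF assms(2)] by (auto simp: conjugate_conjugate)
    then show False using q assms(4) by simp
  qed
  then show ?thesis using assms by (auto simp: inversions_mult)
qed

context
  fixes a b
  assumes ab: "a \<in> S" "b \<in> S"
begin

abbreviation rot :: "int \<Rightarrow> 'a" where
  "rot k \<equiv> (a \<otimes> b) [^] k"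

lemma rot_closed [simp]: "rot k \<in> carrier W"
  using ab by simp

lemma rot_add: "rot (j + k) = rot j \<otimes> rot k"
  using ab by (simp add: int_pow_mult)

lemma inv_rot: "inv (rot k) = rot (- k)"
  using ab by (simp add: int_pow_neg)

lemma swap_rot: "a \<otimes> rot k = rot (- k) \<otimes> a"
proof -
  have "conjugate a (rot k) = conjugate a (a \<otimes> b) [^] k"
    using ab hom_int_pow[OF conjugate_hom] is_group by auto
  also have "conjugate a (a \<otimes> b) = inv (a \<otimes> b)"
    using ab by (simp add: conjugate_def inv_mult_group m_assoc[symmetric])
  also have "\<dots> [^] k = rot (- k)"
    using ab by (simp add: int_pow_inv int_pow_neg)
  finally have "conjugate a (rot k) \<otimes> a = rot (- k) \<otimes> a" by simp
  then show ?thesis using ab by (simp add: conjugate_swap)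
qed

abbreviation mirror :: "int \<Rightarrow> 'a" where
  "mirror k \<equiv> rot k \<otimes> a"

lemma mirror_rot: "mirror j \<otimes> rot k = mirror (j - k)"
  using ab by (simp add: m_assoc swap_rot) (simp add: m_assoc[symmetric] rot_add[symmetric])

lemma mirror_mirror: "mirror j \<otimes> mirror k = rot (j - k)"
  using ab mirror_rot[of j k] by (simp add: m_assoc[symmetric]) (simp add: m_assoc)

lemma mirror_square: "mirror k \<otimes> mirror k = \<one>"
  by (simp add: mirror_mirror)

lemma inv_mirror: "inv (mirror k) = mirror k"
  using ab by (simp add: inv_equality mirror_square)

lemma rot_mirror: "rot j \<otimes> mirror k = mirror (j + k)"
  using ab by (simp add: m_assoc[symmetric] rot_add)

lemma conjugate_rot_mirror: "conjugate (rot j) (mirror k) = mirror (2 * j + k)"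
  by (simp add: conjugate_def rot_mirror inv_rot mirror_rot algebra_simps)

lemma conjugate_mirror_mirror: "conjugate (mirror j) (mirror k) = mirror (2 * j - k)"
  by (simp add: conjugate_def mirror_mirror inv_mirror rot_mirror algebra_simps)

definition dihedral :: "'a set" where
  "dihedral = range (\<lambda>k. rot k) \<union> range (\<lambda>k. mirror k)"

lemma dihedral_closed: "v \<in> dihedral \<Longrightarrow> v \<in> carrier W"
  using ab by (auto simp: dihedral_def)

lemma dihedral_inv: "v \<in> dihedral \<Longrightarrow> inv v \<in> dihedral"
  by (auto simp: dihedral_def inv_rot inv_mirror)

lemma dihedral_reflect: "v \<in> dihedral \<Longrightarrow> mirror k \<otimes> v \<in> dihedral"
  by (auto simp: dihedral_def mirror_rot mirror_mirror)

lemma dihedral_conjugate: "v \<in> dihedral \<Longrightarrow> \<exists>j. conjugate v (mirror k) = mirror j"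
  by (auto simp: dihedral_def conjugate_rot_mirror conjugate_mirror_mirror)

lemma one_dihedral: "\<one> \<in> dihedral"
  using int_pow_0[of W "a \<otimes> b"] by (auto simp: dihedral_def intro!: image_eqI[of _ _ 0])

lemma rot_eq_iff: "rot j = rot k \<longleftrightarrow> int (ord (a \<otimes> b)) dvd k - j"
  using ab int_pow_eq[of "a \<otimes> b"] by simp

lemma mirror_eq_iff: "mirror j = mirror k \<longleftrightarrow> int (ord (a \<otimes> b)) dvd k - j"
  using ab by (simp add: rot_eq_iff)

text \<open>
  An element of the dihedral group is an alternating word of less than \<open>2 m\<close> letters that starts
  with \<open>a\<close>, and this word meets the mirrors in the order of their numbers.
\<close>
lemma mirror_inversions_end_segment:
  assumes v: "v \<in> dihedral" and m: "ord (a \<otimes> b) \<noteq> 0"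
  shows "end_segment (int (ord (a \<otimes> b))) {i \<in> {0..<int (ord (a \<otimes> b))}. mirror i \<in> inversions v}"
proof -
  let ?m = "ord (a \<otimes> b)"
  let ?f = "\<lambda>i::nat. mirror (int i)"
  have f: "(\<lambda>i::nat. (a \<otimes> b) [^] i \<otimes> a) = ?f" by (simp add: int_pow_int)
  have word: "concat (replicate k [a, b]) \<in> lists S" for k
    using ab by (induction k) auto
  note alt = alternating_walls[OF ab one_closed]
  have "\<exists>N\<le>2 * ?m. inversions v = odds (map ?f [0..<N])"
  proof -
    obtain k where k: "v = rot k \<or> v = mirror k" using v by (auto simp: dihedral_def)
    define l where "l = nat (k mod int ?m)"
    have l: "l < ?m" "rot k = rot (int l)"
      using m by (auto simp: l_def rot_eq_iff nat_less_iff mod_eq_dvd_iff[symmetric])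
    have w: "walls \<one> (concat (replicate l [a, b])) = map ?f [0..<2 * l]"
      "list_prod W (concat (replicate l [a, b])) = rot (int l)"
      using alt[of l] ab by (simp_all add: f[symmetric] int_pow_int)
    from k show ?thesis
    proof
      assume "v = rot k"
      then show ?thesis
        using inversions_word[OF word[of l]] w l by (intro exI[of _ "2 * l"]) auto
    next
      assume "v = mirror k"
      moreover have "list_prod W (concat (replicate l [a, b]) @ [a]) = mirror k"
        using word[of l] ab w l by (simp add: word_append)
      moreover have "walls \<one> (concat (replicate l [a, b]) @ [a]) = map ?f [0..<Suc (2 * l)]"
        using word[of l] ab w conjugate_rot_mirror[of "int l" 0] by (simp add: walls_append)
      ultimately show ?thesis
        using inversions_word[of "concat (replicate l [a, b]) @ [a]"] word[of l] ab l
        by (intro exI[of _ "Suc (2 * l)"]) (auto simp del: upt_Suc)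
    qed
  qed
  then obtain N where N: "N \<le> 2 * ?m" "inversions v = odds (map ?f [0..<N])" by auto
  have inj: "inj_on ?f {..<?m}"
  proof (rule inj_onI)
    fix i j assume "i \<in> {..<?m}" "j \<in> {..<?m}" "?f i = ?f j"
    then have "int ?m dvd int j - int i" "i < ?m" "j < ?m" by (auto simp: mirror_eq_iff)
    then show "i = j" using zdvd_imp_le[of "int ?m" "int j - int i"] zdvd_imp_le[of "int ?m" "int i - int j"]
      by (cases i j rule: linorder_cases) (auto simp: dvd_diff_commute)
  qed
  have per: "?f (i + ?m) = ?f i" for i by (simp add: mirror_eq_iff)
  have img: "{i \<in> {0..<int ?m}. mirror i \<in> ?f ` {c..<d}} = {int c..<int d}" if "d \<le> ?m" for c d
  proof (intro equalityI subsetI)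
    fix i assume i: "i \<in> {i \<in> {0..<int ?m}. mirror i \<in> ?f ` {c..<d}}"
    then obtain j where j: "j \<in> {c..<d}" "?f (nat i) = ?f j" by auto
    then have "nat i = j" using inj_onD[OF inj j(2)] i that by auto
    then show "i \<in> {int c..<int d}" using j i by auto
  next
    fix i assume "i \<in> {int c..<int d}"
    then show "i \<in> {i \<in> {0..<int ?m}. mirror i \<in> ?f ` {c..<d}}"
      using that by (auto intro!: image_eqI[of _ _ "nat i"])
  qed
  show ?thesis
  proof (cases "N \<le> ?m")
    case True
    then have "{i \<in> {0..<int ?m}. mirror i \<in> inversions v} = {0..<int N}"
      using odds_periodic[OF inj per N(1)] N(2) img[of N 0] by simp
    then show ?thesis using True unfolding end_segment_def
      by (intro exI[of _ "int N"]) auto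
  next
    case False
    then have "{i \<in> {0..<int ?m}. mirror i \<in> inversions v} = {int (N - ?m)..<int ?m}"
      using odds_periodic[OF inj per N(1)] N(2) img[of ?m "N - ?m"] by simp
    then show ?thesis using N(1) False unfolding end_segment_def
      by (intro exI[of _ "int (N - ?m)"]) auto
  qed
qed

text \<open>
  The chamber \<open>x\<close> is a shortest one of the residue, so it lies on the same side as \<open>\<one>\<close> of all walls of
  the residue. An arbitrary chamber \<open>z\<close> is moved by the reflections in these walls to one that also
  does, and this shows that the walls between \<open>\<one>\<close> and \<open>z\<close> correspond to the mirrors that separate an
  element of the dihedral group from \<open>\<one>\<close>.
\<close>
lemma residue_fan:
  assumes y: "y \<in> carrier W" and m: "ord (a \<otimes> b) \<noteq> 0"
  obtains x t where "x \<in> carrier W" "reflection_fan (int (ord (a \<otimes> b))) t"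
    "t 0 = conjugate x a" "t (- 1) = conjugate x b"
    "\<And>i. conjugate y (mirror i) \<in> range t"
proof -
  let ?m = "int (ord (a \<otimes> b))"
  obtain x where x: "x \<in> (\<lambda>v. y \<otimes> v) ` dihedral"
    and x_min: "\<And>p. p \<otimes> x \<in> (\<lambda>v. y \<otimes> v) ` dihedral \<Longrightarrow> p \<notin> inversions x"
    using shortest_element[of "(\<lambda>v. y \<otimes> v) ` dihedral"] one_dihedral y dihedral_closed by auto
  then obtain v where v: "v \<in> dihedral" "x = y \<otimes> v" by auto
  have vc: "v \<in> carrier W" and xc: "x \<in> carrier W" using v y dihedral_closed by auto
  define t where "t = (\<lambda>i. conjugate x (mirror i))"
  have tc: "t i \<in> carrier W" for i using xc ab by (simp add: t_def)
  have t_x: "t i \<notin> inversions x" for i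
  proof (rule x_min)
    have "t i \<otimes> x = y \<otimes> (v \<otimes> mirror i)"
      using xc ab y vc v(2) by (simp add: t_def conjugate_swap m_assoc)
    moreover have "v \<otimes> mirror i \<in> dihedral"
      using v(1) by (auto simp: dihedral_def rot_mirror mirror_mirror)
    ultimately show "t i \<otimes> x \<in> (\<lambda>v. y \<otimes> v) ` dihedral" by auto
  qed
  have conj_t: "\<exists>j. conjugate (conjugate x u) (t i) = t j" if u: "u \<in> dihedral" for u i
  proof -
    have uc: "u \<in> carrier W" using u dihedral_closed by auto
    obtain j where j: "conjugate u (mirror i) = mirror j" using dihedral_conjugate[OF u] by auto
    have "conjugate (conjugate x u) (t i) = conjugate (conjugate x u \<otimes> x) (mirror i)"
      using xc uc ab by (simp add: t_def conjugate_conjugate)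
    also have "\<dots> = conjugate x (conjugate u (mirror i))"
      using xc uc ab by (simp add: conjugate_swap conjugate_conjugate)
    finally show ?thesis using j by (auto simp: t_def)
  qed
  have inv_conj: "inv (conjugate x u) = conjugate x (inv u)" if "u \<in> carrier W" for u
    using that xc by (simp add: conjugate_def inv_mult_group m_assoc)
  have seg: "end_segment ?m {i \<in> {0..<?m}. t i \<in> inversions z}" if z: "z \<in> carrier W" for z
  proof -
    \<comment> \<open>The orbit of \<open>z\<close> under the reflections of the residue; \<open>d\<close> below leads back to \<open>z\<close>.\<close>
    let ?A = "(\<lambda>u. conjugate x u \<otimes> z) ` dihedral"
    have "?A \<subseteq> carrier W" using z xc dihedral_closed by auto
    moreover have "?A \<noteq> {}" using one_dihedral by blast
    ultimately obtain z' where z': "z' \<in> ?A" "\<And>p. p \<otimes> z' \<in> ?A \<Longrightarrow> p \<notin> inversions z'"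
      using shortest_element by blast
    then obtain u where u: "u \<in> dihedral" "z' = conjugate x u \<otimes> z" by auto
    have uc: "u \<in> carrier W" using u dihedral_closed by auto
    define d where "d = conjugate x (inv u)"
    have d: "d \<in> carrier W" "z = d \<otimes> z'" "z' \<in> carrier W"
      using u uc xc z by (simp_all add: d_def inv_conj[symmetric] m_assoc[symmetric])
    have t_z': "t i \<notin> inversions z'" for i
    proof (rule z'(2))
      have "t i \<otimes> z' = conjugate x (mirror i \<otimes> u) \<otimes> z"
        using u uc xc z ab tc by (simp add: conjugate_mult m_assoc t_def)
      then show "t i \<otimes> z' \<in> ?A" using dihedral_reflect[OF u(1)] by auto
    qed
    have conj_d: "\<exists>j. conjugate (inv d) (t i) = t j" for i
      using conj_t[OF u(1)] uc xc inv_conj[of "inv u"] by (simp add: d_def)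
    have "t i \<in> inversions z \<longleftrightarrow> mirror i \<in> inversions (inv u)" for i
    proof -
      have "t i \<in> inversions z \<longleftrightarrow> t i \<in> inversions d"
        using inversions_coset_iff[OF d(1,3) tc] conj_d[of i] t_z' d(2) by auto
      also have "\<dots> \<longleftrightarrow> t i \<in> inversions (d \<otimes> x)"
        using inversions_coset_iff[OF d(1) xc tc] conj_d[of i] t_x by auto
      also have "d \<otimes> x = x \<otimes> inv u" using xc uc by (simp add: d_def conjugate_swap)
      also have "t i \<in> inversions (x \<otimes> inv u) \<longleftrightarrow> t i \<in> conjugate x ` inversions (inv u)"
        using xc uc t_x by (auto simp: inversions_mult)
      also have "\<dots> \<longleftrightarrow> mirror i \<in> inversions (inv u)"
      proof
        assume "t i \<in> conjugate x ` inversions (inv u)"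
        then obtain q where "q \<in> inversions (inv u)" "conjugate x (mirror i) = conjugate x q"
          by (auto simp: t_def)
        then show "mirror i \<in> inversions (inv u)"
          using conjugate_eq_iff[of x "mirror i" q] xc ab inversions_closed[of "inv u"] uc by auto
      qed (auto simp: t_def)
      finally show ?thesis .
    qed
    then show ?thesis using mirror_inversions_end_segment[OF dihedral_inv[OF u(1)] m] by simp
  qed
  have "reflection_fan ?m t"
    unfolding reflection_fan_def
  proof (intro conjI allI ballI)
    show "inj_on t {0..<?m}"
    proof (rule inj_onI)
      fix i j assume ij: "i \<in> {0..<?m}" "j \<in> {0..<?m}" "t i = t j"
      then have "mirror i = mirror j" using conjugate_eq_iff[of x "mirror i" "mirror j"] xc ab by (simp add: t_def)
      then have "i mod ?m = j mod ?m" by (metis mirror_eq_iff mod_eq_dvd_iff)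
      then show "i = j" using ij by simp
    qed
    show "conjugate (t i) (t j) = t (2 * i - j)" for i j
      using xc ab conjugate_mirror_mirror[of i j]
      by (simp add: t_def conjugate_conjugate conjugate_swap)
        (simp add: conjugate_conjugate[symmetric])
    show "t (i + ?m) = t i" for i
      using mirror_eq_iff[of "i + ?m" i] by (simp add: t_def)
  qed (use m tc seg in auto)
  moreover have "t 0 = conjugate x a" "t (- 1) = conjugate x b"
    using xc ab by (simp_all add: t_def int_pow_neg inv_mult_group m_assoc)
  moreover have "conjugate y (mirror i) \<in> range t" for i
  proof -
    obtain j where j: "conjugate (inv v) (mirror i) = mirror j"
      using dihedral_conjugate[OF dihedral_inv[OF v(1)]] by auto
    have "t j = conjugate (x \<otimes> inv v) (mirror i)"
      using j[symmetric] xc vc ab by (simp add: t_def conjugate_conjugate)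
    also have "x \<otimes> inv v = y" using v y vc by (simp add: m_assoc)
    finally show ?thesis by (metis rangeI)
  qed
  ultimately show thesis using that xc by blast
qed

end

end

section \<open>Spanning the cycle space by peak reduction\<close>

lemma f2_span_base: "C \<in> \<C> \<Longrightarrow> C \<in> f2_span \<C>"
  by (simp add: f2_span_def f2.span_base)

lemma f2_span_empty: "{} \<in> f2_span \<C>"
  by (simp add: f2_span_def f2_indicator_empty f2.span_zero)

lemma f2_span_sym_diff: "A \<in> f2_span \<C> \<Longrightarrow> B \<in> f2_span \<C> \<Longrightarrow> sym_diff A B \<in> f2_span \<C>"
  unfolding f2_span_def mem_Collect_eq f2_indicator_sym_diff by (rule f2.span_add)

lemma card_sym_diff_parity:
  assumes "finite A" "finite B"
  shows "even (card (sym_diff A B)) = (even (card A) = even (card B))"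
proof -
  have "card A = card (A - B) + card (A \<inter> B)" "card B = card (B - A) + card (A \<inter> B)"
    using assms by (metis card_Diff_subset_Int card_mono finite_Int inf_le1 inf_le2 inf_commute le_add_diff_inverse2)+
  moreover have "card (sym_diff A B) = card (A - B) + card (B - A)"
    using assms by (intro card_Un_disjoint) auto
  ultimately show ?thesis by presburger
qed

lemma star_sym_diff: "{e \<in> sym_diff A B. v \<in> e} = sym_diff {e \<in> A. v \<in> e} {e \<in> B. v \<in> e}"
  by auto

lemma cycle_space_empty: "{} \<in> cycle_space V E"
  by (simp add: cycle_space_def degree_in_def)

lemma cycle_space_sym_diff:
  assumes "finite E" "A \<in> cycle_space V E" "B \<in> cycle_space V E"
  shows "sym_diff A B \<in> cycle_space V E"
proof -
  have sub: "A \<subseteq> E" "B \<subseteq> E" using assms by (auto simp: cycle_space_def)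
  have "even (degree_in (sym_diff A B) v)" if "v \<in> V" for v
  proof -
    have "finite {e \<in> A. v \<in> e}" "finite {e \<in> B. v \<in> e}"
      using sub assms(1) by (auto intro: finite_subset)
    then show ?thesis
      using that assms(2,3) unfolding degree_in_def star_sym_diff
      by (simp add: card_sym_diff_parity cycle_space_def degree_in_def)
  qed
  then show ?thesis using sub by (auto simp: cycle_space_def)
qed

lemma f2_span_subset_cycle_space:
  assumes "finite E" "\<C> \<subseteq> cycle_space V E"
  shows "f2_span \<C> \<subseteq> cycle_space V E"
proof
  fix F assume "F \<in> f2_span \<C>"
  then have "f2_indicator F \<in> f2.span (f2_indicator ` \<C>)" by (simp add: f2_span_def)
  also have "f2.span (f2_indicator ` \<C>) \<subseteq> f2_indicator ` cycle_space V E"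
  proof (rule f2.span_minimal)
    show "f2_indicator ` \<C> \<subseteq> f2_indicator ` cycle_space V E" using assms(2) by auto
    show "f2.subspace (f2_indicator ` cycle_space V E)"
      unfolding f2.subspace_def
    proof (intro conjI ballI allI)
      show "0 \<in> f2_indicator ` cycle_space V E"
        using cycle_space_empty f2_indicator_empty by (metis imageI)
      fix x assume x: "x \<in> f2_indicator ` cycle_space V E"
      show "x + y \<in> f2_indicator ` cycle_space V E" if "y \<in> f2_indicator ` cycle_space V E" for y
        using x that cycle_space_sym_diff[OF assms(1)] by (auto simp flip: f2_indicator_sym_diff)
      show "f2_scale c x \<in> f2_indicator ` cycle_space V E" for c
      proof (cases "c = 0")
        case True
        then have "f2_scale c x = f2_indicator {}" by (simp add: f2_scale_def f2_indicator_empty fun_eq_iff)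
        then show ?thesis using cycle_space_empty by (metis imageI)
      next
        case False
        then have "c = 1" by simp
        then have "f2_scale c x = x" unfolding f2_scale_def by (simp only: mult_1)
        then show ?thesis using x by simp
      qed
    qed
  qed
  finally show "F \<in> cycle_space V E"
    using bij_f2_indicator by (auto simp: bij_def inj_def)
qed

lemma is_cycle_in_cycle_space: "is_cycle V E C \<Longrightarrow> C \<in> cycle_space V E"
  by (force simp: is_cycle_def cycle_space_def)

text \<open>
  The edges from \<open>v\<close> to \<open>x\<close> and to \<open>y\<close> are interchangeable modulo the span of \<open>\<C>\<close> and subgraphs that avoid
  \<open>v\<close> and do not rise above it. The symmetric difference makes this an equivalence relation: it is empty
  for \<open>x = y\<close>.
\<close>
definition linked :: "'v set set set \<Rightarrow> ('v \<Rightarrow> nat) \<Rightarrow> 'v \<Rightarrow> 'v \<Rightarrow> 'v \<Rightarrow> bool" where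
  "linked \<C> h v x y \<longleftrightarrow>
     (\<exists>H\<in>f2_span \<C>. (\<forall>e\<in>H. \<forall>z\<in>e. h z \<le> h v) \<and>
        {e \<in> H. v \<in> e} = sym_diff {{v, x}} {{v, y}})"

lemma linked_refl: "linked \<C> h v x x"
  unfolding linked_def by (rule bexI[OF _ f2_span_empty]) auto

lemma linked_sym: "linked \<C> h v x y \<Longrightarrow> linked \<C> h v y x"
  unfolding linked_def by (simp add: Un_commute)

lemma linked_trans:
  assumes "linked \<C> h v x y" "linked \<C> h v y z"
  shows "linked \<C> h v x z"
proof -
  obtain H H' where H: "H \<in> f2_span \<C>" "\<forall>e\<in>H. \<forall>z\<in>e. h z \<le> h v"
      "{e \<in> H. v \<in> e} = sym_diff {{v, x}} {{v, y}}"
    and H': "H' \<in> f2_span \<C>" "\<forall>e\<in>H'. \<forall>z\<in>e. h z \<le> h v"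
      "{e \<in> H'. v \<in> e} = sym_diff {{v, y}} {{v, z}}"
    using assms by (auto simp: linked_def)
  have "{e \<in> sym_diff H H'. v \<in> e} = sym_diff {{v, x}} {{v, z}}"
    unfolding star_sym_diff H(3) H'(3) by blast
  then show ?thesis
    unfolding linked_def
    by (intro bexI[OF _ f2_span_sym_diff[OF H(1) H'(1)]]) (use H(2) H'(2) in auto)
qed

text \<open>
  An even number of interchangeable edges at \<open>v\<close> can be cancelled in pairs.
\<close>
lemma peak_cancellation:
  assumes "finite K" "even (card K)" "K \<subseteq> (\<lambda>x. {v, x}) ` X"
    and linked: "\<And>x y. x \<in> X \<Longrightarrow> y \<in> X \<Longrightarrow> linked \<C> h v x y"
  shows "\<exists>H\<in>f2_span \<C>. (\<forall>e\<in>H. \<forall>z\<in>e. h z \<le> h v) \<and> {e \<in> H. v \<in> e} = K"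
  using assms(1-3)
proof (induction "card K" arbitrary: K rule: less_induct)
  case less
  show ?case
  proof (cases "K = {}")
    case True
    then show ?thesis by (intro bexI[OF _ f2_span_empty]) auto
  next
    case False
    then obtain e where e: "e \<in> K" by auto
    have "K \<noteq> {e}" using less.prems(2) by auto
    then obtain e' where e': "e' \<in> K" "e' \<noteq> e" using e by auto
    obtain x y where xy: "e = {v, x}" "e' = {v, y}" "x \<in> X" "y \<in> X" using less.prems(3) e e' by blast
    let ?K = "K - {e, e'}"
    have card: "card K = card ?K + 2"
      using e e' less.prems(1) card_Diff_subset[of "{e, e'}" K] card_mono[of K "{e, e'}"] by auto
    then obtain H where H: "H \<in> f2_span \<C>" "\<forall>e\<in>H. \<forall>z\<in>e. h z \<le> h v" "{e \<in> H. v \<in> e} = ?K"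
      using less.hyps[of ?K] less.prems by auto
    obtain H' where H': "H' \<in> f2_span \<C>" "\<forall>e\<in>H'. \<forall>z\<in>e. h z \<le> h v"
        "{e \<in> H'. v \<in> e} = sym_diff {e} {e'}"
      using linked[OF xy(3,4)] xy by (auto simp: linked_def)
    have "{e \<in> sym_diff H H'. v \<in> e} = K"
      unfolding star_sym_diff H(3) H'(3) using e e' by auto
    then show ?thesis
      by (intro bexI[OF _ f2_span_sym_diff[OF H(1) H'(1)]]) (use H(2) H'(2) in auto)
  qed
qed

text \<open>
  An even subgraph has an even number of edges at its highest vertex \<open>v\<close>, all of them leading down.
  If any two of these are linked, an element of the span removes them all without
  introducing vertices above \<open>v\<close> or new edges at \<open>v\<close>, and the highest vertex of the sum is lower.
\<close>
lemma cycle_space_by_peak_reduction: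
  fixes h :: "'v \<Rightarrow> nat"
  assumes "finite E" and \<C>: "\<C> \<subseteq> cycle_space V E"
    and edges: "\<And>e. e \<in> E \<Longrightarrow> \<exists>x\<in>V. \<exists>y\<in>V. x \<noteq> y \<and> e = {x, y}"
    and inj: "inj_on h V"
    and peak: "\<And>v x y. v \<in> V \<Longrightarrow> {v, x} \<in> E \<Longrightarrow> {v, y} \<in> E \<Longrightarrow> h x < h v \<Longrightarrow> h y < h v \<Longrightarrow>
      linked \<C> h v x y"
  shows "cycle_space V E = f2_span \<C>"
proof
  show "f2_span \<C> \<subseteq> cycle_space V E" by (rule f2_span_subset_cycle_space[OF assms(1,2)])
  have "F \<in> f2_span \<C>" if "F \<in> cycle_space V E" "\<forall>e\<in>F. \<forall>z\<in>e. h z < N" for F N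
    using that
  proof (induction N arbitrary: F)
    case 0
    then have "e \<notin> F" for e using edges[of e] by (fastforce simp: cycle_space_def)
    then have "F = {}" by auto
    then show ?case by (simp add: f2_span_empty)
  next
    case (Suc N)
    have FE: "F \<subseteq> E" using Suc.prems(1) by (simp add: cycle_space_def)
    show ?case
    proof (cases "\<exists>v\<in>\<Union>F. h v = N")
      case False
      then have "\<forall>e\<in>F. \<forall>z\<in>e. h z < N" using Suc.prems(2) less_antisym by blast
      then show ?thesis using Suc.IH Suc.prems(1) by auto
    next
      case True
      then obtain v e where v: "e \<in> F" "v \<in> e" "h v = N" by auto
      have vV: "v \<in> V" using edges[of e] v FE by auto
      let ?X = "{x. {v, x} \<in> E \<and> h x < h v}"
      let ?K = "{e \<in> F. v \<in> e}"
      have "?K \<subseteq> (\<lambda>x. {v, x}) ` ?X"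
      proof
        fix e assume e: "e \<in> ?K"
        then obtain x where x: "x \<in> V" "x \<noteq> v" "e = {v, x}"
          using edges[of e] FE by auto
        have "h x \<noteq> h v" using inj x vV by (auto simp: inj_on_def)
        moreover have "h x \<le> N" using Suc.prems(2) e x by fastforce
        ultimately show "e \<in> (\<lambda>x. {v, x}) ` ?X" using x e FE v(3) by auto
      qed
      moreover have "finite ?K" using FE assms(1) by (auto intro: finite_subset)
      moreover have "even (card ?K)"
        using Suc.prems(1) vV by (simp add: cycle_space_def degree_in_def)
      ultimately obtain H where H: "H \<in> f2_span \<C>" "\<forall>e\<in>H. \<forall>z\<in>e. h z \<le> h v" "{e \<in> H. v \<in> e} = ?K"
        using peak_cancellation[of ?K v ?X \<C> h] peak[OF vV] by auto
      have HV: "H \<in> cycle_space V E"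
        using f2_span_subset_cycle_space[OF assms(1,2)] H(1) by auto
      let ?F = "sym_diff F H"
      have F': "?F \<in> cycle_space V E"
        by (rule cycle_space_sym_diff[OF assms(1) Suc.prems(1) HV])
      have "{e \<in> ?F. v \<in> e} = {}" unfolding star_sym_diff H(3) by auto
      moreover have "h z \<le> N" if "e \<in> ?F" "z \<in> e" for e z
        using that H(2) Suc.prems(2) v(3) by (auto simp: less_Suc_eq_le)
      moreover have "z \<in> V" if "e \<in> ?F" "z \<in> e" for e z
        using that F' edges[of e] by (auto simp: cycle_space_def)
      ultimately have "h z < N" if "e \<in> ?F" "z \<in> e" for e z
        using that inj vV v(3) unfolding inj_on_def by (metis (no_types, lifting) empty_iff le_neq_implies_less mem_Collect_eq)
      then have "?F \<in> f2_span \<C>" using Suc.IH[OF F'] by blast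
      then have "sym_diff ?F H \<in> f2_span \<C>" using H(1) by (rule f2_span_sym_diff)
      moreover have "sym_diff ?F H = F" by auto
      ultimately show ?thesis by simp
    qed
  qed
  note bounded = this
  show "cycle_space V E \<subseteq> f2_span \<C>"
  proof
    fix F assume F: "F \<in> cycle_space V E"
    have "finite (\<Union>F)"
    proof (rule finite_Union)
      show "finite F" using F assms(1) by (auto simp: cycle_space_def intro: finite_subset)
      show "finite e" if "e \<in> F" for e using edges[of e] that F by (auto simp: cycle_space_def)
    qed
    then have "\<forall>e\<in>F. \<forall>z\<in>e. h z < Suc (Max (h ` \<Union>F))"
      by (auto simp: less_Suc_eq_le intro!: Max_ge)
    then show "F \<in> f2_span \<C>" using bounded F by blast
  qed
qed

definition polygon :: "nat \<Rightarrow> (nat \<Rightarrow> 'v) \<Rightarrow> 'v set set" where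
  "polygon L z = (\<lambda>i. {z i, z (Suc i mod L)}) ` {..<L}"

text \<open>
  Stated for every vertex of the polygon, because the highest vertex need not be the first one.
\<close>
lemma polygon_star:
  assumes L: "L \<ge> 3" and inj: "inj_on z {..<L}" and k: "k < L"
  shows "{e \<in> polygon L z. z k \<in> e} = {{z k, z (Suc k mod L)}, {z k, z ((k + L - 1) mod L)}}"
    and "{z k, z (Suc k mod L)} \<noteq> {z k, z ((k + L - 1) mod L)}"
proof -
  let ?p = "(k + L - 1) mod L"
  have eq: "z i = z j \<longleftrightarrow> i = j" if "i < L" "j < L" for i j
    using inj that by (auto simp: inj_on_def)
  have p: "?p = (if k = 0 then L - 1 else k - 1)"
  proof (cases k)
    case (Suc k')
    then have "k + L - 1 = k' + L" by simp
    then show ?thesis using Suc k by simp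
  qed (use k in auto)
  have s: "Suc i mod L = (if Suc i = L then 0 else Suc i)" if "i < L" for i
    using that by auto
  have ps: "Suc ?p mod L = k" using p s k by auto
  have pk: "?p < L" using k by auto
  have uniq: "i = ?p" if "i < L" "Suc i mod L = k" for i
    using that p s k by (auto split: if_splits)
  show "{e \<in> polygon L z. z k \<in> e} = {{z k, z (Suc k mod L)}, {z k, z ?p}}"
  proof (intro equalityI subsetI)
    fix e assume "e \<in> {e \<in> polygon L z. z k \<in> e}"
    then obtain i where i: "i < L" "e = {z i, z (Suc i mod L)}" "z k = z i \<or> z k = z (Suc i mod L)"
      by (auto simp: polygon_def)
    then have "k = i \<or> k = Suc i mod L" using eq k by auto
    then show "e \<in> {{z k, z (Suc k mod L)}, {z k, z ?p}}"
      using i uniq[of i] by (auto simp: insert_commute)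
  next
    fix e assume "e \<in> {{z k, z (Suc k mod L)}, {z k, z ?p}}"
    moreover have "{z k, z ?p} = {z ?p, z (Suc ?p mod L)}" using ps by (simp add: insert_commute)
    ultimately show "e \<in> {e \<in> polygon L z. z k \<in> e}"
      using k pk unfolding polygon_def by auto
  qed
  have "Suc k mod L \<noteq> ?p" using p s[OF k] L k by auto
  then have "z (Suc k mod L) \<noteq> z ?p" using eq[of "Suc k mod L" ?p] pk k by simp
  moreover have "z (Suc k mod L) \<noteq> z k" using eq[of "Suc k mod L" k] s[OF k] L k by auto
  ultimately show "{z k, z (Suc k mod L)} \<noteq> {z k, z ?p}" by (auto simp: doubleton_eq_iff)
qed

lemma polygon_is_cycle:
  assumes L: "L \<ge> 3" and inj: "inj_on z {..<L}"
    and edges: "\<And>i. i < L \<Longrightarrow> {z i, z (Suc i mod L)} \<in> E"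
  shows "is_cycle V E (polygon L z)" and "card (polygon L z) = L"
proof -
  let ?C = "polygon L z"
  let ?R = "{(x, y). {x, y} \<in> ?C}"
  have eq: "z i = z j \<longleftrightarrow> i = j" if "i < L" "j < L" for i j
    using inj that by (auto simp: inj_on_def)
  have range: "\<exists>i<L. x = z i" if x: "x \<in> \<Union>?C" for x
  proof -
    obtain i where "i < L" "x = z i \<or> x = z (Suc i mod L)" using x by (auto simp: polygon_def)
    moreover have "Suc i mod L < L" using L by simp
    ultimately show ?thesis by blast
  qed
  have symR: "sym (?R\<^sup>*)" by (rule sym_rtrancl) (auto simp: sym_def insert_commute)
  have zero: "(z 0, z i) \<in> ?R\<^sup>*" if "i < L" for i
    using that
  proof (induction i)
    case (Suc i)
    then have "(z i, z (Suc i)) \<in> ?R" by (auto simp: polygon_def intro!: image_eqI[of _ _ i])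
    then show ?case using Suc by (auto intro: rtrancl_into_rtrancl)
  qed simp
  have conn: "connected_edges ?C"
    unfolding connected_edges_def
  proof (intro ballI)
    fix x y assume "x \<in> \<Union>?C" "y \<in> \<Union>?C"
    then obtain i j where "i < L" "x = z i" "j < L" "y = z j" using range by metis
    then show "(x, y) \<in> ?R\<^sup>*"
      using zero[of i] zero[of j] symR by (meson rtrancl_trans symD)
  qed
  have deg: "degree_in ?C v = 0 \<or> degree_in ?C v = 2" for v
  proof (cases "\<exists>i<L. v = z i")
    case True
    then obtain i where i: "i < L" "v = z i" by auto
    show ?thesis using polygon_star[OF L inj i(1)] i(2) by (simp add: degree_in_def)
  next
    case False
    then have "{e \<in> ?C. v \<in> e} = {}" using range by auto
    then show ?thesis unfolding degree_in_def by (metis card.empty)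
  qed
  have "?C \<noteq> {}" using L by (auto simp: polygon_def lessThan_empty_iff)
  then show "is_cycle V E ?C"
    using conn deg edges by (auto simp: is_cycle_def polygon_def)
  have "inj_on (\<lambda>i. {z i, z (Suc i mod L)}) {..<L}"
  proof (rule inj_onI)
    fix i j assume ij: "i \<in> {..<L}" "j \<in> {..<L}" "{z i, z (Suc i mod L)} = {z j, z (Suc j mod L)}"
    have "Suc i mod L < L" "Suc j mod L < L" using L by auto
    then have "i = j \<or> (i = Suc j mod L \<and> Suc i mod L = j)"
      using ij eq by (auto simp: doubleton_eq_iff)
    moreover have "Suc k mod L = (if Suc k = L then 0 else Suc k)" if "k < L" for k
      using that by auto
    ultimately show "i = j" using L ij by (auto split: if_splits)
  qed
  then show "card ?C = L" by (simp add: polygon_def card_image)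
qed

lemma linked_polygon:
  assumes L: "L \<ge> 3" "L \<in> \<L>" and inj: "inj_on z {..<L}"
    and edges: "\<And>i. i < L \<Longrightarrow> {z i, z (Suc i mod L)} \<in> E"
    and k: "k < L" and top: "\<And>i. i < L \<Longrightarrow> h (z i) \<le> h (z k)"
  shows "linked {C. is_cycle V E C \<and> card C \<in> \<L>} h (z k) (z (Suc k mod L)) (z ((k + L - 1) mod L))"
proof -
  have "polygon L z \<in> f2_span {C. is_cycle V E C \<and> card C \<in> \<L>}"
    using polygon_is_cycle[OF L(1) inj edges] L(2) by (intro f2_span_base) auto
  moreover have "h x \<le> h (z k)" if e: "e \<in> polygon L z" "x \<in> e" for e x
  proof -
    obtain i where "i < L" "x = z i \<or> x = z (Suc i mod L)" using e by (auto simp: polygon_def)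
    moreover have "Suc i mod L < L" using L(1) by simp
    ultimately show ?thesis using top by auto
  qed
  ultimately show ?thesis
    unfolding linked_def
    using polygon_star[OF L(1) inj k] by (intro bexI[of _ "polygon L z"]) auto
qed

section \<open>Bit strings\<close>

definition flip :: "nat list \<Rightarrow> nat set \<Rightarrow> nat list" where
  "flip e A = map (\<lambda>i. if i \<in> A then 1 - e ! i else e ! i) [0..<length e]"

definition bits :: "nat \<Rightarrow> nat list \<Rightarrow> bool" where
  "bits n e \<longleftrightarrow> length e = n \<and> set e \<subseteq> {0, 1}"

lemma bits_nth: "bits n e \<Longrightarrow> i < n \<Longrightarrow> e ! i = 0 \<or> e ! i = 1"
  unfolding bits_def using nth_mem[of i e] by blast

lemma length_flip [simp]: "length (flip e A) = length e"
  by (simp add: flip_def)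

lemma nth_flip: "i < length e \<Longrightarrow> flip e A ! i = (if i \<in> A then 1 - e ! i else e ! i)"
  by (simp add: flip_def)

lemma bits_flip:
  assumes "bits n e"
  shows "bits n (flip e A)"
  unfolding bits_def
proof (intro conjI subsetI)
  show "length (flip e A) = n" using assms by (simp add: bits_def)
  fix x assume "x \<in> set (flip e A)"
  then obtain i where i: "i < length e" "x = flip e A ! i" by (auto simp: in_set_conv_nth)
  then show "x \<in> {0, 1}"
    using bits_nth[OF assms, of i] assms by (auto simp: nth_flip bits_def)
qed

lemma flip_empty [simp]: "flip e {} = e"
  by (simp add: flip_def map_nth)

lemma flip_flip: "bits n e \<Longrightarrow> flip (flip e A) B = flip e (sym_diff A B)"
proof (rule nth_equalityI)
  fix i assume e: "bits n e" and "i < length (flip (flip e A) B)"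
  then have i: "i < length e" by simp
  then show "flip (flip e A) B ! i = flip e (sym_diff A B) ! i"
    using bits_nth[OF e, of i] e by (auto simp: nth_flip bits_def)
qed simp

lemma hamming_dist_flip:
  assumes "bits n e"
  shows "hamming_dist (flip e A) (flip e B) = card (sym_diff A B \<inter> {..<n})"
proof -
  have "flip e A ! i \<noteq> flip e B ! i \<longleftrightarrow> i \<in> sym_diff A B" if "i < n" for i
    using bits_nth[OF assms that] that assms by (auto simp: nth_flip bits_def)
  moreover have "length e = n" using assms by (simp add: bits_def)
  ultimately have "{i. i < length (flip e A) \<and> flip e A ! i \<noteq> flip e B ! i} = sym_diff A B \<inter> {..<n}"
    by auto
  then show ?thesis by (simp add: hamming_dist_def)
qed

lemma bits_eq_flip:
  assumes "bits n x" "bits n y"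
  shows "y = flip x {i. i < n \<and> x ! i \<noteq> y ! i}"
proof (rule nth_equalityI)
  show "length y = length (flip x {i. i < n \<and> x ! i \<noteq> y ! i})"
    using assms by (simp add: bits_def)
  fix i assume "i < length y"
  then have "i < n" "i < length x" using assms by (auto simp: bits_def)
  then show "y ! i = flip x {i. i < n \<and> x ! i \<noteq> y ! i} ! i"
    using bits_nth[of n x i] bits_nth[of n y i] assms by (auto simp: nth_flip)
qed

lemma binary_less:
  fixes f g :: "nat \<Rightarrow> bool"
  assumes "l < n" "f l" "\<not> g l" "\<And>k. l < k \<Longrightarrow> k < n \<Longrightarrow> f k = g k"
  shows "(\<Sum>k<n. if g k then 2 ^ k else 0) < (\<Sum>k<n. if f k then 2 ^ k else 0 :: nat)"
proof -
  let ?F = "\<lambda>f k. if f k then 2 ^ k else 0 :: nat"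
  have split: "(\<Sum>k<n. ?F h k) = (\<Sum>k<l. ?F h k) + (?F h l + (\<Sum>k\<in>{l<..<n}. ?F h k))" for h
  proof -
    have "{..<n} = {..<l} \<union> insert l {l<..<n}" using assms(1) by auto
    then have "(\<Sum>k<n. ?F h k) = (\<Sum>k\<in>{..<l} \<union> insert l {l<..<n}. ?F h k)" by metis
    also have "\<dots> = (\<Sum>k<l. ?F h k) + (\<Sum>k\<in>insert l {l<..<n}. ?F h k)"
      by (rule sum.union_disjoint) auto
    finally show ?thesis by simp
  qed
  have "(\<Sum>k<l. ?F g k) \<le> (\<Sum>k<l. 2 ^ k)" by (rule sum_mono) auto
  also have "\<dots> < 2 ^ l" by (induction l) auto
  finally have "(\<Sum>k<l. ?F g k) < 2 ^ l" .
  moreover have "(\<Sum>k\<in>{l<..<n}. ?F f k) = (\<Sum>k\<in>{l<..<n}. ?F g k)"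
    using assms(4) by (intro sum.cong) auto
  ultimately show ?thesis using assms(2,3) by (simp add: split[of f] split[of g])
qed

section \<open>Subexpressions as galleries\<close>

locale expression = coxeter W S for W (structure) and S +
  fixes ss w
  assumes ss: "set ss \<subseteq> S" and w: "w \<in> carrier W"
begin

abbreviation "n \<equiv> length ss"
abbreviation "V \<equiv> subexpressions W ss w"
abbreviation "E \<equiv> subexpression_edges W ss w"

lemma ss_nth [simp, intro]: "i < n \<Longrightarrow> ss ! i \<in> S"
  using ss by auto

primrec prefix :: "nat list \<Rightarrow> nat \<Rightarrow> 'a" where
  "prefix e 0 = \<one>"
| "prefix e (Suc k) = (if e ! k = 1 then prefix e k \<otimes> ss ! k else prefix e k)"

definition hit :: "nat list \<Rightarrow> nat \<Rightarrow> 'a" where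
  "hit e k = conjugate (prefix e k) (ss ! k)"

lemma prefix_closed [simp]: "k \<le> n \<Longrightarrow> prefix e k \<in> carrier W"
  by (induction k) auto

lemma hit_closed [simp]: "k < n \<Longrightarrow> hit e k \<in> carrier W"
  by (simp add: hit_def)

lemma hit_square [simp]: "k < n \<Longrightarrow> hit e k \<otimes> hit e k = \<one>"
  by (simp add: hit_def conjugate_square)

lemma prefix_list_prod:
  assumes "bits n e" "k \<le> n"
  shows "list_prod W (take k (map2 (\<lambda>s k. s [^] k) ss e)) = prefix e k"
  using assms(2)
proof (induction k)
  case (Suc k)
  let ?xs = "map2 (\<lambda>s k. s [^] (k::nat)) ss e"
  have len: "length ?xs = n" "length e = n" using assms(1) by (auto simp: bits_def)
  have nth: "?xs ! k = ss ! k [^] (e ! k)" using Suc.prems len by simp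
  have sub: "set (take k ?xs) \<subseteq> carrier W"
    by (auto dest!: in_set_takeD set_zip_leftD simp: subsetD[OF ss])
  have "take (Suc k) ?xs = take k ?xs @ [ss ! k [^] (e ! k)]"
    using Suc.prems len nth by (simp add: take_Suc_conv_app_nth del: take_map)
  then have "list_prod W (take (Suc k) ?xs) = prefix e k \<otimes> ss ! k [^] (e ! k)"
    using Suc sub by (simp add: list_prod_append del: take_map)
  then show ?case using bits_nth[OF assms(1), of k] Suc.prems by auto
qed simp

lemma vertex_iff: "e \<in> V \<longleftrightarrow> bits n e \<and> prefix e n = w"
proof (cases "bits n e")
  case True
  then show ?thesis
    using prefix_list_prod[OF True order.refl] by (auto simp: subexpressions_def bits_def)
next
  case False
  then show ?thesis by (auto simp: subexpressions_def bits_def)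
qed

lemma vertex_bits: "e \<in> V \<Longrightarrow> bits n e"
  by (simp add: vertex_iff)

lemma finite_V: "finite V"
proof (rule finite_subset)
  show "V \<subseteq> {e. set e \<subseteq> {0, 1} \<and> length e = n}" by (auto simp: subexpressions_def)
qed (simp add: finite_lists_length_eq)

lemma finite_E: "finite E"
proof (rule finite_subset)
  show "E \<subseteq> (\<lambda>(x, y). {x, y}) ` (V \<times> V)" by (auto simp: subexpression_edges_def)
qed (simp add: finite_V)

text \<open>
  The chambers between the two positions are reflected in the first wall, and those after the second
  position in both walls, one after the other.
\<close>
lemma prefix_flip_pair:
  assumes e: "bits n e" and ij: "i < j" "j < n" and k: "k \<le> n"
  shows "prefix (flip e {i, j}) k =
    (if k \<le> i then prefix e k else if k \<le> j then hit e i \<otimes> prefix e k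
     else hit e i \<otimes> hit e j \<otimes> prefix e k)"
  using k
proof (induction k)
  case (Suc k)
  have len: "length e = n" using e by (simp add: bits_def)
  have bit: "e ! k = 0 \<or> e ! k = 1" using bits_nth[OF e] Suc.prems by simp
  have step: "(if 1 - e ! k = 1 then prefix e k \<otimes> ss ! k else prefix e k) = hit e k \<otimes> prefix e (Suc k)"
    using bit Suc.prems by (auto simp: hit_def conjugate_swap m_assoc[symmetric]) (auto simp: m_assoc)
  consider "k < i" | "k = i" | "i < k" "k < j" | "k = j" | "j < k" using ij(1) by linarith
  then show ?case
  proof cases
    case 2
    then show ?thesis using Suc step ij len by (auto simp: nth_flip)
  next
    case 4
    have "prefix (flip e {i, j}) (Suc k) =
      hit e i \<otimes> (if 1 - e ! k = 1 then prefix e k \<otimes> ss ! k else prefix e k)"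
      using 4 Suc ij len by (auto simp: nth_flip m_assoc)
    also have "\<dots> = hit e i \<otimes> hit e j \<otimes> prefix e (Suc k)"
      unfolding step using 4 ij by (simp add: m_assoc del: prefix.simps)
    finally show ?thesis using 4 ij by (simp del: prefix.simps)
  qed (use Suc ij len in \<open>auto simp: nth_flip m_assoc\<close>)
qed simp

lemma prefix_flip:
  assumes e: "bits n e" and ij: "i < j" "j < n" "hit e i = hit e j" and k: "k \<le> n"
  shows "prefix (flip e {i, j}) k = (if i < k \<and> k \<le> j then hit e i \<otimes> prefix e k else prefix e k)"
  using prefix_flip_pair[OF e ij(1,2) k] ij k by auto

text \<open>
  The wall at position \<open>j\<close> itself is not affected, since it is the mirror of the reflection. This is why
  nested and disjoint pairs of flips do not interfere.
\<close>
lemma hit_flip: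
  assumes e: "bits n e" and ij: "i < j" "j < n" "hit e i = hit e j" and k: "k < n"
  shows "hit (flip e {i, j}) k = (if i < k \<and> k < j then conjugate (hit e i) (hit e k) else hit e k)"
proof -
  have "hit (flip e {i, j}) k = (if i < k \<and> k \<le> j then conjugate (hit e i) (hit e k) else hit e k)"
    using prefix_flip[OF e ij, of k] k ij by (simp add: hit_def conjugate_conjugate)
  moreover have "conjugate (hit e i) (hit e j) = hit e j" using ij by (simp flip: ij(3))
  ultimately show ?thesis by auto
qed

lemma flip_vertex:
  assumes "e \<in> V" "i < j" "j < n" "hit e i = hit e j"
  shows "flip e {i, j} \<in> V"
  using assms prefix_flip[of e i j n] by (auto simp: vertex_iff bits_flip)

lemma flip_edge:
  assumes "bits n e" "flip e A \<in> V" "flip e B \<in> V" "A \<subseteq> {..<n}" "B \<subseteq> {..<n}" "card (sym_diff A B) = 2"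
  shows "{flip e A, flip e B} \<in> E"
proof -
  have "sym_diff A B \<inter> {..<n} = sym_diff A B" using assms(4,5) by auto
  then show ?thesis
    using assms hamming_dist_flip[OF assms(1), of A B] by (auto simp: subexpression_edges_def)
qed

text \<open>
  The target is preserved iff the product of the two reflections is \<open>\<one>\<close>, that is, iff they are equal.
\<close>
lemma edge_flip:
  assumes "{x, y} \<in> E"
  obtains i j where "x \<in> V" "y \<in> V" "i < j" "j < n" "hit x i = hit x j" "y = flip x {i, j}"
proof -
  have sym: "hamming_dist x y = hamming_dist y x" if "x \<in> V" "y \<in> V" for x y
    using that by (auto simp: hamming_dist_def vertex_iff bits_def intro!: arg_cong[of _ _ card])
  have xy: "x \<in> V" "y \<in> V" "hamming_dist x y = 2"
    using assms sym by (auto simp: subexpression_edges_def doubleton_eq_iff)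
  let ?D = "{i. i < n \<and> x ! i \<noteq> y ! i}"
  have b: "bits n x" "bits n y" using xy vertex_bits by auto
  have "card ?D = 2" using xy(3) b(1) by (simp add: hamming_dist_def bits_def)
  then obtain i j where ij: "?D = {i, j}" "i \<noteq> j" by (meson card_2_iff)
  define i' j' where "i' = min i j" and "j' = max i j"
  have D: "?D = {i', j'}" "i' < j'" using ij by (auto simp: i'_def j'_def min_def max_def)
  then have j': "j' < n" by blast
  have y: "y = flip x {i', j'}" using bits_eq_flip[OF b] D by simp
  have "\<not> n \<le> i'" "\<not> n \<le> j'" using D(2) j' by auto
  then have "hit x i' \<otimes> hit x j' \<otimes> prefix x n = prefix y n"
    unfolding y by (simp add: prefix_flip_pair[OF b(1) D(2) j'])
  then have "hit x i' \<otimes> hit x j' \<otimes> w = w" using xy by (simp add: vertex_iff)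
  then have "hit x i' \<otimes> hit x j' = \<one>" using w j' D(2) by simp
  then have "hit x i' \<otimes> hit x j' = hit x j' \<otimes> hit x j'" using j' by simp
  moreover have "hit x i' \<otimes> hit x j' = hit x j' \<otimes> hit x j' \<longleftrightarrow> hit x i' = hit x j'"
    using j' D(2) by (intro right_cancel) auto
  ultimately have "hit x i' = hit x j'" by blast
  then show thesis using that xy D j' y by blast
qed

text \<open>
  The wall hit at \<open>k\<close> separates the chamber before position \<open>k\<close> from \<open>\<one>\<close>, whether it is then crossed or not.
\<close>
definition descent :: "nat list \<Rightarrow> nat \<Rightarrow> bool" where
  "descent e k \<longleftrightarrow> hit e k \<in> inversions (prefix e k)"

text \<open>
  Late positions weigh more: an edge changes the descents at the larger of its two positions but
  at no later one.
\<close>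
definition height :: "nat list \<Rightarrow> nat" where
  "height e = (\<Sum>k<n. if descent e k then 2 ^ k else 0)"

text \<open>
  From the last position on which they differ, two galleries with the same target run through the
  same chambers backwards from \<open>w\<close>. Just before that position they are on different sides of the
  same wall.
\<close>
lemma last_difference:
  assumes xy: "x \<in> V" "y \<in> V" and l: "l < n" "x ! l \<noteq> y ! l"
    and above: "\<And>k. l < k \<Longrightarrow> k < n \<Longrightarrow> x ! k = y ! k"
  shows "descent y l = (\<not> descent x l)" and "\<And>k. l < k \<Longrightarrow> k < n \<Longrightarrow> descent x k = descent y k"
proof -
  have eq: "prefix x k = prefix y k" if "k \<le> n" "l < k" for k
    using that
  proof (induction k rule: inc_induct)
    case base
    then show ?case using xy by (simp add: vertex_iff)
  next
    case (step k)
    then have "prefix x (Suc k) = prefix y (Suc k)" "x ! k = y ! k" using above by auto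
    then show ?case using step.hyps by (auto split: if_splits)
  qed
  show "descent x k = descent y k" if "l < k" "k < n" for k
    using eq[of k] that by (simp add: descent_def hit_def)
  have bits: "x ! l = 0 \<or> x ! l = 1" "y ! l = 0 \<or> y ! l = 1"
    using xy l bits_nth vertex_bits by metis+
  have "prefix x (Suc l) = prefix y (Suc l)" using l by (intro eq) auto
  then have "prefix y l = prefix x l \<otimes> ss ! l"
    using bits l by (auto simp: m_assoc)
  then show "descent y l = (\<not> descent x l)"
    using l by (auto simp: descent_def hit_def inversions_step conjugate_conjugate[symmetric])
qed

lemma height_less:
  assumes xy: "x \<in> V" "y \<in> V" and l: "l < n" "x ! l \<noteq> y ! l"
    and above: "\<And>k. l < k \<Longrightarrow> k < n \<Longrightarrow> x ! k = y ! k" and "descent x l"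
  shows "height y < height x"
  unfolding height_def
  by (rule binary_less[of l]) (use assms last_difference[OF xy l above] in auto)

lemma height_flip_less:
  assumes "v \<in> V" "flip v A \<in> V" "l \<in> A" "A \<subseteq> {..l}" "l < n" "descent v l"
  shows "height (flip v A) < height v"
proof (rule height_less[OF assms(1,2,5)])
  have b: "bits n v" using assms(1) vertex_bits by auto
  then have "length v = n" by (simp add: bits_def)
  then show "v ! l \<noteq> flip v A ! l" "\<And>k. l < k \<Longrightarrow> k < n \<Longrightarrow> v ! k = flip v A ! k"
    using assms bits_nth[OF b, of l] by (auto simp: nth_flip)
qed (rule assms(6))

lemma inj_on_height: "inj_on height V"
proof (rule inj_onI, rule ccontr)
  fix x y assume xy: "x \<in> V" "y \<in> V" "height x = height y" "x \<noteq> y"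
  have len: "length x = n" "length y = n" using xy vertex_bits by (auto simp: bits_def)
  let ?D = "{i. i < n \<and> x ! i \<noteq> y ! i}"
  have "?D \<noteq> {}"
  proof
    assume "?D = {}"
    then have "x = y" using len by (intro nth_equalityI) auto
    then show False using xy(4) by simp
  qed
  then have "Max ?D \<in> ?D" by (intro Max_in) auto
  then obtain l where l: "l = Max ?D" "l < n" "x ! l \<noteq> y ! l" by auto
  have above: "x ! k = y ! k" if "l < k" "k < n" for k
  proof (rule ccontr)
    assume "x ! k \<noteq> y ! k"
    then have "k \<in> ?D" using that by simp
    then have "k \<le> l" unfolding l(1) by (intro Max_ge) auto
    then show False using that by simp
  qed
  have "descent x l \<or> descent y l"
    using last_difference(1)[OF xy(1,2) l(2,3)] above by auto
  then show False
  proof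
    assume "descent x l"
    then show False using height_less[OF xy(1,2) l(2,3)] above xy(3) by auto
  next
    assume "descent y l"
    then show False using height_less[OF xy(2,1) l(2)] l(3) above xy(3) by auto
  qed
qed

lemma down_edge:
  assumes "{v, u} \<in> E" "height u < height v"
  obtains i j where "i < j" "j < n" "hit v i = hit v j" "u = flip v {i, j}" "descent v j"
proof -
  obtain i j where ij: "v \<in> V" "u \<in> V" "i < j" "j < n" "hit v i = hit v j" "u = flip v {i, j}"
    using edge_flip[OF assms(1)] .
  have b: "bits n v" using ij vertex_bits by auto
  then have len: "length v = n" by (simp add: bits_def)
  have diff: "v ! j \<noteq> u ! j" "\<And>k. j < k \<Longrightarrow> k < n \<Longrightarrow> v ! k = u ! k"
    using ij len bits_nth[OF b, of j] by (auto simp: nth_flip)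
  have "descent v j"
  proof (rule ccontr)
    assume "\<not> descent v j"
    then have "descent u j" using last_difference(1)[OF ij(1,2,4) diff] by simp
    then have "height v < height u"
      using height_less[OF ij(2,1,4)] diff by auto
    then show False using assms(2) by simp
  qed
  then show thesis using that ij by blast
qed

definition short_cycles :: "nat list set set set" where
  "short_cycles = {C. is_cycle V E C \<and> card C \<in> {d + 2 | d. d \<in> order_divisors W ss}}"

abbreviation "linked_at v A B \<equiv> linked short_cycles height v (flip v A) (flip v B)"

text \<open>
  A cycle through \<open>v\<close> is described by the sets \<open>Q i\<close> of bits in which its vertices differ from \<open>v\<close>. The
  other vertices are lower than \<open>v\<close> if the largest element of each of these sets is a descent of \<open>v\<close>.
\<close>
lemma linked_flips:
  assumes v: "v \<in> V" and d: "L = d + 2" "d \<in> order_divisors W ss"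
    and inj: "inj_on Q {..<L}"
    and verts: "\<And>i. i < L \<Longrightarrow> flip v (Q i) \<in> V" and sub: "\<And>i. i < L \<Longrightarrow> Q i \<subseteq> {..<n}"
    and dist: "\<And>i. i < L \<Longrightarrow> card (sym_diff (Q i) (Q (Suc i mod L))) = 2"
    and k: "k < L" "Q k = {}"
    and top: "\<And>i. i < L \<Longrightarrow> i \<noteq> k \<Longrightarrow> \<exists>l\<in>Q i. Q i \<subseteq> {..l} \<and> descent v l"
  shows "linked_at v (Q (Suc k mod L)) (Q ((k + L - 1) mod L))"
proof -
  have b: "bits n v" using v vertex_bits by auto
  have L: "L \<ge> 3" using d by (auto simp: order_divisors_def)
  have vk: "flip v (Q k) = v" using k by simp
  have inj': "inj_on (\<lambda>i. flip v (Q i)) {..<L}"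
  proof (rule inj_onI)
    fix i j assume ij: "i \<in> {..<L}" "j \<in> {..<L}" "flip v (Q i) = flip v (Q j)"
    then have "card (sym_diff (Q i) (Q j) \<inter> {..<n}) = 0"
      using hamming_dist_flip[OF b, of "Q i" "Q j"] by (simp add: hamming_dist_def)
    then have "sym_diff (Q i) (Q j) = {}" using sub[of i] sub[of j] ij by auto
    then show "i = j" using inj ij by (auto simp: inj_on_def)
  qed
  have "linked short_cycles height (flip v (Q k)) (flip v (Q (Suc k mod L))) (flip v (Q ((k + L - 1) mod L)))"
    unfolding short_cycles_def
  proof (rule linked_polygon[where z = "\<lambda>i. flip v (Q i)", OF L _ inj' _ k(1)])
    show "L \<in> {d + 2 | d. d \<in> order_divisors W ss}" using d by auto
    show "{flip v (Q i), flip v (Q (Suc i mod L))} \<in> E" if "i < L" for i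
    proof -
      have "Suc i mod L < L" using L by simp
      then show ?thesis using flip_edge[OF b] verts sub dist that by blast
    qed
    show "height (flip v (Q i)) \<le> height (flip v (Q k))" if i: "i < L" for i
    proof (cases "i = k")
      case False
      then obtain l where "l \<in> Q i" "Q i \<subseteq> {..l}" "descent v l" using top i by blast
      then show ?thesis
        using height_flip_less[OF v verts[OF i]] sub[OF i] vk by force
    qed simp
  qed
  then show ?thesis using vk by simp
qed

lemma one_order_divisor: "1 \<in> order_divisors W ss"
  unfolding order_divisors_def by (auto intro!: exI[of _ "[]"])

lemma two_order_divisor:
  assumes "i < n"
  shows "2 \<in> order_divisors W ss"
proof -
  have "ord (ss ! i) = 2" using coxeter assms by (auto simp: coxeter_system_def)
  then show ?thesis
    using assms unfolding order_divisors_def by (auto intro!: exI[of _ "[ss ! i]"])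
qed

lemma linked_triangle:
  assumes v: "v \<in> V" and AB: "flip v A \<in> V" "flip v B \<in> V" "A \<subseteq> {..<n}" "B \<subseteq> {..<n}"
    and card: "card A = 2" "card B = 2" "card (sym_diff A B) = 2"
    and top: "\<exists>l\<in>A. A \<subseteq> {..l} \<and> descent v l" "\<exists>l\<in>B. B \<subseteq> {..l} \<and> descent v l"
  shows "linked_at v A B"
proof -
  define Q where "Q = (\<lambda>i::nat. if i = 0 then {} else if i = 1 then A else B)"
  have lt: "i < 3 \<longleftrightarrow> i = 0 \<or> i = 1 \<or> i = 2" for i :: nat by auto
  have "A \<noteq> {}" "B \<noteq> {}" "A \<noteq> B" using card by auto
  then have "inj_on Q {..<3}" by (auto simp: inj_on_def Q_def lt)
  then have "linked_at v (Q (Suc 0 mod 3)) (Q ((0 + 3 - 1) mod 3))"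
    using assms by (intro linked_flips[OF v, of 3 1 Q 0] one_order_divisor) (auto simp: Q_def lt)
  then show ?thesis by (simp add: Q_def)
qed

lemma linked_square:
  assumes v: "v \<in> V" and AB: "flip v A \<in> V" "flip v B \<in> V" "flip v (A \<union> B) \<in> V"
      "A \<subseteq> {..<n}" "B \<subseteq> {..<n}"
    and card: "card A = 2" "card B = 2" and disj: "A \<inter> B = {}"
    and top: "\<exists>l\<in>A. A \<subseteq> {..l} \<and> descent v l" "\<exists>l\<in>B. B \<subseteq> {..l} \<and> descent v l"
  shows "linked_at v A B"
proof -
  define Q where "Q = (\<lambda>i::nat. if i = 0 then {} else if i = 1 then A else if i = 2 then A \<union> B else B)"
  have lt: "i < 4 \<longleftrightarrow> i = 0 \<or> i = 1 \<or> i = 2 \<or> i = 3" for i :: nat by auto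
  have ne: "A \<noteq> {}" "B \<noteq> {}" using card by auto
  then have inj: "inj_on Q {..<4}" using disj by (auto simp: inj_on_def Q_def lt)
  obtain a b where ab: "a \<in> A" "A \<subseteq> {..a}" "descent v a" "b \<in> B" "B \<subseteq> {..b}" "descent v b"
    using top by auto
  have top_un: "\<exists>l\<in>A \<union> B. A \<union> B \<subseteq> {..l} \<and> descent v l"
    using ab by (intro bexI[of _ "max a b"]) (auto simp: max_def)
  have "sym_diff A (A \<union> B) = B" "sym_diff (A \<union> B) B = A" using disj by auto
  moreover have "2 \<in> order_divisors W ss" using ab AB two_order_divisor by auto
  ultimately have "linked_at v (Q (Suc 0 mod 4)) (Q ((0 + 4 - 1) mod 4))"
    using assms top_un inj by (intro linked_flips[OF v, of 4 2 Q 0]) (auto simp: Q_def lt)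
  then show ?thesis by (simp add: Q_def)
qed

end

section \<open>Galleries around a finite rank-two residue\<close>

lemma initial_segment:
  assumes "end_segment m K" "x \<in> K" "y \<notin> K" "x < y" "y < m"
  obtains q where "K = {0..<q}" "x < q" "q \<le> y"
  using assms unfolding end_segment_def by fastforce

lemma final_segment:
  assumes "end_segment m K" "x \<in> K" "y \<notin> K" "0 \<le> y" "y < x"
  obtains q where "K = {q..<m}" "y < q" "q \<le> x"
  using assms unfolding end_segment_def by fastforce

lemma last_switch:
  fixes P :: "nat \<Rightarrow> bool"
  assumes "k1 \<le> k2" "P k1 \<noteq> P k2"
  obtains i where "k1 \<le> i" "i < k2" "P i \<noteq> P k2" "\<And>k. i < k \<Longrightarrow> k \<le> k2 \<Longrightarrow> P k = P k2"
proof -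
  let ?A = "{i. i < k2 \<and> P i \<noteq> P k2}"
  have k1: "k1 \<in> ?A" using assms le_neq_implies_less by blast
  have fin: "finite ?A" by simp
  have "Max ?A \<in> ?A" using k1 fin by (intro Max_in) auto
  moreover have "k1 \<le> Max ?A" using k1 fin by (intro Max_ge) auto
  moreover have "P k = P k2" if "Max ?A < k" "k \<le> k2" for k
  proof (rule ccontr)
    assume "P k \<noteq> P k2"
    then have "k \<in> ?A" using that le_neq_implies_less by blast
    then have "k \<le> Max ?A" using fin by (intro Max_ge) auto
    then show False using that by simp
  qed
  ultimately show thesis using that[of "Max ?A"] by blast
qed

text \<open>
  The trace of a gallery on a rank-two residue with walls \<open>0, \<dots>, m - 1\<close>: the walls \<open>K k\<close> that separate the
  chamber before position \<open>k\<close> from \<open>\<one>\<close>, and the wall hit at position \<open>k\<close> if it is one of the residue. The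
  last assumption is the situation in which the descent \<open>l\<close> forms neither a triangle nor a square with
  any earlier descent \<open>j\<close> of the residue.
\<close>
locale fan_gallery =
  fixes m :: int and l :: nat and K :: "nat \<Rightarrow> int set" and wall :: "nat \<Rightarrow> int option" and c :: int
  assumes start: "K 0 = {}"
    and segment: "\<And>k. k \<le> l \<Longrightarrow> end_segment m (K k)"
    and step: "\<And>k. k < l \<Longrightarrow>
      K (Suc k) = K k \<or> (\<exists>a. wall k = Some a \<and> K (Suc k) = sym_diff (K k) {a})"
    and toggle: "\<And>k a. k \<le> l \<Longrightarrow> wall k = Some a \<Longrightarrow>
      0 \<le> a \<and> a < m \<and> end_segment m (sym_diff (K k) {a})"
    and last: "wall l = Some c" "c \<in> K l"
    and interleaved: "\<And>i j k a. j < l \<Longrightarrow> wall j = Some a \<Longrightarrow> a \<in> K j \<Longrightarrow> i < j \<Longrightarrow> wall i = Some a \<Longrightarrow>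
      k < l \<Longrightarrow> wall k = Some c \<Longrightarrow> i < k \<and> k < j"
begin

lemma switch:
  assumes "k1 \<le> k2" "k2 \<le> l" "(a \<in> K k1) \<noteq> (a \<in> K k2)"
  obtains i where "k1 \<le> i" "i < k2" "wall i = Some a" "(a \<in> K i) \<noteq> (a \<in> K k2)"
    "K (Suc i) = sym_diff (K i) {a}" "\<And>k. i < k \<Longrightarrow> k \<le> k2 \<Longrightarrow> (a \<in> K k) = (a \<in> K k2)"
proof -
  obtain i where i: "k1 \<le> i" "i < k2" "(a \<in> K i) \<noteq> (a \<in> K k2)"
    and after: "\<And>k. i < k \<Longrightarrow> k \<le> k2 \<Longrightarrow> (a \<in> K k) = (a \<in> K k2)"
    using last_switch[of k1 k2 "\<lambda>k. a \<in> K k"] assms by blast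
  have "(a \<in> K (Suc i)) \<noteq> (a \<in> K i)" using i after[of "Suc i"] by auto
  then have "wall i = Some a" "K (Suc i) = sym_diff (K i) {a}"
    using step[of i] i assms(2) by auto
  then show thesis using that i after by blast
qed

lemma enter:
  assumes "k1 \<le> k2" "k2 \<le> l" "a \<notin> K k1" "a \<in> K k2"
  shows "\<exists>i. k1 \<le> i \<and> i < k2 \<and> wall i = Some a \<and> a \<notin> K i \<and> K (Suc i) = insert a (K i)"
proof -
  have "(a \<in> K k1) \<noteq> (a \<in> K k2)" using assms by simp
  from switch[OF assms(1,2) this] obtain i where i: "k1 \<le> i" "i < k2" "wall i = Some a"
      "(a \<in> K i) \<noteq> (a \<in> K k2)" "K (Suc i) = sym_diff (K i) {a}" by metis
  have a: "a \<notin> K i" using i(4) assms(4) by simp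
  have "K (Suc i) = insert a (K i)" unfolding i(5) using a by blast
  then show ?thesis using i(1-3) a by blast
qed

lemma leave:
  assumes "k1 \<le> k2" "k2 \<le> l" "a \<in> K k1" "a \<notin> K k2"
  shows "\<exists>i. k1 \<le> i \<and> i < k2 \<and> wall i = Some a \<and> a \<in> K i \<and> K (Suc i) = K i - {a} \<and>
    (\<forall>k. i < k \<longrightarrow> k \<le> k2 \<longrightarrow> a \<notin> K k)"
proof -
  have "(a \<in> K k1) \<noteq> (a \<in> K k2)" using assms by simp
  from switch[OF assms(1,2) this] obtain i where i: "k1 \<le> i" "i < k2" "wall i = Some a"
      "(a \<in> K i) \<noteq> (a \<in> K k2)" "K (Suc i) = sym_diff (K i) {a}"
    and after: "\<And>k. i < k \<Longrightarrow> k \<le> k2 \<Longrightarrow> (a \<in> K k) = (a \<in> K k2)" by metis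
  have a: "a \<in> K i" using i(4) assms(4) by simp
  have "K (Suc i) = K i - {a}" unfolding i(5) using a by blast
  moreover have "\<forall>k. i < k \<longrightarrow> k \<le> k2 \<longrightarrow> a \<notin> K k" using after assms(4) by blast
  ultimately show ?thesis using i(1-3) a by blast
qed

lemma K_bounds: "k \<le> l \<Longrightarrow> K k \<subseteq> {0..<m}"
  using segment[of k] by (auto simp: end_segment_def)

text \<open>
  From \<open>p 0\<close> to \<open>p m\<close> the gallery hits the \<open>m\<close> walls in cyclic order and then the first one again. At the
  final position \<open>l\<close> it hits either the wall next in this order or the one that was hit two positions
  earlier. These are the walls seen from two neighbouring vertices of the polygon.
\<close>
definition pattern :: "(nat \<Rightarrow> nat) \<Rightarrow> int \<Rightarrow> int \<Rightarrow> bool" where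
  "pattern p b s \<longleftrightarrow> (s = 1 \<or> s = - 1) \<and> (\<forall>i\<le>nat m. p i < p (Suc i)) \<and> p (Suc (nat m)) = l \<and>
     (\<exists>a\<in>K (p (nat m)). wall (p (nat m)) = Some a) \<and>
     (\<forall>i\<le>nat m. wall (p i) = Some ((b + s * int i) mod m)) \<and>
     (c = (b + s * (m - 1)) mod m \<or> c = (b + s * (m + 1)) mod m)"

text \<open>
  Before its first descent \<open>j0\<close> the gallery only moves away from \<open>\<one>\<close>. Since the wall \<open>e\<close> of \<open>j0\<close> was crossed
  before \<open>c\<close> and can be crossed again, the gallery has reached the chamber opposite to \<open>\<one>\<close> in the
  residue: it has crossed the walls \<open>0, \<dots>, m - 1\<close> in this order, and \<open>e = 0\<close>. If \<open>c = m - 1\<close>, these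
  crossings together with \<open>j0\<close> and \<open>l\<close> are the required positions. Otherwise \<open>c\<close> is approached from the
  walls \<open>0, \<dots>, c - 1\<close>, since an approach from \<open>c + 1\<close> is excluded by the interleaving. The final
  crossings of these walls complete the crossings of \<open>c - 1, \<dots>, m - 1\<close> to the required list.
\<close>
lemma oriented_pattern:
  assumes j0: "j0 < l" "wall j0 = Some e" "e \<in> K j0"
    and first: "\<And>k a. k < j0 \<Longrightarrow> wall k = Some a \<Longrightarrow> a \<notin> K k"
    and ec: "e < c"
  shows "(\<exists>p b. pattern p b 1) \<and> K j0 = {0..<m}"
proof -
  have bounds: "0 \<le> e" "c < m" using toggle[of j0 e] toggle[of l c] j0 last by auto
  have mono: "K k \<subseteq> K k'" if "k \<le> k'" "k' \<le> j0" for k k'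
    using that
  proof (induction k' rule: dec_induct)
    case (step k')
    then have "K k' \<subseteq> K (Suc k')"
      using fan_gallery.step[OF fan_gallery_axioms, of k'] first[of k'] j0(1) by auto
    then show ?case using step by auto
  qed simp
  \<comment> \<open>All hits of \<open>c\<close> before \<open>l\<close> precede \<open>j0\<close>, so the side of \<open>c\<close> is decided there.\<close>
  have c_in: "c \<in> K j0"
  proof (rule ccontr)
    assume "c \<notin> K j0"
    then obtain k where k: "j0 \<le> k" "k < l" "wall k = Some c"
      using enter[of j0 l c] j0(1) last(2) less_imp_le by blast
    obtain i where i: "i < j0" "wall i = Some e" using enter[OF le0 less_imp_le[OF j0(1)], of e] j0(3) start by blast
    show False using interleaved[OF j0 i k(2,3)] k(1) by simp
  qed
  have e_first: "e \<in> K k" if k: "k \<le> j0" "c \<in> K k" for k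
  proof (rule ccontr)
    assume "e \<notin> K k"
    then obtain i where i: "k \<le> i" "i < j0" "wall i = Some e"
      using enter[OF k(1) less_imp_le[OF j0(1)], of e] j0(3) by blast
    have "k \<le> l" using k(1) j0(1) by simp
    then obtain k' where k': "k' < k" "wall k' = Some c"
      using enter[OF le0, of k c] k(2) start by blast
    then have "k' < l" using k j0(1) by simp
    then show False using interleaved[OF j0 i(2,3) _ k'(2)] i(1) k'(1) by simp
  qed
  obtain k1 where k1: "k1 < j0" "wall k1 = Some c" "c \<notin> K k1" "K (Suc k1) = insert c (K k1)"
    using enter[OF le0 less_imp_le[OF j0(1)], of c] c_in start by blast
  have "e \<in> K (Suc k1)" using e_first[of "Suc k1"] k1 by auto
  then have "e \<in> K k1" using k1 ec by auto
  then have zero_k1: "0 \<in> K k1"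
    using initial_segment[OF segment[of k1] _ k1(3) ec bounds(2)] k1(1) j0(1) bounds(1) by force
  then have zero: "0 \<in> K j0" using mono[of k1 j0] k1 by auto
  \<comment> \<open>A segment that contains \<open>0\<close> and \<open>c\<close>, and from which \<open>e < c\<close> can be removed, consists of all walls.\<close>
  have seg_j0: "end_segment m (sym_diff (K j0) {e})" using toggle[of j0 e] j0 by auto
  obtain q where q: "sym_diff (K j0) {e} = {q..<m}" "e < q" "q \<le> c"
    using final_segment[OF seg_j0, of c e] c_in j0(3) ec bounds by auto
  have e0: "e = 0"
  proof (rule ccontr)
    assume "e \<noteq> 0"
    then have "0 \<in> sym_diff (K j0) {e}" using zero by auto
    then show False using q bounds by auto
  qed
  have full: "K j0 = {0..<m}"
  proof
    show "K j0 \<subseteq> {0..<m}" using K_bounds j0(1) by auto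
    show "{0..<m} \<subseteq> K j0"
    proof (rule subsetI, rule ccontr)
      fix z assume z: "z \<in> {0..<m}" "z \<notin> K j0"
      then have "z \<noteq> e" using j0(3) by blast
      then have "z \<notin> sym_diff (K j0) {e}" using z(2) by simp
      then have "z < c" using z(1) q(3) unfolding q(1) by simp
      then obtain q' where "K j0 = {q'..<m}" "z < q'"
        using final_segment[OF segment[of j0], of c z] z c_in j0(1) by auto
      then show False using zero z by auto
    qed
  qed
  \<comment> \<open>The walls are crossed upwards from \<open>0\<close>; a descending order would cross \<open>c\<close> before \<open>0\<close>.\<close>
  have down: "a \<in> K k" if ka: "k \<le> j0" "a + 1 \<in> K k" "0 \<le> a" for a k
  proof (rule ccontr)
    assume "a \<notin> K k"
    then obtain q where q: "K k = {q..<m}" "a < q" "q \<le> a + 1"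
      using final_segment[OF segment[of k], of "a + 1" a] ka j0(1) by auto
    have "0 \<notin> K k" using q ka by auto
    then have ck: "c \<notin> K k" using e_first[of k] ka e0 by auto
    have "k \<le> k1"
    proof (rule ccontr)
      assume "\<not> k \<le> k1"
      then have "K (Suc k1) \<subseteq> K k" using mono[of "Suc k1" k] ka by auto
      then show False using k1 ck by auto
    qed
    moreover have "m - 1 \<in> K k" "c < m - 1" using q ka ck bounds by auto
    ultimately have "m - 1 \<in> K k1" using mono[of k k1] k1 by auto
    moreover have "k1 \<le> l" "0 \<le> c" using k1(1) j0(1) ec bounds(1) by auto
    ultimately obtain q' where "K k1 = {q'..<m}" "c < q'"
      using final_segment[OF segment _ k1(3)] \<open>c < m - 1\<close> by metis
    then show False using zero_k1 ec bounds by auto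
  qed
  have "\<exists>i. i < j0 \<and> wall i = Some a \<and> a \<notin> K i \<and> K (Suc i) = insert a (K i)" if "a \<in> {0..<m}" for a
    using enter[OF le0 less_imp_le[OF j0(1)], of a] start full that by blast
  then obtain \<iota> where \<iota>: "\<And>a. a \<in> {0..<m} \<Longrightarrow>
      \<iota> a < j0 \<and> wall (\<iota> a) = Some a \<and> a \<notin> K (\<iota> a) \<and> K (Suc (\<iota> a)) = insert a (K (\<iota> a))"
    by metis
  have \<iota>_less: "\<iota> a < \<iota> (a + 1)" if a: "0 \<le> a" "a + 1 < m" for a
  proof (rule ccontr)
    assume n: "\<not> \<iota> a < \<iota> (a + 1)"
    have "a + 1 \<in> K (Suc (\<iota> (a + 1)))" using \<iota>[of "a + 1"] a by auto
    then have "a \<in> K (Suc (\<iota> (a + 1)))" using down[of "Suc (\<iota> (a + 1))" a] \<iota>[of "a + 1"] a by auto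
    then have "a \<in> K (\<iota> (a + 1))" using \<iota>[of "a + 1"] a by auto
    then have "a \<in> K (\<iota> a)" using mono[of "\<iota> (a + 1)" "\<iota> a"] n \<iota>[of a] a by auto
    then show False using \<iota>[of a] a by auto
  qed
  have c_before: "k < j0" if "k < l" "wall k = Some c" for k
    using interleaved[OF j0, of "\<iota> 0" k] \<iota>[of 0] e0 that ec bounds by auto
  have c_stays: "c \<in> K k" if k: "j0 \<le> k" "k \<le> l" for k
  proof (rule ccontr)
    assume "c \<notin> K k"
    then obtain i where "j0 \<le> i" "i < k" "wall i = Some c"
      using leave[OF k c_in] by blast
    then show False using c_before[of i] k by auto
  qed
  define M where "M = nat m"
  have M: "m = int M" using bounds ec by (simp add: M_def)
  have "\<exists>p b. pattern p b 1"
  proof (cases "c = m - 1")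
    case True
    define p where "p = (\<lambda>i. if i < M then \<iota> (int i) else if i = M then j0 else l)"
    have "p i < p (Suc i)" if i: "i \<le> M" for i
    proof -
      consider "Suc i < M" | "Suc i = M" | "i = M" using i by linarith
      then show ?thesis
        using \<iota>_less[of "int i"] \<iota>[of "int i"] j0(1) M by cases (auto simp: p_def algebra_simps)
    qed
    moreover have "wall (p i) = Some ((0 + 1 * int i) mod m)" if "i \<le> M" for i
      using that \<iota>[of "int i"] M j0(2) e0 by (auto simp: p_def)
    moreover have "\<exists>a\<in>K (p M). wall (p M) = Some a" using j0(2,3) by (auto simp: p_def)
    moreover have "p (Suc M) = l" by (simp add: p_def)
    moreover have "(m - 1) mod m = m - 1" using ec bounds by (intro mod_pos_pos_trivial) auto
    then have "c = (0 + 1 * (m - 1)) mod m" using True by simp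
    ultimately have "pattern p 0 1" unfolding pattern_def M_def[symmetric] by blast
    then show ?thesis by blast
  next
    case False
    then have cm: "c + 1 < m" using bounds by auto
    \<comment> \<open>If \<open>c + 1\<close> had been crossed back, that crossing would be a descent whose wall was also hit
      after \<open>c\<close>, against the interleaving.\<close>
    have c1: "c + 1 \<in> K l"
    proof (rule ccontr)
      assume "c + 1 \<notin> K l"
      moreover have "c + 1 \<in> K j0" using full cm ec bounds by simp
      ultimately obtain h where h: "j0 \<le> h" "h < l" "wall h = Some (c + 1)" "c + 1 \<in> K h"
        using leave[OF less_imp_le[OF j0(1)] order.refl] by blast
      have "\<iota> (c + 1) < \<iota> c"
        using interleaved[OF h(2-4), of "\<iota> (c + 1)" "\<iota> c"] \<iota>[of c] \<iota>[of "c + 1"] h cm ec bounds by auto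
      then show False using \<iota>_less[of c] cm ec bounds by auto
    qed
    have seg_l: "end_segment m (sym_diff (K l) {c})" using toggle[of l c] last by auto
    obtain q where q: "sym_diff (K l) {c} = {q..<m}" "c < q" "q \<le> c + 1"
      using final_segment[OF seg_l, of "c + 1" c] c1 last ec bounds by auto
    \<comment> \<open>So the walls \<open>0, \<dots>, c - 1\<close> have been crossed back, and \<open>\<eta> a\<close> is the last time this happened to \<open>a\<close>.\<close>
    have low: "a \<notin> K l" if a: "a < c" for a
    proof
      assume "a \<in> K l"
      then have "a \<in> sym_diff (K l) {c}" using a by simp
      then show False unfolding q(1) using q(2) a by simp
    qed
    have "\<exists>h. j0 \<le> h \<and> h < l \<and> wall h = Some a \<and> a \<in> K h \<and> K (Suc h) = K h - {a} \<and>
        (\<forall>k. h < k \<longrightarrow> k \<le> l \<longrightarrow> a \<notin> K k)" if a: "a \<in> {0..<c}" for a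
    proof -
      have "a \<in> K j0" "a \<notin> K l" using full a low[of a] bounds by auto
      then show ?thesis using leave[OF less_imp_le[OF j0(1)] order.refl] by blast
    qed
    then obtain \<eta> where \<eta>: "\<And>a. a \<in> {0..<c} \<Longrightarrow> j0 \<le> \<eta> a \<and> \<eta> a < l \<and> wall (\<eta> a) = Some a \<and>
        a \<in> K (\<eta> a) \<and> K (Suc (\<eta> a)) = K (\<eta> a) - {a} \<and> (\<forall>k. \<eta> a < k \<longrightarrow> k \<le> l \<longrightarrow> a \<notin> K k)"
      by metis
    have \<eta>_less: "\<eta> a < \<eta> (a + 1)" if a: "0 \<le> a" "a + 1 < c" for a
    proof (rule ccontr)
      assume n: "\<not> \<eta> a < \<eta> (a + 1)"
      have "c \<in> K (\<eta> a)" "a \<in> K (\<eta> a)" using c_stays[of "\<eta> a"] \<eta>[of a] a by auto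
      then have "a + 1 \<in> K (\<eta> a)"
        using final_segment[OF segment[of "\<eta> a"], of c "a + 1"] \<eta>[of a] a by force
      then have "a + 1 \<in> K (Suc (\<eta> a))" using \<eta>[of a] a by auto
      moreover have "\<eta> (a + 1) < Suc (\<eta> a)" "Suc (\<eta> a) \<le> l" "a + 1 \<in> {0..<c}"
        using n \<eta>[of a] a by auto
      ultimately show False using \<eta>[of "a + 1"] by blast
    qed
    define C where "C = nat c"
    have C: "c = int C" "0 < C" "C + 1 < M" using ec bounds cm M by (auto simp: C_def)
    define p where "p = (\<lambda>i. if i + C \<le> M then \<iota> (int (C - 1 + i))
      else if i \<le> M then \<eta> (int (C - 1 + i - M)) else l)"
    have \<iota>_n: "\<iota> (int a) < \<iota> (int (Suc a))" if "Suc a < M" for a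
      using \<iota>_less[of "int a"] that M by (simp add: algebra_simps)
    have \<eta>_n: "\<eta> (int a) < \<eta> (int (Suc a))" if "Suc a < C" for a
      using \<eta>_less[of "int a"] that C by (simp add: algebra_simps)
    have "p i < p (Suc i)" if i: "i \<le> M" for i
    proof -
      consider "Suc i + C \<le> M" | "i + C = M" | "M < i + C" "i < M" | "i = M" using i C by linarith
      then show ?thesis
      proof cases
        case 1
        then show ?thesis using \<iota>_n[of "C - 1 + i"] C by (auto simp: p_def)
      next
        case 2
        then have "p i = \<iota> (int (M - 1))" "p (Suc i) = \<eta> 0"
          using C by (auto simp: p_def intro!: arg_cong[of _ _ \<iota>])
        then show ?thesis using \<iota>[of "int (M - 1)"] \<eta>[of 0] C M by auto
      next
        case 3
        then have "p i = \<eta> (int (C - 1 + i - M))" "p (Suc i) = \<eta> (int (C - 1 + Suc i - M))"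
          using C by (auto simp: p_def)
        moreover have "C - 1 + Suc i - M = Suc (C - 1 + i - M)" using 3 C by linarith
        moreover have "\<eta> (int (C - 1 + i - M)) < \<eta> (int (Suc (C - 1 + i - M)))"
          using 3 C by (intro \<eta>_n) linarith
        ultimately show ?thesis by presburger
      next
        case 4
        then show ?thesis using \<eta>[of "int (C - 1)"] C by (auto simp: p_def)
      qed
    qed
    moreover have "wall (p i) = Some ((c - 1 + 1 * int i) mod m)" if i: "i \<le> M" for i
    proof (cases "i + C \<le> M")
      case True
      then have "(c - 1 + 1 * int i) mod m = int (C - 1 + i)" using C M by auto
      then show ?thesis using \<iota>[of "int (C - 1 + i)"] True C M by (auto simp: p_def)
    next
      case False
      then have "(c - 1 + 1 * int i) = int (C - 1 + i - M) + m" using C M by auto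
      then have "(c - 1 + 1 * int i) mod m = int (C - 1 + i - M) mod m" by simp
      also have "\<dots> = int (C - 1 + i - M)" using i C M by (intro mod_pos_pos_trivial) auto
      finally show ?thesis using \<eta>[of "int (C - 1 + i - M)"] False C i by (auto simp: p_def)
    qed
    moreover have "\<exists>a\<in>K (p M). wall (p M) = Some a"
      using \<eta>[of "int (C - 1)"] C by (auto simp: p_def)
    moreover have "p (Suc M) = l" using C by (simp add: p_def)
    moreover have "c = (c - 1 + 1 * (m + 1)) mod m" using ec bounds by simp
    ultimately have "pattern p (c - 1) 1" unfolding pattern_def M_def[symmetric] by blast
    then show ?thesis by blast
  qed
  then show ?thesis using full by blast
qed

end

lemma image_sym_diff_on:
  assumes "inj_on f C" "A \<subseteq> C" "B \<subseteq> C"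
  shows "sym_diff (f ` A) (f ` B) = f ` sym_diff A B"
proof -
  have "f ` A - f ` B = f ` (A - B)" "f ` B - f ` A = f ` (B - A)"
    using assms by (auto intro!: inj_on_image_set_diff[OF assms(1), symmetric])
  then show ?thesis by (simp add: image_Un)
qed

lemma end_segment_reverse:
  assumes "end_segment m K"
  shows "end_segment m ((\<lambda>a. m - 1 - a) ` K)"
proof -
  obtain c where c: "0 \<le> c" "c \<le> m" "K = {0..<c} \<or> K = {c..<m}"
    using assms by (auto simp: end_segment_def)
  have mem: "x \<in> (\<lambda>a. m - 1 - a) ` K \<longleftrightarrow> m - 1 - x \<in> K" for x
    by (auto intro: image_eqI[of _ _ "m - 1 - x"])
  have "(\<lambda>a. m - 1 - a) ` K = {m - c..<m} \<or> (\<lambda>a. m - 1 - a) ` K = {0..<m - c}"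
    using c(3)
  proof
    assume K: "K = {0..<c}"
    have "x \<in> (\<lambda>a. m - 1 - a) ` K \<longleftrightarrow> x \<in> {m - c..<m}" for x
      unfolding mem unfolding K by auto
    then show ?thesis by blast
  next
    assume K: "K = {c..<m}"
    have "x \<in> (\<lambda>a. m - 1 - a) ` K \<longleftrightarrow> x \<in> {0..<m - c}" for x
      unfolding mem unfolding K by auto
    then show ?thesis by blast
  qed
  then show ?thesis using c(1,2) unfolding end_segment_def by (intro exI[of _ "m - c"]) auto
qed

lemma (in fan_gallery) reverse:
  "fan_gallery m l (\<lambda>k. (\<lambda>a. m - 1 - a) ` K k) (\<lambda>k. map_option (\<lambda>a. m - 1 - a) (wall k)) (m - 1 - c)"
proof
  let ?f = "\<lambda>a. m - 1 - a"
  have inj: "inj ?f" by (auto simp: inj_def)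
  have sd: "?f ` sym_diff A {a} = sym_diff (?f ` A) {?f a}" for A a
    using image_sym_diff_on[OF inj, of A "{a}"] by simp
  have eq: "map_option ?f x = Some b \<longleftrightarrow> x = Some (?f b)" for x b by (cases x) auto
  show "?f ` K 0 = {}" using start by simp
  show "end_segment m (?f ` K k)" if "k \<le> l" for k
    by (rule end_segment_reverse[OF segment[OF that]])
  show "?f ` K (Suc k) = ?f ` K k \<or>
      (\<exists>a. map_option ?f (wall k) = Some a \<and> ?f ` K (Suc k) = sym_diff (?f ` K k) {a})"
    if k: "k < l" for k
    using step[OF k]
  proof (elim disjE exE conjE)
    fix a assume "wall k = Some a" "K (Suc k) = sym_diff (K k) {a}"
    then show ?thesis using sd[of "K k" a] by (intro disjI2 exI[of _ "?f a"]) simp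
  qed simp
  show "0 \<le> a \<and> a < m \<and> end_segment m (sym_diff (?f ` K k) {a})"
    if "k \<le> l" "map_option ?f (wall k) = Some a" for k a
  proof -
    have "wall k = Some (?f a)" using that(2) eq by blast
    then have t: "0 \<le> ?f a \<and> ?f a < m \<and> end_segment m (sym_diff (K k) {?f a})"
      by (rule toggle[OF that(1)])
    then have "end_segment m (?f ` sym_diff (K k) {?f a})" using end_segment_reverse by blast
    then have "end_segment m (sym_diff (?f ` K k) {?f (?f a)})" unfolding sd .
    then show ?thesis using t by simp
  qed
  show "map_option ?f (wall l) = Some (m - 1 - c)" using last by simp
  show "m - 1 - c \<in> ?f ` K l" using last by simp
  show "i < k \<and> k < j"
    if "j < l" "map_option ?f (wall j) = Some a" "a \<in> ?f ` K j" "i < j" "map_option ?f (wall i) = Some a"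
      "k < l" "map_option ?f (wall k) = Some (m - 1 - c)" for i j k a
  proof -
    have "wall j = Some (?f a)" "wall i = Some (?f a)" "wall k = Some (?f (m - 1 - c))"
      using that(2,5,7) eq by blast+
    moreover have "?f (m - 1 - c) = c" by simp
    moreover have "?f a \<in> K j" using that(3) by auto
    ultimately show ?thesis using interleaved[OF that(1) _ _ that(4) _ that(6)] by metis
  qed
qed

text \<open>
  The orientation of the residue is chosen so that the wall of the first descent comes before \<open>c\<close>.
\<close>
lemma (in fan_gallery) pattern_exists:
  assumes "j < l" "wall j = Some e" "e \<in> K j"
  shows "(\<exists>p b s. pattern p b s) \<and> (\<forall>a\<in>{0..<m}. \<exists>k<l. wall k = Some a)"
proof -
  let ?f = "\<lambda>a. m - 1 - a"
  let ?P = "\<lambda>j. j < l \<and> (\<exists>e. wall j = Some e \<and> e \<in> K j)"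
  define j0 where "j0 = (LEAST j. ?P j)"
  have "?P j0" unfolding j0_def by (rule LeastI[of ?P j]) (use assms in blast)
  then obtain d where d: "j0 < l" "wall j0 = Some d" "d \<in> K j0" by blast
  have first: "a \<notin> K k" if "k < j0" "wall k = Some a" for k a
    using not_less_Least[of k ?P] that d(1) unfolding j0_def[symmetric] by auto
  obtain i where i: "i < j0" "wall i = Some d"
    using enter[OF le0 less_imp_le[OF d(1)], of d] d(3) start by blast
  have "d \<noteq> c"
  proof
    assume "d = c"
    then show False using interleaved[OF d i, of i] i d(1) by simp
  qed
  have "(\<exists>p b s. pattern p b s) \<and> K j0 = {0..<m}"
  proof (cases "d < c")
    case True
    then show ?thesis using oriented_pattern[OF d first] by blast
  next
    case False
    interpret R: fan_gallery m l "\<lambda>k. ?f ` K k" "\<lambda>k. map_option ?f (wall k)" "?f c"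
      by (rule reverse)
    have "(\<exists>p b. R.pattern p b 1) \<and> ?f ` K j0 = {0..<m}"
    proof (rule R.oriented_pattern)
      show "j0 < l" "map_option ?f (wall j0) = Some (?f d)" "?f d \<in> ?f ` K j0" "?f d < ?f c"
        using d False \<open>d \<noteq> c\<close> by auto
      show "a \<notin> ?f ` K k" if "k < j0" "map_option ?f (wall k) = Some a" for k a
        using that first[of k] by auto
    qed
    then obtain p b where p: "R.pattern p b 1" and full: "?f ` K j0 = {0..<m}" by blast
    have "0 \<le> d" "d < m" using toggle[of j0 d] d by auto
    have flip: "?f (x mod m) = (?f x) mod m" for x
    proof -
      have "0 \<le> ?f (x mod m)" "?f (x mod m) < m"
        using pos_mod_sign[of m x] pos_mod_bound[of m x] \<open>0 \<le> d\<close> \<open>d < m\<close> by linarith+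
      then have "?f (x mod m) = ?f (x mod m) mod m" by simp
      also have "\<dots> = ?f x mod m" by (simp add: mod_diff_right_eq)
      finally show ?thesis .
    qed
    have eq: "map_option ?f x = Some b \<longleftrightarrow> x = Some (?f b)" for x b by (cases x) auto
    have "pattern p (?f b) (- 1)"
      unfolding pattern_def
    proof (intro conjI allI impI)
      show "\<And>i. i \<le> nat m \<Longrightarrow> p i < p (Suc i)" "p (Suc (nat m)) = l"
        using p by (auto simp: R.pattern_def)
      show "\<exists>a\<in>K (p (nat m)). wall (p (nat m)) = Some a"
        using p eq by (fastforce simp: R.pattern_def)
      show "wall (p i) = Some ((?f b + - 1 * int i) mod m)" if "i \<le> nat m" for i
      proof -
        have "map_option ?f (wall (p i)) = Some ((b + 1 * int i) mod m)"
          using p that unfolding R.pattern_def by blast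
        then have "wall (p i) = Some (?f ((b + 1 * int i) mod m))" using eq by blast
        then show ?thesis unfolding flip by (simp add: algebra_simps)
      qed
      have "?f c = (b + 1 * (m - 1)) mod m \<or> ?f c = (b + 1 * (m + 1)) mod m"
        using p unfolding R.pattern_def by blast
      then have "c = ?f ((b + 1 * (m - 1)) mod m) \<or> c = ?f ((b + 1 * (m + 1)) mod m)" by linarith
      then show "c = (?f b + - 1 * (m - 1)) mod m \<or> c = (?f b + - 1 * (m + 1)) mod m"
        unfolding flip by (simp add: algebra_simps)
    qed simp
    moreover have "K j0 = {0..<m}"
    proof
      show "K j0 \<subseteq> {0..<m}" using K_bounds d(1) by auto
      show "{0..<m} \<subseteq> K j0"
      proof
        fix x assume "x \<in> {0..<m}"
        then have "?f x \<in> ?f ` K j0" using full by simp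
        then show "x \<in> K j0" by auto
      qed
    qed
    ultimately show ?thesis by blast
  qed
  moreover have "\<exists>k<l. wall k = Some a" if a: "a \<in> K j0" for a
  proof -
    have "a \<notin> K 0" using start by simp
    then obtain i where "i < j0" "wall i = Some a"
      using enter[OF le0 less_imp_le[OF d(1)] _ a] by blast
    then show ?thesis using d(1) less_trans by blast
  qed
  ultimately show ?thesis by blast
qed

section \<open>Polygons of subexpressions\<close>

text \<open>
  The vertices of a polygon of subexpressions correspond to the pairs of cyclically neighbouring
  positions in a list of \<open>L\<close> positions.
\<close>
definition cyclic_pair :: "nat \<Rightarrow> nat \<Rightarrow> nat set" where
  "cyclic_pair L i = {i, Suc i mod L}"

lemma cyclic_pair_subset: "i < L \<Longrightarrow> cyclic_pair L i \<subseteq> {..<L}"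
  by (auto simp: cyclic_pair_def)

lemma Suc_mod_eq: "i < L \<Longrightarrow> Suc i mod L = (if Suc i = L then 0 else Suc i)"
  by auto

lemma inj_on_cyclic_pair:
  assumes "L \<ge> 3"
  shows "inj_on (cyclic_pair L) {..<L}"
proof (rule inj_onI)
  fix i j assume ij: "i \<in> {..<L}" "j \<in> {..<L}" "cyclic_pair L i = cyclic_pair L j"
  then have "i = j \<or> i = Suc j mod L \<and> Suc i mod L = j"
    by (auto simp: cyclic_pair_def doubleton_eq_iff)
  then show "i = j" using assms ij(1,2) by (auto simp: Suc_mod_eq split: if_splits)
qed

lemma card_cyclic_pair_step:
  assumes "L \<ge> 3" "i < L"
  shows "card (sym_diff (cyclic_pair L i) (cyclic_pair L (Suc i mod L))) = 2"
proof -
  let ?j = "Suc i mod L" let ?k = "Suc ?j mod L"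
  have "?j < L" using assms by simp
  then have ne: "i \<noteq> ?j" "?j \<noteq> ?k" "i \<noteq> ?k"
    using assms Suc_mod_eq[of i L] Suc_mod_eq[of ?j L] by (auto split: if_splits)
  have "sym_diff (cyclic_pair L i) (cyclic_pair L ?j) = {i, ?k}"
    unfolding cyclic_pair_def using ne by auto
  then show ?thesis using ne by simp
qed

lemma image_cyclic_pair:
  "i \<le> M \<Longrightarrow> p ` cyclic_pair (M + 2) i = {p i, p (Suc i)}"
  "p ` cyclic_pair (M + 2) (Suc M) = {p 0, p (Suc M)}"
  by (auto simp: cyclic_pair_def)

context expression
begin

context
  fixes v :: "nat list" and M :: nat and p :: "nat \<Rightarrow> nat"
  assumes v: "v \<in> V" and M: "2 \<le> M" "M \<in> order_divisors W ss"
    and increasing: "\<And>i. i \<le> M \<Longrightarrow> p i < p (Suc i)" and p_n: "p (Suc M) < n"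
begin

lemma p_less: "i < j \<Longrightarrow> j \<le> Suc M \<Longrightarrow> p i < p j"
proof (induction j)
  case (Suc j)
  then show ?case using increasing[of j] by (cases "i = j") auto
qed simp

lemma p_less_iff: "i \<le> Suc M \<Longrightarrow> j \<le> Suc M \<Longrightarrow> p i < p j \<longleftrightarrow> i < j"
  using p_less[of i j] p_less[of j i] by (cases i j rule: linorder_cases) auto

lemma p_le_iff: "i \<le> Suc M \<Longrightarrow> j \<le> Suc M \<Longrightarrow> p i \<le> p j \<longleftrightarrow> i \<le> j"
  using p_less_iff[of j i] by (simp add: linorder_not_less[symmetric])

lemma inj_on_p: "inj_on p {..<M + 2}"
  by (rule inj_onI, rule ccontr) (metis p_less_iff less_irrefl linorder_neqE_nat lessThan_iff
      add_2_eq_Suc' less_Suc_eq_le)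

lemma p_bound: "i \<le> Suc M \<Longrightarrow> p i < n"
  using p_le_iff[of i "Suc M"] p_n by auto

abbreviation "pair i \<equiv> p ` cyclic_pair (M + 2) i"

lemma pair_sym_diff:
  "i < M + 2 \<Longrightarrow> j < M + 2 \<Longrightarrow>
     sym_diff (pair i) (pair j) = p ` sym_diff (cyclic_pair (M + 2) i) (cyclic_pair (M + 2) j)"
  by (rule image_sym_diff_on[OF inj_on_p cyclic_pair_subset cyclic_pair_subset])

text \<open>
  The bits of the vertex with number \<open>i\<close> differ from those of the vertex with number \<open>B\<close>, which is \<open>v\<close>, in
  the pairs \<open>i\<close> and \<open>B\<close>. Every vertex but the two last ones differs from \<open>v\<close> in position \<open>p (M + 1)\<close>.
\<close>
lemma linked_around_polygon:
  assumes B: "B = M \<or> B = Suc M"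
    and verts: "\<And>i. i < M + 2 \<Longrightarrow> flip v (sym_diff (pair i) (pair B)) \<in> V"
    and desc: "descent v (p M)" "descent v (p (Suc M))"
  shows "linked_at v (sym_diff (pair (Suc B mod (M + 2))) (pair B))
    (sym_diff (pair ((B + (M + 2) - 1) mod (M + 2))) (pair B))"
proof (rule linked_flips[OF v refl M(2), of "\<lambda>i. sym_diff (pair i) (pair B)" B])
  have L: "M + 2 \<ge> 3" using M by simp
  have cancel: "sym_diff (sym_diff (pair i) (pair B)) (sym_diff (pair j) (pair B)) = sym_diff (pair i) (pair j)"
    for i j by blast
  show "inj_on (\<lambda>i. sym_diff (pair i) (pair B)) {..<M + 2}"
  proof (rule inj_onI)
    fix i j assume ij: "i \<in> {..<M + 2}" "j \<in> {..<M + 2}"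
      "sym_diff (pair i) (pair B) = sym_diff (pair j) (pair B)"
    then have "pair i = pair j" by blast
    then have "cyclic_pair (M + 2) i = cyclic_pair (M + 2) j"
      using ij(1,2) inj_on_image_eq_iff[OF inj_on_p] cyclic_pair_subset[of i "M + 2"] cyclic_pair_subset[of j "M + 2"]
      by auto
    then show "i = j" using inj_on_cyclic_pair[OF L] ij(1,2) by (auto dest: inj_onD)
  qed
  show "flip v (sym_diff (pair i) (pair B)) \<in> V" if "i < M + 2" for i using verts[OF that] .
  show "sym_diff (pair i) (pair B) \<subseteq> {..<n}" if "i < M + 2" for i
  proof -
    have "pair k \<subseteq> {..<n}" if "k < M + 2" for k
      using p_bound cyclic_pair_subset[OF that] by fastforce
    moreover have "B < M + 2" using B by auto
    ultimately show ?thesis using that by blast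
  qed
  show "card (sym_diff (sym_diff (pair i) (pair B)) (sym_diff (pair (Suc i mod (M + 2))) (pair B))) = 2"
    if i: "i < M + 2" for i
  proof -
    have j: "Suc i mod (M + 2) < M + 2" by simp
    have "sym_diff (cyclic_pair (M + 2) i) (cyclic_pair (M + 2) (Suc i mod (M + 2))) \<subseteq> {..<M + 2}"
      using cyclic_pair_subset[OF i] cyclic_pair_subset[OF j] by blast
    then have "inj_on p (sym_diff (cyclic_pair (M + 2) i) (cyclic_pair (M + 2) (Suc i mod (M + 2))))"
      by (rule inj_on_subset[OF inj_on_p])
    then show ?thesis
      unfolding cancel pair_sym_diff[OF i j] using card_cyclic_pair_step[OF L i] by (simp add: card_image)
  qed
  show "B < M + 2" "sym_diff (pair B) (pair B) = {}" using B by auto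
  show "\<exists>l\<in>sym_diff (pair i) (pair B). sym_diff (pair i) (pair B) \<subseteq> {..l} \<and> descent v l"
    if i: "i < M + 2" "i \<noteq> B" for i
  proof -
    have le: "p k \<le> p (Suc M)" "k \<le> M \<Longrightarrow> p k \<le> p M" if "k < M + 2" for k
      using that by (auto simp: p_le_iff)
    have ne: "p k \<noteq> p l" if "k < l" "l \<le> Suc M" for k l using p_less[OF that] by simp
    consider "i < M" | "i = M" "B = Suc M" | "i = Suc M" "B = M" using i B by linarith
    then show ?thesis
    proof cases
      case 1
      have "p (Suc M) \<notin> pair i"
        using 1 ne[of i "Suc M"] ne[of "Suc i" "Suc M"] image_cyclic_pair(1)[of i M p] by simp
      moreover have "p (Suc M) \<in> pair B"
        using B image_cyclic_pair(1)[of M M p] image_cyclic_pair(2)[of p M] by auto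
      moreover have "sym_diff (pair i) (pair B) \<subseteq> {..p (Suc M)}"
        using cyclic_pair_subset[OF i(1)] cyclic_pair_subset[of B "M + 2"] B le(1) by fastforce
      ultimately show ?thesis using desc(2) by blast
    next
      case 2
      then have "sym_diff (pair i) (pair B) = {p 0, p M}"
        using ne[of 0 "Suc M"] ne[of M "Suc M"] ne[of 0 M] M
          image_cyclic_pair(1)[of M M p] image_cyclic_pair(2)[of p M] by auto
      then show ?thesis using desc(1) le(2)[of 0] by auto
    next
      case 3
      then have "sym_diff (pair i) (pair B) = {p 0, p M}"
        using ne[of 0 "Suc M"] ne[of M "Suc M"] ne[of 0 M] M
          image_cyclic_pair(1)[of M M p] image_cyclic_pair(2)[of p M] by auto
      then show ?thesis using desc(1) le(2)[of 0] by auto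
    qed
  qed
qed

end

text \<open>
  For an alternating word of \<open>M + 2\<close> letters in a dihedral group with \<open>M\<close> reflections, the subexpressions
  whose target is the longest element are those that omit two cyclically neighbouring letters. The
  vertex \<open>v\<close> plays the role of the one that omits the last two letters.
\<close>
lemma polygon_vertices:
  fixes t :: "int \<Rightarrow> 'a"
  assumes v: "v \<in> V" and M: "2 \<le> M" "M \<in> order_divisors W ss"
    and increasing: "\<And>i. i \<le> M \<Longrightarrow> p i < p (Suc i)" and p_n: "p (Suc M) < n"
    and fan: "\<And>i j. conjugate (t i) (t j) = t (2 * i - j)" "t (int M) = t 0"
    and hits: "\<And>i. i \<le> M \<Longrightarrow> hit v (p i) = t (int i)" "hit v (p (Suc M)) = t (int M - 1)"
    and i: "i < M + 2"
  shows "flip v (sym_diff (p ` cyclic_pair (M + 2) i) (p ` cyclic_pair (M + 2) M)) \<in> V"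
proof -
  note ctx = v M increasing p_n
  note pl = p_less_iff[OF ctx] and psimps = image_cyclic_pair[where p = p and M = M]
  let ?Q = "\<lambda>i. p ` cyclic_pair (M + 2) i"
  have b: "bits n v" using v vertex_bits by auto
  have bound: "p i < n" if "i \<le> Suc M" for i by (rule p_bound[OF ctx that])
  \<comment> \<open>Going down from the pair \<open>M\<close>, the vertex with number \<open>k\<close> hits the walls \<open>t 0, \<dots>, t k\<close> and then continues
    two steps behind, so that the positions \<open>k\<close> and \<open>k + 2\<close> of the vertex with number \<open>k + 1\<close> share the wall \<open>t k\<close>.\<close>
  have down: "flip v (sym_diff (?Q k) (?Q M)) \<in> V \<and>
      (\<forall>i\<le>Suc M. hit (flip v (sym_diff (?Q k) (?Q M))) (p i) = (if i \<le> k then t (int i) else t (int i - 2)))"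
    if "k \<le> M" for k
    using that
  proof (induction k rule: inc_induct)
    case base
    have "hit v (p i) = (if i \<le> M then t (int i) else t (int i - 2))" if "i \<le> Suc M" for i
      using hits that le_Suc_eq by auto
    then show ?case using v by simp
  next
    case (step k)
    let ?e = "flip v (sym_diff (?Q (Suc k)) (?Q M))"
    have eV: "?e \<in> V" and e_hits: "\<And>i. i \<le> Suc M \<Longrightarrow>
        hit ?e (p i) = (if i \<le> Suc k then t (int i) else t (int i - 2))"
      using step.IH by auto
    have be: "bits n ?e" using eV vertex_bits by auto
    have kM: "k + 2 \<le> Suc M" using step.hyps by simp
    have lt: "p k < p (k + 2)" "p (k + 2) < n" using pl[of k "k + 2"] bound kM by auto
    have eq: "hit ?e (p k) = hit ?e (p (k + 2))"
      using e_hits[of k] e_hits[of "k + 2"] kM by simp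
    have ne: "p k \<noteq> p (Suc k)" "p (Suc k) \<noteq> p (k + 2)" "p k \<noteq> p (k + 2)"
      using pl[of k "Suc k"] pl[of "Suc k" "k + 2"] pl[of k "k + 2"] kM by auto
    have "sym_diff (sym_diff (?Q (Suc k)) (?Q M)) {p k, p (k + 2)} =
        sym_diff (sym_diff (?Q (Suc k)) {p k, p (k + 2)}) (?Q M)" by blast
    also have "sym_diff (?Q (Suc k)) {p k, p (k + 2)} = ?Q k"
    proof -
      have Q: "?Q (Suc k) = {p (Suc k), p (k + 2)}" "?Q k = {p k, p (Suc k)}"
        using psimps(1)[of "Suc k"] psimps(1)[of k] kM by simp_all
      show ?thesis unfolding Q using ne by auto
    qed
    finally have flip: "flip ?e {p k, p (k + 2)} = flip v (sym_diff (?Q k) (?Q M))"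
      using flip_flip[OF b] by simp
    have "flip v (sym_diff (?Q k) (?Q M)) \<in> V"
      using flip_vertex[OF eV lt eq] flip by simp
    moreover have "hit (flip v (sym_diff (?Q k) (?Q M))) (p i) = (if i \<le> k then t (int i) else t (int i - 2))"
      if i: "i \<le> Suc M" for i
    proof -
      have between: "p k < p i \<and> p i < p (k + 2) \<longleftrightarrow> i = Suc k"
        using pl[of k i] pl[of i "k + 2"] i kM by auto
      have "conjugate (hit ?e (p k)) (hit ?e (p (Suc k))) = t (int (Suc k) - 2)"
        using e_hits[of k] e_hits[of "Suc k"] kM fan(1)[of "int k" "int (Suc k)"]
        by (simp add: algebra_simps)
      then have "hit (flip ?e {p k, p (k + 2)}) (p i) =
          (if i = Suc k then t (int (Suc k) - 2) else hit ?e (p i))"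
        using hit_flip[OF be lt eq bound[OF i]] between by auto
      then show ?thesis unfolding flip using e_hits[OF i] by auto
    qed
    ultimately show ?case by blast
  qed
  show ?thesis
  proof (cases "i \<le> M")
    case False
    then have "i = Suc M" using i by simp
    moreover have "p 0 \<noteq> p M" "p 0 \<noteq> p (Suc M)" "p M \<noteq> p (Suc M)"
      using pl[of 0 M] pl[of 0 "Suc M"] pl[of M "Suc M"] M by auto
    ultimately have "sym_diff (?Q i) (?Q M) = {p 0, p M}"
      using psimps(1)[of M] psimps(2) by auto
    moreover have "flip v {p 0, p M} \<in> V"
      using flip_vertex[OF v, of "p 0" "p M"] pl[of 0 M] bound[of M] M hits(1)[of 0] hits(1)[of M] fan(2)
      by simp
    ultimately show ?thesis by simp
  qed (use down in blast)
qed

text \<open>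
  Here \<open>v\<close> is the vertex of the polygon that belongs to the last two positions.
\<close>
lemma linked_straight_polygon:
  fixes t :: "int \<Rightarrow> 'a"
  assumes v: "v \<in> V" and M: "2 \<le> M" "M \<in> order_divisors W ss"
    and increasing: "\<And>i. i \<le> M \<Longrightarrow> p i < p (Suc i)" and p_n: "p (Suc M) < n"
    and fan: "\<And>i j. conjugate (t i) (t j) = t (2 * i - j)" "t (int M) = t 0"
    and hits: "\<And>i. i \<le> M \<Longrightarrow> hit v (p i) = t (int i)" "hit v (p (Suc M)) = t (int M - 1)"
    and desc: "descent v (p M)" "descent v (p (Suc M))"
  shows "linked_at v {p 0, p M} {p (M - 1), p (Suc M)}"
proof -
  note ctx = v M increasing p_n
  note pl = p_less_iff[OF ctx] and psimps = image_cyclic_pair[where p = p and M = M]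
  let ?Q = "\<lambda>i. p ` cyclic_pair (M + 2) i"
  have ne: "p 0 \<noteq> p M" "p 0 \<noteq> p (Suc M)" "p M \<noteq> p (Suc M)" "p (M - 1) \<noteq> p M" "p (M - 1) \<noteq> p (Suc M)"
    using pl[of 0 M] pl[of 0 "Suc M"] pl[of M "Suc M"] p_less[OF ctx, of "M - 1" M] p_less[OF ctx, of "M - 1" "Suc M"] M by auto
  have Q: "?Q M = {p M, p (Suc M)}" "?Q (Suc M) = {p 0, p (Suc M)}" "?Q (M - 1) = {p (M - 1), p M}"
    using psimps(1)[of M] psimps(2) psimps(1)[of "M - 1"] M by simp_all
  have "sym_diff (?Q (Suc M)) (?Q M) = {p 0, p M}" "sym_diff (?Q (M - 1)) (?Q M) = {p (M - 1), p (Suc M)}"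
    unfolding Q using ne by auto
  moreover have "Suc M mod (M + 2) = Suc M" "(M + (M + 2) - 1) mod (M + 2) = M - 1"
    using M mod_add_self2[of "M - 1" "M + 2"] by simp_all
  ultimately show ?thesis
    using linked_around_polygon[OF ctx, of M] polygon_vertices[OF ctx fan hits] desc by simp
qed

text \<open>
  Here \<open>v\<close> is the vertex that belongs to the first and the last position. Its neighbour along the flip of
  \<open>p 0\<close> and \<open>p M\<close> sees the walls in the opposite cyclic order and satisfies the assumptions of
  \<open>polygon_vertices\<close>.
\<close>
lemma linked_turned_polygon:
  fixes t :: "int \<Rightarrow> 'a"
  assumes v: "v \<in> V" and M: "2 \<le> M" "M \<in> order_divisors W ss"
    and increasing: "\<And>i. i \<le> M \<Longrightarrow> p i < p (Suc i)" and p_n: "p (Suc M) < n"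
    and fan: "\<And>i j. conjugate (t i) (t j) = t (2 * i - j)" "\<And>i. t (i + int M) = t i"
    and hits: "\<And>i. i \<le> Suc M \<Longrightarrow> hit v (p i) = t (int i)"
    and desc: "descent v (p M)" "descent v (p (Suc M))"
  shows "linked_at v {p 1, p (Suc M)} {p 0, p M}"
proof -
  note ctx = v M increasing p_n
  note pl = p_less_iff[OF ctx] and psimps = image_cyclic_pair[where p = p and M = M]
  let ?Q = "\<lambda>i. p ` cyclic_pair (M + 2) i"
  let ?e = "flip v {p 0, p M}"
  have b: "bits n v" using v vertex_bits by auto
  have lt: "p 0 < p M" "p M < n" using pl[of 0 M] p_bound[OF ctx, of M] M by auto
  have "hit v (p 0) = hit v (p M)" using hits[of 0] hits[of M] fan(2)[of 0] by simp
  note turn = lt this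
  have eV: "?e \<in> V" by (rule flip_vertex[OF v turn])
  have e_hits: "hit ?e (p i) = (if 0 < i \<and> i < M then conjugate (t 0) (t (int i)) else t (int i))"
    if i: "i \<le> Suc M" for i
    using hit_flip[OF b turn p_bound[OF ctx i]] pl[of 0 i] pl[of i M] i hits[of 0] hits[OF i] by simp
  have per: "t (- int M) = t 0" "t (int M) = t 0" "t (1 - int M) = t 1" "t (int M + 1) = t 1"
    using fan(2)[of "- int M"] fan(2)[of 0] fan(2)[of "1 - int M"] fan(2)[of 1] by (simp_all add: add.commute)
  have verts: "flip ?e (sym_diff (?Q i) (?Q M)) \<in> V" if "i < M + 2" for i
  proof (rule polygon_vertices[OF eV M increasing p_n, where t = "\<lambda>i. t (- i)"])
    show "hit ?e (p i) = t (- int i)" if "i \<le> M" for i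
      using that e_hits[of i] fan(1)[of 0 "int i"] per by (cases "i = 0 \<or> i = M") auto
    show "hit ?e (p (Suc M)) = t (- (int M - 1))"
      using e_hits[of "Suc M"] per by (simp add: add.commute)
    show "conjugate (t (- i)) (t (- j)) = t (- (2 * i - j))" for i j
      using fan(1)[of "- i" "- j"] by simp
  qed (use that per in auto)
  have ne: "p 0 \<noteq> p M" "p 0 \<noteq> p (Suc M)" "p M \<noteq> p (Suc M)" "p 1 \<noteq> p 0" "p 1 \<noteq> p (Suc M)"
    using pl[of 0 M] pl[of 0 "Suc M"] pl[of M "Suc M"] pl[of 0 1] pl[of 1 "Suc M"] M by auto
  have Q: "?Q M = {p M, p (Suc M)}" "?Q (Suc M) = {p 0, p (Suc M)}" "?Q 0 = {p 0, p 1}"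
    using psimps(1)[of M] psimps(2) psimps(1)[of 0] M by simp_all
  have QQ: "sym_diff {p 0, p M} (?Q M) = ?Q (Suc M)" unfolding Q using ne by auto
  have assoc: "sym_diff {p 0, p M} (sym_diff A (?Q M)) = sym_diff A (sym_diff {p 0, p M} (?Q M))" for A
    by blast
  have v_verts: "flip v (sym_diff (?Q i) (?Q (Suc M))) \<in> V" if "i < M + 2" for i
    using verts[OF that] unfolding flip_flip[OF b] assoc QQ .
  note linked = linked_around_polygon[OF ctx disjI2[OF refl] v_verts desc]
  have "sym_diff (?Q 0) (?Q (Suc M)) = {p 1, p (Suc M)}" "sym_diff (?Q M) (?Q (Suc M)) = {p 0, p M}"
    unfolding Q using ne by auto
  moreover have "Suc (Suc M) mod (M + 2) = 0" "(Suc M + (M + 2) - 1) mod (M + 2) = M"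
    using mod_add_self2[of M "M + 2"] by simp_all
  ultimately show ?thesis using linked by simp
qed

section \<open>Linking descents\<close>

lemma inversions_prefix_Suc:
  "k < n \<Longrightarrow> inversions (prefix e (Suc k)) =
     (if e ! k = 1 then sym_diff (inversions (prefix e k)) {hit e k} else inversions (prefix e k))"
  by (simp add: hit_def inversions_step)

lemma inversion_is_hit:
  "k \<le> n \<Longrightarrow> q \<in> inversions (prefix e k) \<Longrightarrow> \<exists>i<k. hit e i = q"
proof (induction k)
  case (Suc k)
  then show ?case
    using inversions_prefix_Suc[of k e] by (cases "q = hit e k") (auto simp del: prefix.simps split: if_splits dest: less_SucI)
qed simp

lemma inversions_unhit:
  assumes "j \<le> k" "k \<le> n" "\<And>i. j \<le> i \<Longrightarrow> i < k \<Longrightarrow> hit e i \<noteq> q"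
  shows "q \<in> inversions (prefix e j) \<longleftrightarrow> q \<in> inversions (prefix e k)"
  using assms
proof (induction k rule: dec_induct)
  case (step k)
  then have "q \<in> inversions (prefix e (Suc k)) \<longleftrightarrow> q \<in> inversions (prefix e k)"
    using inversions_prefix_Suc[of k e] step.prems(2)[of k] by (auto simp del: prefix.simps)
  then show ?case using step by (simp del: prefix.simps)
qed simp

definition crossings :: "nat list \<Rightarrow> nat \<Rightarrow> nat list" where
  "crossings e k = filter (\<lambda>i. e ! i = 1) [0..<k]"

lemma crossing_word:
  assumes "k \<le> n"
  shows "map ((!) ss) (crossings e k) \<in> lists S" "list_prod W (map ((!) ss) (crossings e k)) = prefix e k"
    "walls \<one> (map ((!) ss) (crossings e k)) = map (hit e) (crossings e k)"
proof -
  have "map ((!) ss) (crossings e k) \<in> lists S \<and> list_prod W (map ((!) ss) (crossings e k)) = prefix e k \<and>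
      walls \<one> (map ((!) ss) (crossings e k)) = map (hit e) (crossings e k)"
    using assms
  proof (induction k)
    case (Suc k)
    then have k: "k < n" "k \<le> n" by auto
    have c: "crossings e (Suc k) = (if e ! k = 1 then crossings e k @ [k] else crossings e k)"
      by (simp add: crossings_def)
    show ?case
    proof (cases "e ! k = 1")
      case True
      have words: "map ((!) ss) (crossings e k) \<in> lists S" "[ss ! k] \<in> lists S"
        using Suc.IH[OF k(2)] k(1) by auto
      show ?thesis
        using words Suc.IH[OF k(2)] k True word_append[OF words] walls_append[OF one_closed words(1)]
        unfolding c by (simp add: hit_def)
    next
      case False
      then show ?thesis using Suc.IH[OF k(2)] c by simp
    qed
  qed (simp add: crossings_def)
  then show "map ((!) ss) (crossings e k) \<in> lists S" "list_prod W (map ((!) ss) (crossings e k)) = prefix e k"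
    "walls \<one> (map ((!) ss) (crossings e k)) = map (hit e) (crossings e k)" by auto
qed

lemma prefix_parabolic: "k \<le> n \<Longrightarrow> prefix e k \<in> generate W (set ss)"
proof (induction k)
  case (Suc k)
  then have "ss ! k \<in> generate W (set ss)" by (auto intro: generate.incl)
  then show ?case using Suc by (auto intro: generate.eng)
qed (simp add: generate.one)

lemma hit_parabolic:
  assumes "k < n"
  shows "hit e k \<in> generate W (set ss)"
proof -
  have "set ss \<subseteq> carrier W" using ss by auto
  then interpret P: subgroup "generate W (set ss)" W by (rule generate_is_subgroup)
  have "ss ! k \<in> generate W (set ss)" using assms by (auto intro: generate.incl)
  then show ?thesis using assms prefix_parabolic[of k e] by (simp add: hit_def conjugate_def)
qed

text \<open>
  Cutting the gallery at its first hit of \<open>t\<close> separates the hits of \<open>r\<close> from those of \<open>t\<close>. Both walls are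
  crossed an odd number of times, so the number of pairs "\<open>r\<close> before \<open>t\<close>" is odd.
\<close>
lemma interleaved_descents_fan:
  assumes j: "j < n" "descent e j"
    and t: "t \<in> inversions (prefix e j)"
    and separated: "\<And>i k. i < j \<Longrightarrow> hit e i = hit e j \<Longrightarrow> k < j \<Longrightarrow> hit e k = t \<Longrightarrow> i < k"
  obtains y a b where "y \<in> carrier W" "a \<in> S" "b \<in> S" "ord (a \<otimes> b) \<noteq> 0"
    "{hit e j, t} \<subseteq> (\<lambda>i. conjugate y ((a \<otimes> b) [^] i \<otimes> a)) ` {..<ord (a \<otimes> b)}"
proof -
  let ?r = "hit e j"
  let ?us = "map ((!) ss) (crossings e j)"
  have jn: "j \<le> n" using j by simp
  note us = crossing_word[OF jn, of e]
  define q where "q = (LEAST k. hit e k = t)"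
  obtain k where k: "k < j" "hit e k = t" using inversion_is_hit[OF jn t] by auto
  have q: "hit e q = t" unfolding q_def by (rule LeastI[of _ k]) (rule k(2))
  have q_min: "hit e i \<noteq> t" if "i < q" for i using not_less_Least that unfolding q_def by blast
  have qj: "q < j" using q_min[of k] k by (meson le_less_trans not_le)
  let ?c1 = "filter (\<lambda>i. e ! i = 1) [0..<q]" and ?c2 = "filter (\<lambda>i. e ! i = 1) [q..<j]"
  have split: "map (hit e) (crossings e j) = map (hit e) ?c1 @ map (hit e) ?c2"
    unfolding crossings_def using upt_add_eq_append[of 0 q "j - q"] qj by (simp flip: map_append filter_append)
  have t1: "t \<notin> set (map (hit e) ?c1)" using q_min by auto
  have r2: "?r \<notin> set (map (hit e) ?c2)" using separated[of _ q] q qj by fastforce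
  have "odds (map (hit e) (crossings e j)) = inversions (prefix e j)"
    using inversions_word[OF us(1)] us by simp
  then have "?r \<in> odds (map (hit e) (crossings e j))" "t \<in> odds (map (hit e) (crossings e j))"
    using j t by (auto simp: descent_def)
  then have "?r \<in> odds (map (hit e) ?c1)" "t \<in> odds (map (hit e) ?c2)"
    using t1 r2 odds_subset[of "map (hit e) ?c1"] odds_subset[of "map (hit e) ?c2"]
    unfolding split odds_append by blast+
  moreover have "\<not> odd_pairs ?r t (map (hit e) ?c1)" "\<not> odd_pairs ?r t (map (hit e) ?c2)"
    using odd_pairs_notin t1 r2 by metis+
  ultimately have "odd_pairs ?r t (walls \<one> ?us)"
    unfolding us(3) split odd_pairs_append by blast
  then show thesis
    using crossing_walls_residue[OF us(1,2), of "ss ! j" t] j that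
    unfolding hit_def[symmetric] descent_def by blast
qed

lemma descent_hit_before:
  assumes "j < n" "descent e j"
  obtains i where "i < j" "hit e i = hit e j"
  using inversion_is_hit[of j "hit e j" e] assms by (auto simp: descent_def)

lemma fan_mod:
  assumes "\<And>i. t (i + m) = t i"
  shows "t (i mod m) = t (i :: int)"
proof -
  have nat: "t (i + int k * m) = t i" for i k
  proof (induction k)
    case (Suc k)
    have "t (i + int (Suc k) * m) = t (i + int k * m + m)" by (simp add: algebra_simps)
    then show ?case using assms Suc by simp
  qed simp
  show ?thesis
  proof (cases "0 \<le> i div m")
    case True
    then show ?thesis using nat[of "i mod m" "nat (i div m)"] by simp
  next
    case False
    then have "i mod m = i + int (nat (- (i div m))) * m"
      by (simp add: minus_div_mult_eq_mod[symmetric])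
    then show ?thesis using nat[of i "nat (- (i div m))"] by metis
  qed
qed

text \<open>
  Two descents on the same wall give a triangle. On different walls, disjoint or nested flips can be
  carried out independently and give a square.
\<close>
lemma noninterleaved_descents_linked:
  assumes v: "v \<in> V" and l: "l < n" "descent v l" and j: "j < l" "descent v j"
    and i: "i < j" "hit v i = hit v j" and k: "k < l" "hit v k = hit v l"
    and sep: "\<not> (i < k \<and> k < j)"
  shows "\<exists>i'. i' < l \<and> hit v i' = hit v l \<and> linked_at v {i, j} {i', l}"
proof (cases "hit v j = hit v l")
  case True
  have "linked_at v {i, j} {i, l}"
  proof (rule linked_triangle[OF v])
    show "flip v {i, j} \<in> V" "flip v {i, l} \<in> V"
      using flip_vertex[OF v] i j l True by auto
    have "sym_diff {i, j} {i, l} = {j, l}" using i j by auto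
    then show "card (sym_diff {i, j} {i, l}) = 2" using j by simp
  qed (use i j l in auto)
  then show ?thesis using i j True by (intro exI[of _ i]) auto
next
  case False
  then have ne: "k \<noteq> i" "k \<noteq> j" using i k by auto
  have "linked_at v {i, j} {k, l}"
  proof (rule linked_square[OF v])
    have jn: "j < n" using j l by simp
    show ij: "flip v {i, j} \<in> V" by (rule flip_vertex[OF v i(1) jn i(2)])
    show "flip v {k, l} \<in> V" by (rule flip_vertex[OF v k(1) l(1) k(2)])
    show disj: "{i, j} \<inter> {k, l} = {}" using ne i j by auto
    have b: "bits n v" using v vertex_bits by auto
    have "hit (flip v {i, j}) k = hit v k" "hit (flip v {i, j}) l = hit v l"
      using hit_flip[OF b i(1) jn i(2)] k l j sep by auto
    then have "flip (flip v {i, j}) {k, l} \<in> V" using flip_vertex[OF ij k(1) l(1)] k(2) by simp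
    moreover have "sym_diff {i, j} {k, l} = {i, j} \<union> {k, l}" using disj by blast
    ultimately show "flip v ({i, j} \<union> {k, l}) \<in> V" using flip_flip[OF b] by metis
  qed (use i j k l ne in auto)
  then show ?thesis using k by blast
qed

text \<open>
  The polygon links \<open>l\<close> to a descent whose wall belongs to the residue of the walls of \<open>j\<close> and \<open>l\<close>, but
  which may be different from \<open>j\<close>.
\<close>
lemma interleaved_descents_linked:
  assumes v: "v \<in> V" and l: "l < n" "descent v l" and j: "j < l" "descent v j"
    and interleaved: "\<And>i j k. j < l \<Longrightarrow> descent v j \<Longrightarrow> i < j \<Longrightarrow> hit v i = hit v j \<Longrightarrow>
      k < l \<Longrightarrow> hit v k = hit v l \<Longrightarrow> i < k \<and> k < j"
  shows "\<exists>i' j' i. i' < j' \<and> j' < l \<and> descent v j' \<and> hit v i' = hit v j' \<and> i < l \<and> hit v i = hit v l \<and>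
    linked_at v {i', j'} {i, l}"
proof -
  have jn: "j < n" using j l by simp
  obtain i0 where i0: "i0 < j" "hit v i0 = hit v j" using descent_hit_before[OF jn j(2)] .
  have no_hit: "hit v k \<noteq> hit v l" if "j \<le> k" "k < l" for k
    using interleaved[OF j i0 that(2)] that(1) by auto
  have "hit v l \<in> inversions (prefix v j)"
    using inversions_unhit[of j l v "hit v l"] no_hit j l by (auto simp: descent_def)
  moreover have "i < k" if "i < j" "hit v i = hit v j" "k < j" "hit v k = hit v l" for i k
    using interleaved[OF j that(1,2) _ that(4)] that(3) j(1) by simp
  ultimately obtain y a b where y: "y \<in> carrier W" and ab: "a \<in> S" "b \<in> S" "ord (a \<otimes> b) \<noteq> 0"
    and rt: "{hit v j, hit v l} \<subseteq> (\<lambda>i. conjugate y ((a \<otimes> b) [^] i \<otimes> a)) ` {..<ord (a \<otimes> b)}"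
    using interleaved_descents_fan[OF jn j(2)] by blast
  define M where "M = ord (a \<otimes> b)"
  define m where "m = int M"
  obtain x t where x: "x \<in> carrier W" and fan: "reflection_fan m t"
    and t_ends: "t 0 = conjugate x a" "t (- 1) = conjugate x b"
    and t_range: "\<And>i. conjugate y ((a \<otimes> b) [^] (i::int) \<otimes> a) \<in> range t"
    using residue_fan[OF ab(1,2) y ab(3)] unfolding m_def M_def by blast
  have m: "m > 0" and t_inj: "inj_on t {0..<m}" and per: "\<And>i. t (i + m) = t i"
    and conj_t: "\<And>i j. conjugate (t i) (t j) = t (2 * i - j)"
    and seg: "\<And>z. z \<in> carrier W \<Longrightarrow> end_segment m {i \<in> {0..<m}. t i \<in> inversions z}"
    using fan by (auto simp: reflection_fan_def)
  note t_mod = fan_mod[of t m, OF per]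
  have in_range: "\<exists>i\<in>{0..<m}. t i = z" if z: "z \<in> range t" for z
  proof -
    obtain i where "z = t i" using z by auto
    then show ?thesis using t_mod[of i] m by (intro bexI[of _ "i mod m"]) auto
  qed
  have rt_range: "z \<in> range t" if z: "z \<in> {hit v j, hit v l}" for z
  proof -
    obtain i :: nat where "z = conjugate y ((a \<otimes> b) [^] i \<otimes> a)" using rt z by blast
    then have "z = conjugate y ((a \<otimes> b) [^] int i \<otimes> a)" by (simp add: int_pow_int)
    then show ?thesis using t_range[of "int i"] by simp
  qed
  obtain d where d: "d \<in> {0..<m}" "t d = hit v j" using in_range[OF rt_range, of "hit v j"] by blast
  obtain c where c: "c \<in> {0..<m}" "t c = hit v l" using in_range[OF rt_range, of "hit v l"] by blast
  have d_ne_c: "d \<noteq> c"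
  proof
    assume "d = c"
    then have "hit v i0 = hit v l" using i0 c d by simp
    then show False using interleaved[OF j i0, of i0] i0(1) j(1) by simp
  qed
  define K where "K = (\<lambda>k. {i \<in> {0..<m}. t i \<in> inversions (prefix v k)})"
  define wall where "wall = (\<lambda>k. if hit v k \<in> t ` {0..<m} then Some (inv_into {0..<m} t (hit v k)) else None)"
  have wall_iff: "wall k = Some i \<longleftrightarrow> i \<in> {0..<m} \<and> t i = hit v k" for k i
  proof
    assume "wall k = Some i"
    then have "hit v k \<in> t ` {0..<m}" "i = inv_into {0..<m} t (hit v k)"
      by (auto simp: wall_def split: if_splits)
    then show "i \<in> {0..<m} \<and> t i = hit v k" using inv_into_into f_inv_into_f by metis
  next
    assume i: "i \<in> {0..<m} \<and> t i = hit v k"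
    then have "hit v k \<in> t ` {0..<m}" by (metis imageI)
    moreover have "inv_into {0..<m} t (hit v k) = i" using inv_into_f_f[OF t_inj] i by metis
    ultimately show "wall k = Some i" by (simp add: wall_def)
  qed
  have K_toggle: "{i \<in> {0..<m}. t i \<in> sym_diff (inversions (prefix v k)) {hit v k}} =
      (case wall k of None \<Rightarrow> K k | Some i \<Rightarrow> sym_diff (K k) {i})" for k
  proof (cases "wall k")
    case None
    then have "t i \<noteq> hit v k" if "i \<in> {0..<m}" for i
      using that wall_iff[of k i] None by auto
    then show ?thesis using None by (auto simp: K_def)
  next
    case (Some a)
    then have a: "a \<in> {0..<m}" "t a = hit v k" using wall_iff by auto
    have "t i = hit v k \<longleftrightarrow> i = a" if "i \<in> {0..<m}" for i
      using inj_on_eq_iff[OF t_inj that a(1)] a(2) by simp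
    then show ?thesis using Some a(1) by (auto simp: K_def)
  qed
  interpret fan_gallery m l K wall c
  proof
    show "K 0 = {}" by (simp add: K_def)
    show "end_segment m (K k)" if "k \<le> l" for k
      unfolding K_def using that l by (intro seg) auto
    show "K (Suc k) = K k \<or> (\<exists>a. wall k = Some a \<and> K (Suc k) = sym_diff (K k) {a})" if "k < l" for k
    proof (cases "v ! k = 1")
      case True
      then have "K (Suc k) = (case wall k of None \<Rightarrow> K k | Some i \<Rightarrow> sym_diff (K k) {i})"
        using K_toggle[of k] inversions_prefix_Suc[of k v] that l by (simp add: K_def del: prefix.simps)
      then show ?thesis by (cases "wall k") auto
    next
      case False
      then show ?thesis by (simp add: K_def)
    qed
    show "0 \<le> a \<and> a < m \<and> end_segment m (sym_diff (K k) {a})" if "k \<le> l" "wall k = Some a" for k a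
    proof -
      have k: "k < n" using that l by simp
      have "end_segment m {i \<in> {0..<m}. t i \<in> inversions (prefix v k \<otimes> ss ! k)}"
        using k by (intro seg) auto
      then have "end_segment m (sym_diff (K k) {a})"
        using K_toggle[of k] that(2) k by (simp add: inversions_step hit_def)
      then show ?thesis using that(2) wall_iff by auto
    qed
    show "wall l = Some c" using wall_iff c by simp
    show "c \<in> K l" using c l(2) by (simp add: K_def descent_def)
    show "i < k \<and> k < j" if "j < l" "wall j = Some a" "a \<in> K j" "i < j" "wall i = Some a"
        "k < l" "wall k = Some c" for i j k a
    proof (rule interleaved)
      show "descent v j" using that(2,3) wall_iff by (simp add: descent_def K_def)
      show "hit v i = hit v j" using that(2,5) wall_iff by metis
      show "hit v k = hit v l" using that(7) wall_iff c by metis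
    qed (use that in auto)
  qed
  have "wall j = Some d" using wall_iff d by simp
  moreover have "d \<in> K j" using d j(2) by (simp add: K_def descent_def)
  ultimately obtain p b' s where p: "pattern p b' s" and all: "\<forall>a\<in>{0..<m}. \<exists>k<l. wall k = Some a"
    using pattern_exists[OF j(1)] by blast
  \<comment> \<open>All walls of the residue are hit by \<open>v\<close>, so they lie in the subgroup generated by the entries.\<close>
  have M_divisor: "M \<in> order_divisors W ss"
  proof -
    have refl: "t i \<in> generate W (set ss)" if "i \<in> {0..<m}" for i
    proof -
      have "\<exists>k<l. wall k = Some i" using all that by blast
      then obtain k where "k < l" "wall k = Some i" by blast
      then have "t i = hit v k" "k < n" using wall_iff[of k i] l by auto
      then show ?thesis using hit_parabolic[of k v] by simp
    qed
    have "conjugate x a \<in> generate W (set ss)" using refl[of 0] m t_ends by simp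
    moreover have "conjugate x b \<in> generate W (set ss)"
      using refl[of "m - 1"] m t_ends per[of "- 1"] by (simp add: algebra_simps)
    ultimately obtain a' b' where "a' \<in> set ss" "b' \<in> set ss" "ord (a' \<otimes> b') = M"
      using parabolic_rank_two[OF ss x ab(1,2)] unfolding M_def by blast
    moreover have "list_prod W [a', b'] = a' \<otimes> b'" using calculation ss by auto
    ultimately show ?thesis
      using m unfolding order_divisors_def m_def
      by (intro CollectI conjI exI[of _ "[a', b']"]) auto
  qed
  have M2: "2 \<le> M" using d_ne_c c(1) d(1) by (auto simp: m_def)
  have nat_m: "nat m = M" by (simp add: m_def)
  have increasing: "\<And>i. i \<le> M \<Longrightarrow> p i < p (Suc i)" and p_l: "p (Suc M) = l"
    and top: "\<exists>a\<in>K (p M). wall (p M) = Some a"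
    and walls: "\<And>i. i \<le> M \<Longrightarrow> wall (p i) = Some ((b' + s * int i) mod m)"
    and s: "s = 1 \<or> s = - 1"
    and c_cases: "c = (b' + s * (m - 1)) mod m \<or> c = (b' + s * (m + 1)) mod m"
    using p unfolding pattern_def nat_m by blast+
  define u where "u = (\<lambda>i. t (b' + s * i))"
  have u_fan: "conjugate (u i) (u j) = u (2 * i - j)" for i j
    unfolding u_def conj_t by (simp add: algebra_simps)
  have u_per: "u (i + int M) = u i" for i
    using s per[of "b' + i"] per[of "b' - i - m"] unfolding u_def m_def by (auto simp: algebra_simps)
  have hits: "hit v (p i) = u (int i)" if "i \<le> M" for i
  proof -
    have "t ((b' + s * int i) mod m) = hit v (p i)" using walls[OF that] wall_iff by blast
    then show ?thesis by (simp add: u_def t_mod)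
  qed
  have desc: "descent v (p M)"
  proof -
    obtain a where a: "a \<in> K (p M)" "wall (p M) = Some a" using top by blast
    then have "t a = hit v (p M)" using wall_iff by blast
    then show ?thesis using a(1) by (simp add: descent_def K_def)
  qed
  have desc_l: "descent v (p (Suc M))" "p (Suc M) < n" using l p_l by auto
  have p_lt: "p i < p k" if "i < k" "k \<le> Suc M" for i k
    by (rule p_less[OF v M2 M_divisor increasing desc_l(2) that])
  have wrap: "hit v (p 0) = hit v (p M)" using hits[of 0] hits[of M] u_per[of 0] by simp
  from c_cases show ?thesis
  proof
    assume "c = (b' + s * (m - 1)) mod m"
    then have end_hit: "hit v (p (Suc M)) = u (int M - 1)"
      using c(2) t_mod[of "b' + s * (m - 1)"] by (simp add: u_def p_l m_def)
    have "linked_at v {p 0, p M} {p (M - 1), p (Suc M)}"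
      using linked_straight_polygon[OF v M2 M_divisor increasing desc_l(2) u_fan _ hits end_hit desc desc_l(1)]
        u_per[of 0] by simp
    moreover have "hit v (p (M - 1)) = hit v l"
      using hits[of "M - 1"] end_hit M2 p_l by (simp add: of_nat_diff)
    ultimately show ?thesis
      using p_lt[of 0 M] p_lt[of M "Suc M"] p_lt[of "M - 1" "Suc M"] M2 desc wrap unfolding p_l
      by (intro exI[of _ "p 0"] exI[of _ "p M"] exI[of _ "p (M - 1)"]) auto
  next
    assume "c = (b' + s * (m + 1)) mod m"
    then have end_hit: "hit v (p (Suc M)) = u (int (Suc M))"
      using c(2) t_mod[of "b' + s * (m + 1)"] by (simp add: u_def p_l m_def add.commute)
    then have all_hits: "hit v (p i) = u (int i)" if "i \<le> Suc M" for i
      using hits[of i] that by (cases "i = Suc M") auto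
    have "linked_at v {p 1, p (Suc M)} {p 0, p M}"
      by (rule linked_turned_polygon[OF v M2 M_divisor increasing desc_l(2) u_fan u_per all_hits desc desc_l(1)])
    then have "linked_at v {p 0, p M} {p 1, p (Suc M)}" by (rule linked_sym)
    moreover have "hit v (p 1) = hit v l"
      using hits[of 1] end_hit M2 p_l u_per[of 1] by (simp add: add.commute)
    ultimately show ?thesis
      using p_lt[of 0 M] p_lt[of M "Suc M"] p_lt[of 1 "Suc M"] M2 desc wrap unfolding p_l
      by (intro exI[of _ "p 0"] exI[of _ "p M"] exI[of _ "p 1"]) auto
  qed
qed

lemma down_edges_same_top_linked:
  assumes v: "v \<in> V" and j: "j < n" "descent v j"
    and i: "i < j" "hit v i = hit v j" "i' < j" "hit v i' = hit v j"
  shows "linked_at v {i, j} {i', j}"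
proof (cases "i = i'")
  case True
  then show ?thesis by (simp add: linked_refl)
next
  case False
  show ?thesis
  proof (rule linked_triangle[OF v])
    have "sym_diff {i, j} {i', j} = {i, i'}" using False i by auto
    then show "card (sym_diff {i, j} {i', j}) = 2" using False by simp
  qed (use flip_vertex[OF v] i j in auto)
qed

text \<open>
  Linking \<open>j\<close> to some earlier descent is enough: descents before \<open>j\<close> are linked among
  themselves by induction.
\<close>
lemma down_edges_linked:
  assumes v: "v \<in> V"
    and "j < n" "descent v j" "i < j" "hit v i = hit v j"
    and "j' < j" "descent v j'" "i' < j'" "hit v i' = hit v j'"
  shows "linked_at v {i', j'} {i, j}"
  using assms(2-)
proof (induction j arbitrary: i i' j' rule: less_induct)
  case (less l)
  have "\<exists>i1 j1 k. i1 < j1 \<and> j1 < l \<and> descent v j1 \<and> hit v i1 = hit v j1 \<and> k < l \<and> hit v k = hit v l \<and>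
      linked_at v {i1, j1} {k, l}"
  proof (cases "\<forall>i j k. j < l \<longrightarrow> descent v j \<longrightarrow> i < j \<longrightarrow> hit v i = hit v j \<longrightarrow>
      k < l \<longrightarrow> hit v k = hit v l \<longrightarrow> i < k \<and> k < j")
    case True
    then show ?thesis using interleaved_descents_linked[OF v less.prems(1,2,5,6)] by blast
  next
    case False
    then show ?thesis using noninterleaved_descents_linked[OF v less.prems(1,2)] by blast
  qed
  then obtain i1 j1 k where 1: "i1 < j1" "j1 < l" "descent v j1" "hit v i1 = hit v j1"
    and k: "k < l" "hit v k = hit v l" "linked_at v {i1, j1} {k, l}" by blast
  have n: "j1 < n" "j' < n" using 1 less.prems by auto
  have "linked_at v {i', j'} {i1, j1}"
  proof (cases j' j1 rule: linorder_cases)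
    case less
    then show ?thesis using less.IH[of j1 i1 j' i'] 1 n less.prems by blast
  next
    case equal
    then show ?thesis using down_edges_same_top_linked[OF v] 1 n less.prems by blast
  next
    case greater
    then show ?thesis using less.IH[of j' i' j1 i1] 1 n less.prems by (blast intro: linked_sym)
  qed
  moreover have "linked_at v {k, l} {i, l}"
    using down_edges_same_top_linked[OF v] k less.prems by blast
  ultimately show ?case using k(3) by (blast intro: linked_trans)
qed

lemma peaks_linked:
  assumes "v \<in> V" "{v, x} \<in> E" "{v, y} \<in> E" "height x < height v" "height y < height v"
  shows "linked short_cycles height v x y"
proof -
  obtain i j where x: "i < j" "j < n" "hit v i = hit v j" "x = flip v {i, j}" "descent v j"
    using down_edge[OF assms(2,4)] .
  obtain i' j' where y: "i' < j'" "j' < n" "hit v i' = hit v j'" "y = flip v {i', j'}" "descent v j'"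
    using down_edge[OF assms(3,5)] .
  show ?thesis
  proof (cases j j' rule: linorder_cases)
    case less
    then show ?thesis using down_edges_linked[OF assms(1) y(2,5,1,3) less x(5,1,3)] x(4) y(4) by simp
  next
    case equal
    then show ?thesis using down_edges_same_top_linked[OF assms(1)] x y by blast
  next
    case greater
    then show ?thesis using down_edges_linked[OF assms(1) x(2,5,1,3) greater y(5,1,3)] x(4) y(4)
      by (simp add: linked_sym)
  qed
qed

lemma cycle_space_short_cycles: "cycle_space V E = f2_span short_cycles"
proof (rule cycle_space_by_peak_reduction[OF finite_E _ _ inj_on_height peaks_linked])
  show "short_cycles \<subseteq> cycle_space V E"
    by (auto simp: short_cycles_def intro: is_cycle_in_cycle_space)
  fix e assume "e \<in> E"
  then obtain x y where xy: "x \<in> V" "y \<in> V" "hamming_dist x y = 2" "e = {x, y}"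
    by (auto simp: subexpression_edges_def)
  then have "x \<noteq> y" by (auto simp: hamming_dist_def)
  then show "\<exists>x\<in>V. \<exists>y\<in>V. x \<noteq> y \<and> e = {x, y}" using xy by blast
qed

end

theorem theorem2:
  fixes W :: "('a, 'b) monoid_scheme" and S :: "'a set" and ss :: "'a list" and w :: 'a
  assumes "coxeter_system W S"
    and "set ss \<subseteq> S"
    and "w \<in> carrier W"
  shows "cycle_space (subexpressions W ss w) (subexpression_edges W ss w) =
    f2_span {C. is_cycle (subexpressions W ss w) (subexpression_edges W ss w) C \<and>
                card C \<in> {d + 2 | d. d \<in> order_divisors W ss}}"
proof -
  interpret group W using assms(1) by (simp add: coxeter_system_def)
  interpret expression W S ss w by unfold_locales (rule assms)+
  show ?thesis using cycle_space_short_cycles unfolding short_cycles_def .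
qed

end
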